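(* The class of parallel poly-pushdown ($\mathcal P$) groups is closed under wreath product: if $U$ and $T$ are $\mathcal P$ groups, then the standard wreath product $U\wr T$ is a $\mathcal P$ group.
   Context: **Wreath product.** $U\wr T$ is the standard (restricted) wreath product, i.e. the semidirect product $U^{[T]}\rtimes T$, where $U^{[T]}=\bigoplus_{t\in T}U$ is the group of finitely supported functions $T\to U$ and $T$ acts by translation of coordinates. **Languages.** For a finite alphabet $A$, $A^*$ is the free monoid on $A$ (words), $\epsilon$ is the empty word, and a language is a subset of $A^*$. **Deterministic pushdown automata.** A deterministic pushdown automaton is a 7-tuple $M=(S,A,B,\tau,s_0,Z_0,Y)$ with $S$ a finite set of states, $A$ a finite input alphabet, $B$ a finite stack alphabet, $s_0\in S$ the start state, $Z_0\in B$ the start symbol, $Y\subseteq S$ the final states, and $\tau:\Sigma\to S\times B^*$ a map with $\Sigma\subseteq (A\cup\{\epsilon\})\times B\times S$ such that for every $(b,s)\in B\times S$ either $(\epsilon,b,s)\in\Sigma$ and $(a,b,s)\notin\Sigma$ for all $a\in A$, or $(\epsilon,b,s)\notin\Sigma$ and $(a,b,s)\in\Sigma$ for all $a\in A$. An instantaneous description is a triple $(u,z,s)\in A^*\times B^*\times S$ (unread input, stack with top at the right end, state). $M$ makes the transition $(av,yb,s)\to(v,y\alpha,t)$ if $a\in A\cup\{\epsilon\}$, $b\in B$, $(a,b,s)\in \Sigma$ and $\tau(a,b,s)=(t,\alpha)$; $\to^*$ is the reflexive transitive closure. $M$ accepts $w$ by final state if $(w,Z_0,s_0)\to^*(\epsilon,z,s)$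 for some $z\in B^*$, $s\in Y$; it accepts $w$ by empty stack if $(w,Z_0,s_0)\to^*(\epsilon,\epsilon,s)$ for some $s\in S$. A language is the language of a deterministic pushdown automaton if it is the set of words accepted by some such $M$ in either one of these two modes. **$\mathcal P$ languages.** $L\subseteq A^*$ is parallel poly-pushdown ($\mathcal P$) if it is an intersection of finitely many languages over $A$ of deterministic pushdown automata. **Two-tape version.** Let $\$$ be a symbol not in $A$, and let $(A\cup\{\$\})^\sharp$, $(A\cup\{\$\})^\flat$ be two disjoint copies of $A\cup\{\$\}$, with induced maps on words $u\mapsto u^\sharp$, $v\mapsto v^\flat$. A shuffle $\sigma(u,v)$ of words $u,v$ is a word $u_1^\sharp v_1^\flat\cdots u_k^\sharp v_k^\flat$ with $u=u_1\cdots u_k$, $v=v_1\cdots v_k$, $u_i\ne\epsilon$ for $i>1$, $v_j\neq\epsilon$ for $j<k$. An asynchronous two-tape pushdown automaton over $A$ is a deterministic pushdown automaton $T$ with input alphabet $(A\cup\{\$\})^\sharp\sqcup (A\cup\{\$\})^\flat$ whose states are partitioned into two sets $S_\sharp,S_\flat$. A pair $(u,v)\in A^*\times A^*$ is accepted by $T$ if some shuffle $\sigma(u\$,v\$)$ is accepted by $T$ and, while reading it, $T$ reads letters of $(A\cup\{\$\})^\sharp$ only in states of $S_\sharp$ and letters of $(A\cup\{\$\})^\flat$ only in states of $S_\flat$. The language of $T$ is the set of accepted pairs. A subset of $A^*\times A^*$ is AT$\mathcal P$ (asynchronous two-tape parallel poly-pushdown) if it is the intersection of the languages of finitely many asynchronous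 two-tape pushdown automata over $A$. **$\mathcal P$ groups.** Let $G$ be a group and $A$ a finite set with a map $A\to G$ such that the induced monoid homomorphism $A^*\to G$, $w\mapsto\overline w$, is surjective. A language $L\subseteq A^*$ is a parallel poly-pushdown structure for $G$ if (1) $w\mapsto \overline w$ restricts to a bijection $L\to G$; (2) $L$ is $\mathcal P$; (3) for each $a\in A$ the set $\{(w,w')\in L\times L: \overline{w'}=\overline{wa}\}$ is AT$\mathcal P$. $G$ is parallel poly-pushdown (a $\mathcal P$ group) if it has such a structure for some such $A$. *)

theory Defs
  imports "HOL-Algebra.Product_Groups"
begin

section \<open>Wreath products\<close>

definition semidirect_product ::
  "('n, 'x) monoid_scheme \<Rightarrow> ('h, 'y) monoid_scheme \<Rightarrow> ('h \<Rightarrow> 'n \<Rightarrow> 'n) \<Rightarrow> ('n \<times> 'h) monoid"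
  where "semidirect_product N H \<alpha> =
    \<lparr>carrier = carrier N \<times> carrier H,
     monoid.mult = (\<lambda>(n, h) (n', h'). (n \<otimes>\<^bsub>N\<^esub> \<alpha> h n', h \<otimes>\<^bsub>H\<^esub> h')),
     one = (\<one>\<^bsub>N\<^esub>, \<one>\<^bsub>H\<^esub>)\<rparr>"

text \<open>The left action of \<open>T\<close> on functions defined on \<open>T\<close>.\<close>

definition translate :: "('t, 'y) monoid_scheme \<Rightarrow> 't \<Rightarrow> ('t \<Rightarrow> 'u) \<Rightarrow> ('t \<Rightarrow> 'u)"
  where "translate T t f = (\<lambda>x\<in>carrier T. f (inv\<^bsub>T\<^esub> t \<otimes>\<^bsub>T\<^esub> x))"

text \<open>\<^const>\<open>sum_group\<close> is the restricted direct product: its elements are the extensional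
  functions on \<^term>\<open>carrier T\<close> with values in \<open>U\<close> that differ from \<open>\<one>\<close> at finitely many points only.\<close>

definition wreath_product ::
  "('u, 'x) monoid_scheme \<Rightarrow> ('t, 'y) monoid_scheme \<Rightarrow> (('t \<Rightarrow> 'u) \<times> 't) monoid"
  where "wreath_product U T =
    semidirect_product (sum_group (carrier T) (\<lambda>_. U)) T (translate T)"


section \<open>Deterministic pushdown automata\<close>

text \<open>The partial transition function takes an element of \<open>A \<union> {\<epsilon>}\<close>, a stack symbol and a state;
  \<open>\<epsilon>\<close> is represented by \<^const>\<open>None\<close>. Its domain is the set \<open>\<Sigma>\<close>.\<close>

record ('a, 'b, 's) dpda =
  states :: "'s set"
  input_alph :: "'a set"
  stack_alph :: "'b set"
  trans :: "'a option \<times> 'b \<times> 's \<Rightarrow> ('s \<times> 'b list) option"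
  start_state :: 's
  start_symbol :: 'b
  final_states :: "'s set"

definition is_dpda :: "('a, 'b, 's) dpda \<Rightarrow> bool"
  where "is_dpda M \<longleftrightarrow>
    finite (states M) \<and> finite (input_alph M) \<and> finite (stack_alph M) \<and>
    start_state M \<in> states M \<and> start_symbol M \<in> stack_alph M \<and> final_states M \<subseteq> states M \<and>
    dom (trans M) \<subseteq> insert None (Some ` input_alph M) \<times> stack_alph M \<times> states M \<and>
    ran (trans M) \<subseteq> states M \<times> lists (stack_alph M) \<and>
    (\<forall>b\<in>stack_alph M. \<forall>s\<in>states M.
      ((None, b, s) \<in> dom (trans M) \<and> (\<forall>a\<in>input_alph M. (Some a, b, s) \<notin> dom (trans M))) \<or>
      ((None, b, s) \<notin> dom (trans M) \<and> (\<forall>a\<in>input_alph M. (Some a, b, s) \<in> dom (trans M))))"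

text \<open>Instantaneous descriptions: unread input, stack (with its top at the right end), state.\<close>

type_synonym ('a, 'b, 's) config = "'a list \<times> 'b list \<times> 's"

text \<open>Transitions are labelled by what they read: \<^term>\<open>Some a\<close> for a letter, \<^const>\<open>None\<close> for \<open>\<epsilon>\<close>.\<close>

inductive dpda_move ::
  "('a, 'b, 's) dpda \<Rightarrow> 'a option \<Rightarrow> ('a, 'b, 's) config \<Rightarrow> ('a, 'b, 's) config \<Rightarrow> bool"
  for M where
    read: "trans M (Some a, b, s) = Some (t, \<alpha>) \<Longrightarrow>
      dpda_move M (Some a) (a # v, y @ [b], s) (v, y @ \<alpha>, t)"
  | silent: "trans M (None, b, s) = Some (t, \<alpha>) \<Longrightarrow>
      dpda_move M None (v, y @ [b], s) (v, y @ \<alpha>, t)"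

definition dpda_step ::
  "('a, 'b, 's) dpda \<Rightarrow> ('a, 'b, 's) config \<Rightarrow> ('a, 'b, 's) config \<Rightarrow> bool"
  where "dpda_step M c c' \<longleftrightarrow> (\<exists>x. dpda_move M x c c')"

datatype acceptance = By_Final_State | By_Empty_Stack

fun accepting_configs ::
  "('a, 'b, 's) dpda \<Rightarrow> acceptance \<Rightarrow> ('a, 'b, 's) config set"
  where
    "accepting_configs M By_Final_State = {([], z, s) | z s. z \<in> lists (stack_alph M) \<and> s \<in> final_states M}"
  | "accepting_configs M By_Empty_Stack = {([], [], s) | s. s \<in> states M}"

definition dpda_lang :: "('a, 'b, 's) dpda \<Rightarrow> acceptance \<Rightarrow> 'a list set"
  where "dpda_lang M m =
    {w \<in> lists (input_alph M).
      \<exists>c\<in>accepting_configs M m. (dpda_step M)\<^sup>*\<^sup>* (w, [start_symbol M], start_state M) c}"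

text \<open>States and stack symbols are drawn from \<^typ>\<open>nat\<close>. As both sets are finite, this is
  no restriction up to renaming.\<close>

definition is_dpda_language :: "'a set \<Rightarrow> 'a list set \<Rightarrow> bool"
  where "is_dpda_language A L \<longleftrightarrow>
    (\<exists>(M :: ('a, nat, nat) dpda) m. is_dpda M \<and> input_alph M = A \<and> L = dpda_lang M m)"

text \<open>Requiring a nonempty family is harmless: the empty intersection would be \<^term>\<open>lists A\<close>,
  which is itself the language of a deterministic pushdown automaton. The same applies to
  the two-tape version below.\<close>

definition P_language :: "'a set \<Rightarrow> 'a list set \<Rightarrow> bool"
  where "P_language A L \<longleftrightarrow>
    (\<exists>F. finite F \<and> F \<noteq> {} \<and> (\<forall>K\<in>F. is_dpda_language A K) \<and> L = \<Inter>F)"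


section \<open>Asynchronous two-tape automata\<close>

text \<open>The set \<open>A \<union> {$}\<close> is represented in \<^typ>\<open>'a option\<close>, with \<^const>\<open>None\<close> for \<open>$\<close>, and the two
  disjoint copies (sharp and flat) of it by \<^const>\<open>Inl\<close> and \<^const>\<open>Inr\<close>. Beware that inside the
  label of a \<^const>\<open>dpda_move\<close> the outermost \<^const>\<open>None\<close> still means \<open>\<epsilon>\<close>.\<close>

type_synonym 'a tape_letter = "'a option + 'a option"

definition two_tape_alph :: "'a set \<Rightarrow> 'a tape_letter set"
  where "two_tape_alph A = insert None (Some ` A) <+> insert None (Some ` A)"

definition with_end :: "'a list \<Rightarrow> 'a option list"
  where "with_end u = map Some u @ [None]"

definition tape_shuffles :: "'b list \<Rightarrow> 'b list \<Rightarrow> ('b + 'b) list set"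
  where "tape_shuffles u v =
    {concat (map2 (\<lambda>x y. map Inl x @ map Inr y) us vs) | us vs.
      length us = length vs \<and> concat us = u \<and> concat vs = v \<and>
      (\<forall>i. 0 < i \<and> i < length us \<longrightarrow> us ! i \<noteq> []) \<and>
      (\<forall>j. Suc j < length vs \<longrightarrow> vs ! j \<noteq> [])}"

text \<open>A transition that reads a letter of the sharp (flat) tape has to start in a
  state of \<open>S1\<close> (of \<open>S2\<close>).\<close>

definition two_tape_step ::
  "('a tape_letter, 'b, 's) dpda \<Rightarrow> 's set \<Rightarrow> 's set \<Rightarrow>
    ('a tape_letter, 'b, 's) config \<Rightarrow> ('a tape_letter, 'b, 's) config \<Rightarrow> bool"
  where "two_tape_step M S1 S2 = (\<lambda>(w, z, s) c'.
    \<exists>x. dpda_move M x (w, z, s) c' \<and>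
      (\<forall>l. x = Some (Inl l) \<longrightarrow> s \<in> S1) \<and> (\<forall>l. x = Some (Inr l) \<longrightarrow> s \<in> S2))"

definition two_tape_lang ::
  "'a set \<Rightarrow> ('a tape_letter, 'b, 's) dpda \<Rightarrow> 's set \<Rightarrow> 's set \<Rightarrow> acceptance \<Rightarrow> ('a list \<times> 'a list) set"
  where "two_tape_lang A M S1 S2 m =
    {(u, v). u \<in> lists A \<and> v \<in> lists A \<and>
      (\<exists>w\<in>tape_shuffles (with_end u) (with_end v). \<exists>c\<in>accepting_configs M m.
        (two_tape_step M S1 S2)\<^sup>*\<^sup>* (w, [start_symbol M], start_state M) c)}"

definition is_two_tape_language :: "'a set \<Rightarrow> ('a list \<times> 'a list) set \<Rightarrow> bool"
  where "is_two_tape_language A R \<longleftrightarrow>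
    (\<exists>(M :: ('a tape_letter, nat, nat) dpda) S1 S2 m.
      is_dpda M \<and> input_alph M = two_tape_alph A \<and>
      states M = S1 \<union> S2 \<and> S1 \<inter> S2 = {} \<and>
      R = two_tape_lang A M S1 S2 m)"

definition ATP_language :: "'a set \<Rightarrow> ('a list \<times> 'a list) set \<Rightarrow> bool"
  where "ATP_language A R \<longleftrightarrow>
    (\<exists>F. finite F \<and> F \<noteq> {} \<and> (\<forall>K\<in>F. is_two_tape_language A K) \<and> R = \<Inter>F)"


section \<open>Parallel poly-pushdown groups\<close>

definition word_value :: "('g, 'x) monoid_scheme \<Rightarrow> ('a \<Rightarrow> 'g) \<Rightarrow> 'a list \<Rightarrow> 'g"
  where "word_value G \<phi> w = foldr (\<lambda>a g. \<phi> a \<otimes>\<^bsub>G\<^esub> g) w \<one>\<^bsub>G\<^esub>"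

definition P_structure ::
  "('g, 'x) monoid_scheme \<Rightarrow> 'a set \<Rightarrow> ('a \<Rightarrow> 'g) \<Rightarrow> 'a list set \<Rightarrow> bool"
  where "P_structure G A \<phi> L \<longleftrightarrow>
    L \<subseteq> lists A \<and>
    bij_betw (word_value G \<phi>) L (carrier G) \<and>
    P_language A L \<and>
    (\<forall>a\<in>A. ATP_language A
      {(w, w'). w \<in> L \<and> w' \<in> L \<and> word_value G \<phi> w' = word_value G \<phi> (w @ [a])})"

text \<open>The letters of the finite alphabet are drawn from \<^typ>\<open>nat\<close>, again without loss of generality.\<close>

definition P_group :: "('g, 'x) monoid_scheme \<Rightarrow> bool"
  where "P_group G \<longleftrightarrow> group G \<and>
    (\<exists>(A :: nat set) \<phi> L.
      finite A \<and> \<phi> \<in> A \<rightarrow> carrier G \<and> word_value G \<phi> ` lists A = carrier G \<and>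
      P_structure G A \<phi> L)"

end

theory Submission
  imports Defs "HOL-Library.Countable" "HOL-Library.List_Lexorder"
begin

text \<open>An element \<open>(f, t)\<close> of the wreath product is spelled
  \<open>v\<^sub>1 x\<^sub>1 v\<^sub>1\<inverse> \<dots> v\<^sub>k x\<^sub>k v\<^sub>k\<inverse> w\<close>, where \<open>w\<close> represents \<open>t\<close>, the words \<open>v\<^sub>i\<close> represent the points of
  the support of \<open>f\<close> and \<open>t\<close> in lexicographic order, and \<open>x\<^sub>i\<close> represents the value of \<open>f\<close> at \<open>v\<^sub>i\<close>.
  The \<open>v\<^sub>i\<inverse>\<close> are spelled in formal inverse letters: a stack can match them with \<open>v\<^sub>i\<close>, and once they
  have been pushed their first letter is on top, ready for the comparison with \<open>v\<^sub>i\<^sub>+\<^sub>1\<close>.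
  The block with \<open>v\<^sub>i = w\<close> carries a mark. A generator of \<open>U\<close> then changes only the \<open>x\<^sub>i\<close> of the marked
  block, and a generator of \<open>T\<close> changes only the marks, \<open>w\<close> and the presence of a trivial marked block.
  So each multiplication relation is the intersection of an equality of two transduced words with
  the preimage of a relation of \<open>U\<close> or \<open>T\<close> under a transducer.

  Membership of all \<open>v\<^sub>i\<close> and \<open>x\<^sub>i\<close> in the given structures requires to stop an automaton in the middle
  of the input, to know whether it accepts, and to restart it. Silent moves that never end are
  in the way; they are removed by passing to machines whose silent moves only pop.\<close>

section \<open>Deterministic machines whose silent moves only pop\<close>

text \<open>The given structures are only finite intersections of languages of deterministic
  automata. An operation on such languages carries over to their intersections if it commutes with
  nonempty intersections. Preimages under transducers and conditions on all factors of a word do so;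
  images and concatenations in general do not. This is why normal forms are described by a
  conjunction of tests, each of which asks the same of all blocks or looks at one fixed place, and
  why the relations of \<open>U\<close> and \<open>T\<close> are pulled back along transducers and
  never pushed forward. Since intersections cost nothing, every test has a stack of its own. Both
  acceptance modes, and one tape as well as two, are reduced to a single notion: a function of the
  word read so far, computed by a machine that has an output after every prefix. On two tapes the
  output also names the tape to be read next, so the shuffle is determined by the two words and need
  not be guessed.\<close>

record ('a, 'b, 's, 'x) popm =
  pstates :: "'s set"
  psyms :: "'b set"
  pop :: "'s \<Rightarrow> 'b \<Rightarrow> 's option"
  rd :: "'a \<Rightarrow> 's \<Rightarrow> 'b option \<Rightarrow> 's \<times> 'b list"
  out :: "'s \<Rightarrow> 'b option \<Rightarrow> 'x"
  pinit :: "'b list \<times> 's"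

definition hdo :: "'b list \<Rightarrow> 'b option"
  where "hdo z = (case z of [] \<Rightarrow> None | b # _ \<Rightarrow> Some b)"

lemma hdo_simps [simp]: "hdo [] = None" "hdo (b # z) = Some b"
  by (simp_all add: hdo_def)

fun settle :: "('s \<Rightarrow> 'b \<Rightarrow> 's option) \<Rightarrow> 'b list \<Rightarrow> 's \<Rightarrow> 'b list \<times> 's"
  where
    "settle p [] s = ([], s)"
  | "settle p (b # z) s = (case p s b of None \<Rightarrow> (b # z, s) | Some t \<Rightarrow> settle p z t)"

text \<open>Reading removes the top symbol and then settles at once, so between letters no silent
  move is pending and every prefix has an output. On the empty stack \<open>rd\<close> and
  \<open>out\<close> get \<open>None\<close> and still act, so the machine never jams.\<close>

definition pstep :: "('a, 'b, 's, 'x) popm \<Rightarrow> 'b list \<times> 's \<Rightarrow> 'a \<Rightarrow> 'b list \<times> 's"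
  where "pstep N c a =
    (case rd N a (snd c) (hdo (fst c)) of (t, \<alpha>) \<Rightarrow> settle (pop N) (\<alpha> @ tl (fst c)) t)"

definition pstart :: "('a, 'b, 's, 'x) popm \<Rightarrow> 'b list \<times> 's"
  where "pstart N = settle (pop N) (fst (pinit N)) (snd (pinit N))"

definition prun :: "('a, 'b, 's, 'x) popm \<Rightarrow> 'a list \<Rightarrow> 'b list \<times> 's"
  where "prun N w = foldl (pstep N) (pstart N) w"

definition outc :: "('a, 'b, 's, 'x) popm \<Rightarrow> 'b list \<times> 's \<Rightarrow> 'x"
  where "outc N c = out N (snd c) (hdo (fst c))"

definition popm_ok :: "'a set \<Rightarrow> ('a, 'b, 's, 'x) popm \<Rightarrow> bool"
  where "popm_ok A N \<longleftrightarrow> finite (pstates N) \<and> finite (psyms N) \<and>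
    pinit N \<in> lists (psyms N) \<times> pstates N \<and>
    (\<forall>s\<in>pstates N. \<forall>b\<in>psyms N. \<forall>t. pop N s b = Some t \<longrightarrow> t \<in> pstates N) \<and>
    (\<forall>a\<in>A. \<forall>s\<in>pstates N. \<forall>b\<in>insert None (Some ` psyms N).
      rd N a s b \<in> pstates N \<times> lists (psyms N))"

text \<open>\<open>F\<close> is the output of such a machine on reading the words over \<open>A\<close>.\<close>

definition pdfun :: "'a set \<Rightarrow> ('a list \<Rightarrow> 'x) \<Rightarrow> bool"
  where "pdfun A F \<longleftrightarrow>
    (\<exists>N :: ('a, nat, nat, 'x) popm. popm_ok A N \<and> (\<forall>w\<in>lists A. F w = outc N (prun N w)))"

lemma prun_Nil [simp]: "prun N [] = pstart N"
  and prun_snoc [simp]: "prun N (w @ [a]) = pstep N (prun N w) a"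
  by (simp_all add: prun_def)

lemma settle_closed:
  assumes "z \<in> lists B" "s \<in> S"
    and "\<And>s b t. s \<in> S \<Longrightarrow> b \<in> B \<Longrightarrow> p s b = Some t \<Longrightarrow> t \<in> S"
  shows "settle p z s \<in> lists B \<times> S"
  using assms(1,2)
  by (induction z arbitrary: s) (auto split: option.split dest: assms(3))

lemma hdo_closed: "z \<in> lists B \<Longrightarrow> hdo z \<in> insert None (Some ` B)"
  by (cases z) auto

lemma settle_rename:
  assumes "\<And>s b. q (f s) (g b) = map_option f (p s b)"
  shows "settle q (map g z) (f s) = map_prod (map g) f (settle p z s)"
  by (induction z arbitrary: s) (auto simp: assms split: option.split)

text \<open>An existential quantifier cannot range over types, so \<open>pdfun\<close> fixes
  \<open>nat\<close>. Renaming along \<open>to_nat\<close> makes products, options and datatypes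
  available as states and stack symbols.\<close>

lemma pdfunI:
  fixes N :: "('a, 'b :: countable, 's :: countable, 'x) popm"
  assumes ok: "popm_ok A N" and F: "\<And>w. w \<in> lists A \<Longrightarrow> F w = outc N (prun N w)"
  shows "pdfun A F"
proof -
  define f :: "'s \<Rightarrow> nat" where "f = to_nat"
  define g :: "'b \<Rightarrow> nat" where "g = to_nat"
  have [simp]: "from_nat (f s) = s" "from_nat (g b) = b" for s b by (simp_all add: f_def g_def)
  define N' :: "('a, nat, nat, 'x) popm" where "N' =
    \<lparr>pstates = f ` pstates N, psyms = g ` psyms N,
     pop = (\<lambda>s b. map_option f (pop N (from_nat s) (from_nat b))),
     rd = (\<lambda>a s b. map_prod f (map g) (rd N a (from_nat s) (map_option from_nat b))),
     out = (\<lambda>s b. out N (from_nat s) (map_option from_nat b)),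
     pinit = map_prod (map g) f (pinit N)\<rparr>"
  have hd: "hdo (map g z) = map_option g (hdo z)" for z by (cases z) auto
  have [simp]: "map_option from_nat (map_option g b) = b" for b by (cases b) auto
  have st: "settle (pop N') (map g z) (f s) = map_prod (map g) f (settle (pop N) z s)" for z s
    by (rule settle_rename) (simp add: N'_def)
  have step: "pstep N' (map_prod (map g) f c) a = map_prod (map g) f (pstep N c a)" for c a
  proof -
    obtain t \<alpha> where r: "rd N a (snd c) (hdo (fst c)) = (t, \<alpha>)" by fastforce
    then have "rd N' a (f (snd c)) (map_option g (hdo (fst c))) = (f t, map g \<alpha>)"
      by (simp add: N'_def)
    then show ?thesis
      by (simp add: pstep_def hd r map_tl[symmetric] st[symmetric])
  qed
  have run: "prun N' w = map_prod (map g) f (prun N w)" for w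
  proof (induction w rule: rev_induct)
    case Nil
    have "pinit N' = map_prod (map g) f (pinit N)" by (simp add: N'_def)
    then show ?case by (simp add: pstart_def st)
  qed (simp add: step)
  have o: "outc N' (map_prod (map g) f c) = outc N c" for c
    by (simp add: outc_def hd) (simp add: N'_def)
  have cl: "rd N a s b \<in> pstates N \<times> lists (psyms N)"
    if "a \<in> A" "s \<in> pstates N" "b = None \<or> (\<exists>x\<in>psyms N. b = Some x)" for a s b
    using that ok unfolding popm_ok_def by blast
  have "rd N' a s b \<in> pstates N' \<times> lists (psyms N')"
    if a: "a \<in> A" and s: "s \<in> pstates N'" and b: "b \<in> insert None (Some ` psyms N')" for a s b
  proof -
    obtain s' where s': "s = f s'" "s' \<in> pstates N" using s by (auto simp: N'_def)
    have "\<exists>b'. b = map_option g b' \<and> (b' = None \<or> (\<exists>x\<in>psyms N. b' = Some x))"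
      using b unfolding N'_def
      by (auto intro: exI[of _ None] exI[of _ "Some _"])
    then obtain b' where b': "b = map_option g b'" "b' = None \<or> (\<exists>x\<in>psyms N. b' = Some x)"
      by blast
    show ?thesis using cl[OF a s'(2) b'(2)] by (auto simp: N'_def s'(1) b'(1))
  qed
  moreover have "pinit N' \<in> lists (psyms N') \<times> pstates N'"
    using ok by (auto simp: N'_def popm_ok_def)
  moreover have "\<forall>s\<in>pstates N'. \<forall>b\<in>psyms N'. \<forall>t. pop N' s b = Some t \<longrightarrow> t \<in> pstates N'"
    using ok by (auto simp: N'_def popm_ok_def)
  moreover have "finite (pstates N')" "finite (psyms N')"
    using ok by (auto simp: N'_def popm_ok_def)
  ultimately have "popm_ok A N'" unfolding popm_ok_def by blast
  then show ?thesis unfolding pdfun_def using F run o by metis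
qed

lemma pdfun_cong: "pdfun A F \<Longrightarrow> (\<And>w. w \<in> lists A \<Longrightarrow> F w = G w) \<Longrightarrow> pdfun A G"
  unfolding pdfun_def by metis

lemma pdfun_const: "pdfun A (\<lambda>_. x)"
proof -
  define N :: "('a, nat, nat, 'b) popm" where "N = \<lparr>pstates = {0}, psyms = {}, pop = (\<lambda>_ _. None),
    rd = (\<lambda>_ _ _. (0, [])), out = (\<lambda>_ _. x), pinit = ([], 0)\<rparr>"
  have "popm_ok A N" by (auto simp: popm_ok_def N_def)
  then show ?thesis by (rule pdfunI) (simp add: outc_def N_def)
qed

subsection \<open>Finite controllers\<close>

datatype 'a command = Nop | Reset | Feed 'a

fun exec :: "'a command \<Rightarrow> 'a list \<Rightarrow> 'a list"
  where "exec Nop w = w" | "exec Reset w = []" | "exec (Feed a) w = w @ [a]"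

text \<open>The controller sees the output on the word fed so far before it decides. So it can
  evaluate a run in the middle of the input and restart the machine on the empty word.\<close>

fun cstep ::
  "('a list \<Rightarrow> 'x) \<Rightarrow> ('q \<Rightarrow> 'c \<Rightarrow> 'x \<Rightarrow> 'q \<times> 'a command) \<Rightarrow> 'q \<times> 'a list \<Rightarrow> 'c \<Rightarrow> 'q \<times> 'a list"
  where "cstep F act (q, w) c = (case act q c (F w) of (q', m) \<Rightarrow> (q', exec m w))"


text \<open>A reset does not clear the stack, it buries it under a barrier \<^const>\<open>None\<close>,
  which the controlled machine cannot tell from the empty stack.\<close>

lemma pdfun_control:
  fixes act :: "'q :: countable \<Rightarrow> 'c \<Rightarrow> 'x \<Rightarrow> 'q \<times> 'a command"
    and ob :: "'q \<Rightarrow> 'x \<Rightarrow> 'y"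
  assumes F: "pdfun A F" and Q: "finite Q" "q0 \<in> Q"
    and act: "\<And>q c x q' m. q \<in> Q \<Longrightarrow> c \<in> C \<Longrightarrow> act q c x = (q', m) \<Longrightarrow>
        q' \<in> Q \<and> (\<forall>a. m = Feed a \<longrightarrow> a \<in> A)"
  shows "pdfun C (\<lambda>v. case foldl (cstep F act) (q0, []) v of (q, w) \<Rightarrow> ob q (F w))"
proof -
  obtain N :: "('a, nat, nat, 'x) popm" where ok: "popm_ok A N"
    and N: "\<And>w. w \<in> lists A \<Longrightarrow> F w = outc N (prun N w)"
    using F unfolding pdfun_def by blast
  \<comment> \<open>Since \<open>rd\<close> removes the top symbol, \<open>Nop\<close> and
    \<open>Reset\<close> have to put it back: this is \<open>sing\<close>. The function
    \<open>jn\<close> makes the empty stack and a barrier on top look alike to \<open>N\<close>, and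
    \<open>Feed\<close> restores a barrier that was on top.\<close>
  define sing :: "nat option option \<Rightarrow> nat option list" where
    "sing b = (case b of None \<Rightarrow> [] | Some x \<Rightarrow> [x])" for b
  define jn :: "nat option option \<Rightarrow> nat option" where "jn b = Option.bind b id" for b
  define N' :: "('c, nat option, nat \<times> 'q, 'y) popm" where "N' =
    \<lparr>pstates = pstates N \<times> Q, psyms = insert None (Some ` psyms N),
     pop = (\<lambda>(s, q) b. case b of None \<Rightarrow> None | Some b \<Rightarrow> map_option (\<lambda>t. (t, q)) (pop N s b)),
     rd = (\<lambda>c (s, q) b. case act q c (out N s (jn b)) of (q', m) \<Rightarrow> (case m of
         Nop \<Rightarrow> ((s, q'), sing b)
       | Reset \<Rightarrow> ((snd (pinit N), q'), map Some (fst (pinit N)) @ None # sing b)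
       | Feed a \<Rightarrow> (case rd N a s (jn b) of (t, \<alpha>) \<Rightarrow>
           ((t, q'), map Some \<alpha> @ (if b = Some None then [None] else []))))),
     out = (\<lambda>(s, q) b. ob q (out N s (jn b))),
     pinit = (map Some (fst (pinit N)), (snd (pinit N), q0))\<rparr>"
  \<comment> \<open>\<open>Y\<close> ranges over what earlier resets have buried; settling cannot
    get past its barrier.\<close>
  define bot where "bot Y \<longleftrightarrow> Y = [] \<or> hd Y = (None :: nat option)" for Y
  have st: "settle (pop N') (map Some z @ Y) (s, q) =
      (case settle (pop N) z s of (z', s') \<Rightarrow> (map Some z' @ Y, (s', q)))" if "bot Y" for z Y s q
  proof (induction z arbitrary: s)
    case Nil
    then show ?case using \<open>bot Y\<close> by (cases Y) (auto simp: N'_def bot_def)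
  next
    case (Cons b z)
    then show ?case by (simp add: N'_def split: option.split)
  qed
  have jn: "jn (hdo (map Some z @ Y)) = hdo z" if "bot Y" for z Y
    using that by (cases z; cases Y) (auto simp: bot_def jn_def)
  \<comment> \<open>After \<open>Nop\<close> the simulated stack is settled once more, so settled
    configurations have to be fixed points.\<close>
  have idem: "settle p (fst (settle p z s)) (snd (settle p z s)) = settle p z s"
    for p :: "nat \<Rightarrow> nat \<Rightarrow> nat option" and z s
    by (induction z arbitrary: s) (auto split: option.split)
  have settled: "settle (pop N) z s = (z, s)" if "prun N w = (z, s)" for z s w
  proof -
    have "\<exists>z' s'. prun N w = settle (pop N) z' s'"
      by (cases w rule: rev_cases) (simp_all add: pstart_def pstep_def case_prod_beta, blast+)
    then obtain z' s' where "prun N w = settle (pop N) z' s'" by blast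
    then show ?thesis using that idem[of "pop N" z' s'] by (metis fst_conv snd_conv)
  qed
  \<comment> \<open>Invariant: above the buried part \<open>Y\<close>, the new machine is in the
    configuration that \<open>N\<close> reaches on the controlled word \<open>w\<close>.\<close>
  define good where "good v \<longleftrightarrow> (\<exists>q w z s Y. foldl (cstep F act) (q0, []) v = (q, w) \<and> q \<in> Q \<and>
     w \<in> lists A \<and> bot Y \<and> prun N w = (z, s) \<and> prun N' v = (map Some z @ Y, (s, q)))" for v
  have goodI: "good v" if "foldl (cstep F act) (q0, []) v = (q, w)" "q \<in> Q"
     "w \<in> lists A" "bot Y" "prun N w = (z, s)" "prun N' v = (map Some z @ Y, (s, q))" for v q w z s Y
    unfolding good_def using that by blast
  have good: "good v" if "v \<in> lists C" for v
    using that
  proof (induction v rule: rev_induct)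
    case Nil
    obtain z s where zs: "pstart N = (z, s)" by fastforce
    have "pstart N' = (map Some z @ [], (s, q0))"
      using st[of "[]" "fst (pinit N)" "snd (pinit N)" q0] zs
      by (simp add: bot_def pstart_def) (simp add: N'_def)
    then show ?case using Q zs by (intro goodI[of _ q0 "[]" "[]" z s]) (auto simp: bot_def)
  next
    case (snoc c v)
    then have "good v" and c: "c \<in> C" by auto
    then obtain q w z s Y where f: "foldl (cstep F act) (q0, []) v = (q, w)" and q: "q \<in> Q" and w: "w \<in> lists A"
      and Y: "bot Y" and zs: "prun N w = (z, s)" and run: "prun N' v = (map Some z @ Y, (s, q))"
      unfolding good_def by blast
    have F: "F w = out N s (hdo z)" using N[OF w] by (simp add: zs outc_def)
    obtain q' m where a: "act q c (F w) = (q', m)" by fastforce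
    have q': "q' \<in> Q" and m: "m = Feed a \<Longrightarrow> a \<in> A" for a using act[OF q c a] by auto
    have f': "foldl (cstep F act) (q0, []) (v @ [c]) = (q', exec m w)"
      by (simp add: f a)
    have run': "prun N' (v @ [c]) = pstep N' (map Some z @ Y, (s, q)) c" by (simp add: run)
    have sing: "sing (hdo X) @ tl X = X" for X by (cases X) (auto simp: sing_def)
    show ?case
    proof (cases m)
      case Nop
      have "rd N' c (s, q) (hdo (map Some z @ Y)) = ((s, q'), sing (hdo (map Some z @ Y)))"
        by (simp add: N'_def jn[OF Y] F[symmetric] a Nop)
      then have "prun N' (v @ [c]) = (map Some z @ Y, (s, q'))"
        unfolding run' by (simp add: pstep_def sing st[OF Y] settled[OF zs])
      then show ?thesis by (intro goodI[OF _ q' w Y zs]) (simp_all add: f a Nop)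
    next
      case Reset
      have r: "rd N' c (s, q) (hdo (map Some z @ Y)) =
          ((snd (pinit N), q'), map Some (fst (pinit N)) @ None # sing (hdo (map Some z @ Y)))"
        by (simp add: N'_def jn[OF Y] F[symmetric] a Reset)
      have Y': "bot (None # map Some z @ Y)" by (simp add: bot_def)
      obtain z' s' where zs': "pstart N = (z', s')" by fastforce
      have "prun N' (v @ [c]) = (map Some z' @ None # map Some z @ Y, (s', q'))"
        unfolding run' using zs' by (simp add: pstep_def r sing st[OF Y'] pstart_def)
      then show ?thesis using zs' by (intro goodI[OF _ q' _ Y', of _ "[]"]) (simp_all add: f a Reset)
    next
      case (Feed a')
      obtain t \<alpha> where t: "rd N a' s (hdo z) = (t, \<alpha>)" by fastforce
      have r: "rd N' c (s, q) (hdo (map Some z @ Y)) =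
          ((t, q'), map Some \<alpha> @ (if hdo (map Some z @ Y) = Some None then [None] else []))"
        by (simp add: N'_def jn[OF Y] F[symmetric] a Feed t)
      have e: "(if hdo (map Some z @ Y) = Some None then [None] else []) @ tl (map Some z @ Y) = map Some (tl z) @ Y"
        using Y by (cases z; cases Y) (auto simp: bot_def)
      obtain z' s' where zs': "settle (pop N) (\<alpha> @ tl z) t = (z', s')" by fastforce
      then have p: "prun N (w @ [a']) = (z', s')" by (simp add: zs pstep_def t)
      have "prun N' (v @ [c]) = (map Some z' @ Y, (s', q'))"
        unfolding run' using st[OF Y, of "\<alpha> @ tl z" t q'] zs' by (simp add: pstep_def r e)
      then show ?thesis using w m[OF Feed] by (intro goodI[OF _ q' _ Y p]) (simp_all add: f a Feed)
    qed
  qed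
  have "popm_ok C N'"
  proof -
    have init: "fst (pinit N) \<in> lists (psyms N)" "snd (pinit N) \<in> pstates N"
      using ok by (auto simp: popm_ok_def)
    have rdN: "rd N a s b \<in> pstates N \<times> lists (psyms N)"
      if "a \<in> A" "s \<in> pstates N" "b \<in> insert None (Some ` psyms N)" for a s b
      using ok that unfolding popm_ok_def by blast
    have "rd N' c sq b \<in> pstates N' \<times> lists (psyms N')"
      if c: "c \<in> C" and sq: "sq \<in> pstates N'" and b: "b \<in> insert None (Some ` psyms N')" for c sq b
    proof -
      obtain s q where [simp]: "sq = (s, q)" and s: "s \<in> pstates N" and q: "q \<in> Q"
        using sq by (auto simp: N'_def)
      have jb: "jn b \<in> insert None (Some ` psyms N)" using b by (auto simp: jn_def N'_def)
      have sb: "sing b \<in> lists (psyms N')" using b by (auto simp: sing_def)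
      obtain q' m where a: "act q c (out N s (jn b)) = (q', m)" by fastforce
      have q': "q' \<in> Q" and m: "m = Feed a \<Longrightarrow> a \<in> A" for a using act[OF q c a] by auto
      show ?thesis
      proof (cases m)
        case Nop
        then show ?thesis using a q' s sb by (simp add: N'_def)
      next
        case Reset
        then show ?thesis using a q' sb init by (auto simp: N'_def)
      next
        case (Feed a')
        then show ?thesis using a q' rdN[OF m[OF Feed] s jb]
          by (auto simp: N'_def split: prod.split)
      qed
    qed
    moreover have "\<forall>s\<in>pstates N'. \<forall>b\<in>psyms N'. \<forall>t. pop N' s b = Some t \<longrightarrow> t \<in> pstates N'"
      using ok by (auto simp: N'_def popm_ok_def)
    moreover have "finite (pstates N')" "finite (psyms N')"
      using ok Q by (auto simp: N'_def popm_ok_def)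
    moreover have "pinit N' \<in> lists (psyms N') \<times> pstates N'"
      using init Q by (auto simp: N'_def)
    ultimately show ?thesis unfolding popm_ok_def by blast
  qed
  then show ?thesis
  proof (rule pdfunI)
    fix v assume "v \<in> lists C"
    from good[OF this] obtain q w z s Y where f: "foldl (cstep F act) (q0, []) v = (q, w)"
      and w: "w \<in> lists A" and Y: "bot Y" and zs: "prun N w = (z, s)" and run: "prun N' v = (map Some z @ Y, (s, q))"
      unfolding good_def by blast
    show "(case foldl (cstep F act) (q0, []) v of (q, w) \<Rightarrow> ob q (F w)) = outc N' (prun N' v)"
      using N[OF w] by (simp add: f run outc_def jn[OF Y] zs) (simp add: N'_def jn[OF Y])
  qed
qed

text \<open>The automaton is a controller; the machine below it is trivial and never fed.\<close>

lemma pdfun_finite_automaton: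
  fixes \<delta> :: "'q :: countable \<Rightarrow> 'c \<Rightarrow> 'q"
  assumes "finite Q" "q0 \<in> Q" "\<And>q c. q \<in> Q \<Longrightarrow> c \<in> C \<Longrightarrow> \<delta> q c \<in> Q"
  shows "pdfun C (\<lambda>v. h (foldl \<delta> q0 v))"
proof -
  let ?act = "\<lambda>q c (x :: unit). (\<delta> q c, Nop :: unit command)"
  have "foldl (cstep (\<lambda>_. ()) ?act) (q0, w) v = (foldl \<delta> q0 v, w)" for v w
    by (induction v arbitrary: q0) auto
  then show ?thesis
    using pdfun_control[OF pdfun_const[of UNIV "()"], of Q q0 C ?act "\<lambda>q _. h q"] assms by auto
qed

section \<open>Runs of pushdown automata\<close>

text \<open>From here on a configuration without its input is a pair of a stack and a state, where the stack
  has its top at the head.\<close>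

definition estep :: "('a, 'b, 's) dpda \<Rightarrow> 'b list \<times> 's \<Rightarrow> ('b list \<times> 's) option"
  where "estep M c = (case fst c of [] \<Rightarrow> None
    | b # y \<Rightarrow> map_option (\<lambda>(t, \<alpha>). (rev \<alpha> @ y, t)) (trans M (None, b, snd c)))"

definition rstep :: "('a, 'b, 's) dpda \<Rightarrow> 'a \<Rightarrow> 'b list \<times> 's \<Rightarrow> ('b list \<times> 's) option"
  where "rstep M a c = (case fst c of [] \<Rightarrow> None
    | b # y \<Rightarrow> map_option (\<lambda>(t, \<alpha>). (rev \<alpha> @ y, t)) (trans M (Some a, b, snd c)))"

definition erel :: "('a, 'b, 's) dpda \<Rightarrow> 'b list \<times> 's \<Rightarrow> 'b list \<times> 's \<Rightarrow> bool"
  where "erel M c c' \<longleftrightarrow> estep M c = Some c'"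

abbreviation ereach :: "('a, 'b, 's) dpda \<Rightarrow> 'b list \<times> 's \<Rightarrow> 'b list \<times> 's \<Rightarrow> bool"
  where "ereach M \<equiv> (erel M)\<^sup>*\<^sup>*"

text \<open>The guard \<open>g\<close> restricts the states in which a letter may be read. A guard
  that is always true gives runs on one tape, the partition of the states gives runs on two tapes,
  and the simulation is proved once for both.\<close>

definition gstep ::
  "('a, 'b, 's) dpda \<Rightarrow> ('a \<Rightarrow> 's \<Rightarrow> bool) \<Rightarrow> ('a, 'b, 's) config \<Rightarrow> ('a, 'b, 's) config \<Rightarrow> bool"
  where "gstep M g c c' \<longleftrightarrow> (\<exists>x. dpda_move M x c c' \<and> (\<forall>l. x = Some l \<longrightarrow> g l (snd (snd c))))"

fun greach ::
  "('a, 'b, 's) dpda \<Rightarrow> ('a \<Rightarrow> 's \<Rightarrow> bool) \<Rightarrow> 'a list \<Rightarrow> 'b list \<times> 's \<Rightarrow> 'b list \<times> 's \<Rightarrow> bool"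
  where
    "greach M g [] c c' = ereach M c c'"
  | "greach M g (a # w) c c' =
      (\<exists>d d'. ereach M c d \<and> rstep M a d = Some d' \<and> g a (snd d) \<and> greach M g w d' c')"

lemma dpda_step_eq_gstep: "dpda_step M = gstep M (\<lambda>_ _. True)"
  by (intro ext) (simp add: dpda_step_def gstep_def)

lemma two_tape_step_eq_gstep:
  "two_tape_step M S1 S2 = gstep M (\<lambda>l s. case l of Inl _ \<Rightarrow> s \<in> S1 | Inr _ \<Rightarrow> s \<in> S2)"
  by (intro ext) (auto simp: two_tape_step_def gstep_def split: sum.splits)

lemma dpda_move_None_iff:
  "dpda_move M None (w, rev z, s) (w', rev z', s') \<longleftrightarrow> w' = w \<and> estep M (z, s) = Some (z', s')"
proof
  assume "dpda_move M None (w, rev z, s) (w', rev z', s')"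
  then show "w' = w \<and> estep M (z, s) = Some (z', s')"
  proof cases
    case (silent b \<alpha> y)
    then have "z = b # rev y" "z' = rev \<alpha> @ rev y" by (metis rev_rev_ident rev_append rev_singleton_conv rev.simps(2) append_Cons append_Nil)+
    then show ?thesis using silent by (simp add: estep_def)
  qed
next
  assume *: "w' = w \<and> estep M (z, s) = Some (z', s')"
  then obtain b y \<alpha> where "z = b # y" "trans M (None, b, s) = Some (s', \<alpha>)" "z' = rev \<alpha> @ y"
    by (auto simp: estep_def split: list.splits)
  then show "dpda_move M None (w, rev z, s) (w', rev z', s')"
    using dpda_move.silent[of M b s s' \<alpha> w "rev y"] * by simp
qed

lemma dpda_move_Some_iff:
  "dpda_move M (Some a) (w, rev z, s) (w', rev z', s') \<longleftrightarrow> w = a # w' \<and> rstep M a (z, s) = Some (z', s')"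
proof
  assume "dpda_move M (Some a) (w, rev z, s) (w', rev z', s')"
  then show "w = a # w' \<and> rstep M a (z, s) = Some (z', s')"
  proof cases
    case (read b \<alpha> y)
    then have "z = b # rev y" "z' = rev \<alpha> @ rev y" by (metis rev_rev_ident rev_append rev_singleton_conv rev.simps(2) append_Cons append_Nil)+
    then show ?thesis using read by (simp add: rstep_def)
  qed
next
  assume *: "w = a # w' \<and> rstep M a (z, s) = Some (z', s')"
  then obtain b y \<alpha> where "z = b # y" "trans M (Some a, b, s) = Some (s', \<alpha>)" "z' = rev \<alpha> @ y"
    by (auto simp: rstep_def split: list.splits)
  then show "dpda_move M (Some a) (w, rev z, s) (w', rev z', s')"
    using dpda_move.read[of M a b s s' \<alpha> w' "rev y"] * by simp
qed

lemma greach_ereach: "ereach M c d \<Longrightarrow> greach M g w d c' \<Longrightarrow> greach M g w c c'"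
  by (cases w) (auto, meson rtranclp_trans)

text \<open>Grouping the silent moves in front of each letter turns a run into a recursion on the
  input, the form on which the simulations induct. \<open>rev\<close> moves the top of the stack to
  the head.\<close>

lemma gsteps_iff_greach:
  "(gstep M g)\<^sup>*\<^sup>* (w, rev z, s) ([], rev z', s') \<longleftrightarrow> greach M g w (z, s) (z', s')"
proof
  have "(gstep M g)\<^sup>*\<^sup>* x y \<Longrightarrow> y = ([], rev z', s') \<Longrightarrow>
    greach M g (fst x) (rev (fst (snd x)), snd (snd x)) (z', s')" for x y
  proof (induction rule: converse_rtranclp_induct)
    case base
    then show ?case by simp
  next
    case (step c d)
    obtain w z s where c: "c = (w, rev z, s)" by (rule that[of "fst c" "rev (fst (snd c))" "snd (snd c)"]) simp
    obtain w' z1 s1 where d: "d = (w', rev z1, s1)" by (rule that[of "fst d" "rev (fst (snd d))" "snd (snd d)"]) simp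
    have IH: "greach M g w' (z1, s1) (z', s')" using step d by simp
    obtain x where x: "dpda_move M x c d" "\<And>l. x = Some l \<Longrightarrow> g l s"
      using step(1) unfolding gstep_def c by auto
    show ?case
    proof (cases x)
      case None
      then have w: "w' = w" and "estep M (z, s) = Some (z1, s1)"
        using x(1) unfolding c d by (simp_all add: dpda_move_None_iff)
      then have "ereach M (z, s) (z1, s1)" by (simp add: r_into_rtranclp erel_def)
      then show ?thesis using greach_ereach IH w c by simp
    next
      case (Some a)
      then have "w = a # w'" "rstep M a (z, s) = Some (z1, s1)"
        using x(1) unfolding c d by (simp_all add: dpda_move_Some_iff)
      then have "greach M g w (z, s) (z', s')"
        using IH x(2)[OF Some] by auto
      then show ?thesis by (simp add: c)
    qed
  qed
  from this[of "(w, rev z, s)" "([], rev z', s')"]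
  show "(gstep M g)\<^sup>*\<^sup>* (w, rev z, s) ([], rev z', s') \<Longrightarrow> greach M g w (z, s) (z', s')" by simp
next
  have e: "(gstep M g)\<^sup>*\<^sup>* (w, rev (fst c), snd c) (w, rev (fst d), snd d)" if "ereach M c d" for w c d
    using that
  proof (induction rule: rtranclp_induct)
    case base
    then show ?case by simp
  next
    case (step d1 d2)
    have "dpda_move M None (w, rev (fst d1), snd d1) (w, rev (fst d2), snd d2)"
      using step(2) by (simp add: dpda_move_None_iff erel_def)
    then have "gstep M g (w, rev (fst d1), snd d1) (w, rev (fst d2), snd d2)"
      unfolding gstep_def by blast
    then show ?case using step(3) by (rule rtranclp.rtrancl_into_rtrancl[rotated])
  qed
  have "greach M g w c c' \<Longrightarrow> (gstep M g)\<^sup>*\<^sup>* (w, rev (fst c), snd c) ([], rev (fst c'), snd c')" for c c'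
  proof (induction w arbitrary: c)
    case Nil
    then show ?case using e by simp
  next
    case (Cons a w)
    then obtain d d' where d: "ereach M c d" "rstep M a d = Some d'" "g a (snd d)" "greach M g w d' c'"
      by auto
    have "dpda_move M (Some a) (a # w, rev (fst d), snd d) (w, rev (fst d'), snd d')"
      using d by (simp add: dpda_move_Some_iff)
    then have "gstep M g (a # w, rev (fst d), snd d) (w, rev (fst d'), snd d')"
      unfolding gstep_def using d(3) by (intro exI[of _ "Some a"]) simp
    then show ?case
      by (rule rtranclp_trans[OF e[OF d(1)] converse_rtranclp_into_rtranclp[OF _ Cons.IH[OF d(4)]]])
  qed
  from this[of "(z, s)" "(z', s')"]
  show "greach M g w (z, s) (z', s') \<Longrightarrow> (gstep M g)\<^sup>*\<^sup>* (w, rev z, s) ([], rev z', s')" by simp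
qed

text \<open>Silent moves are a partial function, so everything reached silently from
  \<open>c\<close> lies on one path, and this path ends in \<open>d\<close>.\<close>

lemma estep_unique:
  assumes "ereach M c d" "estep M d = None" "ereach M c d'"
  shows "ereach M d' d"
  using assms(3,1)
proof (induction rule: rtranclp_induct)
  case base
  then show ?case .
next
  case (step y z)
  from step.IH[OF step.prems] show ?case
    by (cases rule: converse_rtranclpE) (use step.hyps assms(2) in \<open>auto simp: erel_def\<close>)
qed

lemma rest_unique: "ereach M c d \<Longrightarrow> estep M d = None \<Longrightarrow> ereach M c d' \<Longrightarrow> estep M d' = None \<Longrightarrow> d' = d"
  using estep_unique[of M c d d'] by (metis (no_types, lifting) converse_rtranclpE option.distinct(1) erel_def)

text \<open>By the dichotomy in the definition of determinism a letter can be read only where no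
  silent move applies, that is, at the end of the silent path. The place where the next letter is
  read is therefore unique.\<close>

lemma rstep_imp_estep_None:
  assumes "is_dpda M" "rstep M a d = Some d'"
  shows "estep M d = None"
proof -
  obtain b y s where d: "d = (b # y, s)" using assms(2) by (cases d) (auto simp: rstep_def split: list.splits)
  then have t: "(Some a, b, s) \<in> dom (trans M)" using assms(2) by (auto simp: rstep_def)
  then have "a \<in> input_alph M" "b \<in> stack_alph M" "s \<in> states M"
    using assms(1) unfolding is_dpda_def by auto
  then have "(None, b, s) \<notin> dom (trans M)" using assms(1) t unfolding is_dpda_def by blast
  then show ?thesis by (auto simp: d estep_def)
qed

lemma greach_Cons_rest:
  assumes "is_dpda M" "ereach M c d" "estep M d = None"
  shows "greach M g (a # w) c c' \<longleftrightarrow> g a (snd d) \<and> (\<exists>d'. rstep M a d = Some d' \<and> greach M g w d' c')"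
proof
  assume "greach M g (a # w) c c'"
  then obtain e d' where e: "ereach M c e" "rstep M a e = Some d'" "g a (snd e)" "greach M g w d' c'"
    by auto
  then have "e = d" using rest_unique[OF assms(2,3)] rstep_imp_estep_None[OF assms(1)] by blast
  then show "g a (snd d) \<and> (\<exists>d'. rstep M a d = Some d' \<and> greach M g w d' c')" using e by blast
next
  assume "g a (snd d) \<and> (\<exists>d'. rstep M a d = Some d' \<and> greach M g w d' c')"
  then show "greach M g (a # w) c c'" unfolding greach.simps using assms(2) by blast
qed

lemma step_closed:
  assumes M: "is_dpda M" and c: "fst c \<in> lists (stack_alph M)" "snd c \<in> states M"
    and st: "estep M c = Some d \<or> rstep M a c = Some d"
  shows "fst d \<in> lists (stack_alph M) \<and> snd d \<in> states M"
proof -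
  obtain x b y t \<alpha> where *: "trans M (x, b, snd c) = Some (t, \<alpha>)" "fst c = b # y" "d = (rev \<alpha> @ y, t)"
    using st by (auto simp: estep_def rstep_def split: list.splits)
  then have "(t, \<alpha>) \<in> ran (trans M)" by (auto simp: ran_def)
  then have "t \<in> states M" "\<alpha> \<in> lists (stack_alph M)" using M unfolding is_dpda_def by auto
  then show ?thesis using * c by auto
qed

lemma ereach_closed:
  assumes "ereach M c d" "is_dpda M" "fst c \<in> lists (stack_alph M)" "snd c \<in> states M"
  shows "fst d \<in> lists (stack_alph M) \<and> snd d \<in> states M"
  using assms(1)
proof (induction rule: rtranclp_induct)
  case base
  then show ?case using assms by blast
next
  case (step d e)
  then show ?case using step_closed[OF assms(2), of d e] by (auto simp: erel_def)
qed

definition maccepts :: "('a, 'b, 's) dpda \<Rightarrow> acceptance \<Rightarrow> 'b list \<times> 's \<Rightarrow> bool"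
  where "maccepts M m c \<longleftrightarrow> (case m of By_Final_State \<Rightarrow> snd c \<in> final_states M | By_Empty_Stack \<Rightarrow> fst c = [])"

lemma greach_closed:
  assumes "is_dpda M"
  shows "greach M g w c d \<Longrightarrow> fst c \<in> lists (stack_alph M) \<Longrightarrow> snd c \<in> states M \<Longrightarrow>
    fst d \<in> lists (stack_alph M) \<and> snd d \<in> states M"
proof (induction w arbitrary: c)
  case Nil
  then show ?case using ereach_closed assms by (metis greach.simps(1))
next
  case (Cons a w)
  then obtain d1 d2 where "ereach M c d1" "rstep M a d1 = Some d2" "greach M g w d2 d" by auto
  then show ?case using ereach_closed[OF _ assms, of c d1] step_closed[OF assms, of d1 d2] Cons by blast
qed

lemma accepting_iff:
  assumes M: "is_dpda M"
  shows "(\<exists>c\<in>accepting_configs M m. (gstep M g)\<^sup>*\<^sup>* (w, [start_symbol M], start_state M) c) \<longleftrightarrow>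
    (\<exists>c. greach M g w ([start_symbol M], start_state M) c \<and> maccepts M m c)"
proof
  assume "\<exists>c\<in>accepting_configs M m. (gstep M g)\<^sup>*\<^sup>* (w, [start_symbol M], start_state M) c"
  then obtain c where c: "c \<in> accepting_configs M m"
    "(gstep M g)\<^sup>*\<^sup>* (w, [start_symbol M], start_state M) c" by blast
  define z s where "z = rev (fst (snd c))" and "s = snd (snd c)"
  have "c = ([], rev z, s)" using c(1) by (cases m) (auto simp: z_def s_def)
  then have c: "([], rev z, s) \<in> accepting_configs M m"
    "(gstep M g)\<^sup>*\<^sup>* (w, rev [start_symbol M], start_state M) ([], rev z, s)"
    using c by simp_all
  then show "\<exists>c. greach M g w ([start_symbol M], start_state M) c \<and> maccepts M m c"
    unfolding gsteps_iff_greach by (intro exI[of _ "(z, s)"]) (cases m; auto simp: maccepts_def)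
next
  assume "\<exists>c. greach M g w ([start_symbol M], start_state M) c \<and> maccepts M m c"
  then obtain z s where c: "greach M g w ([start_symbol M], start_state M) (z, s)" "maccepts M m (z, s)"
    by auto
  have "fst (z, s) \<in> lists (stack_alph M) \<and> snd (z, s) \<in> states M"
    using greach_closed[OF M c(1)] M by (auto simp: is_dpda_def)
  then have "([], rev z, s) \<in> accepting_configs M m" using c(2)
    by (cases m) (auto simp: maccepts_def)
  moreover have "(gstep M g)\<^sup>*\<^sup>* (w, rev [start_symbol M], start_state M) ([], rev z, s)"
    using c(1) by (simp only: gsteps_iff_greach)
  ultimately show "\<exists>c\<in>accepting_configs M m. (gstep M g)\<^sup>*\<^sup>* (w, [start_symbol M], start_state M) c"
    by auto
qed

text \<open>\<open>along P w\<close>: whenever \<open>w = p @ l # q\<close>, the letter \<open>l\<close> read after the prefix \<open>p\<close> satisfies \<open>P p l\<close>.\<close>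

fun along :: "('a list \<Rightarrow> 'a \<Rightarrow> bool) \<Rightarrow> 'a list \<Rightarrow> bool"
  where
    "along P [] = True"
  | "along P (l # w) = (P [] l \<and> along (\<lambda>p. P (l # p)) w)"

lemma along_snoc [simp]: "along P (w @ [l]) \<longleftrightarrow> along P w \<and> P w l"
  by (induction w arbitrary: P) auto

lemma along_conj: "along (\<lambda>p l. P p l \<and> Q p l) w \<longleftrightarrow> along P w \<and> along Q w"
  by (induction w arbitrary: P Q) auto

subsection \<open>From pushdown automata to machines that only pop silently\<close>

text \<open>Silent moves that start from a single symbol erase it, come to rest on a nonempty stack,
  or never end; in the last case neither \<open>pops\<close> nor \<open>rests\<close> holds. Both
  predicates enter the finite transition table of the new machine directly: the table only has to
  exist.\<close>

definition pops :: "('a, 'b, 's) dpda \<Rightarrow> 's \<Rightarrow> 'b \<Rightarrow> 's \<Rightarrow> bool"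
  where "pops M s b t \<longleftrightarrow> ereach M ([b], s) ([], t)"

definition rests :: "('a, 'b, 's) dpda \<Rightarrow> 's \<Rightarrow> 'b \<Rightarrow> 'b list \<times> 's \<Rightarrow> bool"
  where "rests M s b c \<longleftrightarrow> ereach M ([b], s) c \<and> estep M c = None \<and> fst c \<noteq> []"

definition meets_final :: "('a, 'b, 's) dpda \<Rightarrow> 'b list \<times> 's \<Rightarrow> bool"
  where "meets_final M c \<longleftrightarrow> (\<exists>d. ereach M c d \<and> snd d \<in> final_states M)"

lemma erel_append: "erel M (z, s) (z', s') \<Longrightarrow> erel M (z @ y, s) (z' @ y, s')"
  by (auto simp: erel_def estep_def split: list.splits)

lemma ereach_append:
  assumes "ereach M c d"
  shows "ereach M (fst c @ y, snd c) (fst d @ y, snd d)"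
  using assms
proof (induction rule: rtranclp_induct)
  case (step d e)
  then have "erel M (fst d @ y, snd d) (fst e @ y, snd e)" using erel_append[of M "fst d" "snd d"] by simp
  then show ?case using step.IH by (rule rtranclp.rtrancl_into_rtrancl[rotated])
qed simp

lemma estep_append_Cons: "b \<noteq> [] \<Longrightarrow> estep M (b @ y, s) = map_option (\<lambda>(z, t). (z @ y, t)) (estep M (b, s))"
  by (cases b) (auto simp: estep_def option.map_comp comp_def case_prod_beta split_beta intro!: map_option_cong)

lemma rstep_append_Cons: "b \<noteq> [] \<Longrightarrow> rstep M a (b @ y, s) = map_option (\<lambda>(z, t). (z @ y, t)) (rstep M a (b, s))"
  by (cases b) (auto simp: rstep_def option.map_comp comp_def case_prod_beta split_beta intro!: map_option_cong)

text \<open>The run is cut where the stack first sinks to \<open>y\<close>; until then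
  \<open>y\<close> is not touched.\<close>

lemma ereach_split:
  assumes "ereach M (b # y, s) c"
  shows "(\<exists>\<beta> t. c = (\<beta> @ y, t) \<and> ereach M ([b], s) (\<beta>, t)) \<or> (\<exists>t. pops M s b t \<and> ereach M (y, t) c)"
  using assms
proof (induction rule: rtranclp_induct)
  case base
  then show ?case by (intro disjI1 exI[of _ "[b]"] exI[of _ s]) simp
next
  case (step c d)
  from step.IH show ?case
  proof (elim disjE exE conjE)
    fix \<beta> t assume c: "c = (\<beta> @ y, t)" "ereach M ([b], s) (\<beta>, t)"
    show ?thesis
    proof (cases "\<beta> = []")
      case True
      then show ?thesis using c step.hyps(2) by (auto simp: pops_def)
    next
      case False
      obtain z u where zu: "estep M (\<beta>, t) = Some (z, u)" "d = (z @ y, u)"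
        using step.hyps(2) by (auto simp: erel_def c estep_append_Cons[OF False])
      then have "ereach M ([b], s) (z, u)"
        using c(2) by (simp add: erel_def rtranclp.rtrancl_into_rtrancl)
      then show ?thesis using zu by blast
    qed
  next
    fix t assume "pops M s b t" "ereach M (y, t) c"
    then show ?thesis using step.hyps(2) by (meson rtranclp.rtrancl_into_rtrancl)
  qed
qed

lemma estep_Nil [simp]: "estep M ([], s) = None"
  by (simp add: estep_def)

lemma pops_unique: "pops M s b t \<Longrightarrow> pops M s b t' \<Longrightarrow> t' = t"
  unfolding pops_def using rest_unique[of M "([b], s)" "([], t)" "([], t')"] by simp

lemma rests_unique: "rests M s b c \<Longrightarrow> rests M s b c' \<Longrightarrow> c' = c"
  unfolding rests_def using rest_unique[of M "([b], s)" c c'] by blast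

lemma the_pops: "pops M s b t \<Longrightarrow> (THE t. pops M s b t) = t"
  using pops_unique by (metis the_equality)

lemma the_rests: "rests M s b c \<Longrightarrow> (THE c. rests M s b c) = c"
  using rests_unique by (metis the_equality)

text \<open>The extra bit of a state records whether a final state was met since the last letter was read.
  The silent moves that follow before the next letter is read are evaluated only when
  this letter is read: they may go on forever.\<close>

definition popm_of :: "('a, nat, nat) dpda \<Rightarrow> acceptance \<Rightarrow> ('a, nat, nat \<times> bool, bool \<times> nat option) popm"
  where "popm_of M m =
    \<lparr>pstates = states M \<times> UNIV, psyms = stack_alph M,
     pop = (\<lambda>(s, f) b. if \<exists>t. pops M s b t
       then Some (THE t. pops M s b t, f \<or> meets_final M ([b], s)) else None),
     rd = (\<lambda>a (s, f) ob. case ob of None \<Rightarrow> ((s, f), []) | Some b \<Rightarrow>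
       if \<exists>c. rests M s b c
       then (case rstep M a (THE c. rests M s b c) of None \<Rightarrow> ((s, f), []) | Some (z, t) \<Rightarrow> ((t, False), z))
       else ((s, f), [])),
     out = (\<lambda>(s, f) ob.
       (case m of By_Final_State \<Rightarrow> f \<or> meets_final M (case ob of None \<Rightarrow> [] | Some b \<Rightarrow> [b], s)
          | By_Empty_Stack \<Rightarrow> ob = None,
        case ob of None \<Rightarrow> None | Some b \<Rightarrow>
          if \<exists>c. rests M s b c then Some (snd (THE c. rests M s b c)) else None)),
     pinit = ([start_symbol M], (start_state M, False))\<rparr>"

lemma popm_of_ok:
  assumes M: "is_dpda M"
  shows "popm_ok (input_alph M) (popm_of M m)"
proof -
  have p: "t \<in> states M" if "pops M s b t" "s \<in> states M" "b \<in> stack_alph M" for s b t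
    using that ereach_closed[OF _ M, of "([b], s)" "([], t)"] by (auto simp: pops_def)
  have r: "fst c \<in> lists (stack_alph M) \<and> snd c \<in> states M"
    if "rests M s b c" "s \<in> states M" "b \<in> stack_alph M" for s b c
    using that ereach_closed[OF _ M, of "([b], s)" c] by (auto simp: rests_def)
  have "rd (popm_of M m) a sf ob \<in> pstates (popm_of M m) \<times> lists (psyms (popm_of M m))"
    if sf: "sf \<in> pstates (popm_of M m)" and ob: "ob \<in> insert None (Some ` psyms (popm_of M m))" for a sf ob
  proof -
    obtain s f where sf: "sf = (s, f)" "s \<in> states M" using sf by (auto simp: popm_of_def)
    show ?thesis
    proof (cases "\<exists>b c. ob = Some b \<and> rests M s b c")
      case False
      then show ?thesis using sf by (auto simp: popm_of_def split: option.split)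
    next
      case True
      then obtain b c where bc: "ob = Some b" "rests M s b c" by blast
      then have b: "b \<in> stack_alph M" using ob by (auto simp: popm_of_def)
      note c = r[OF bc(2) sf(2) b]
      have "fst d \<in> lists (stack_alph M) \<and> snd d \<in> states M" if "rstep M a c = Some d" for d
        using step_closed[OF M _ _ disjI2[OF that]] c by blast
      then show ?thesis using sf bc the_rests[OF bc(2)]
        by (auto simp: popm_of_def split: option.split)
    qed
  qed
  moreover have "finite (pstates (popm_of M m))" "finite (psyms (popm_of M m))"
    "pinit (popm_of M m) \<in> lists (psyms (popm_of M m)) \<times> pstates (popm_of M m)"
    using M by (auto simp: is_dpda_def popm_of_def)
  moreover have "t \<in> pstates (popm_of M m)"
    if "s \<in> pstates (popm_of M m)" "b \<in> psyms (popm_of M m)" "pop (popm_of M m) s b = Some t" for s b t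
    using that p the_pops by (fastforce simp: popm_of_def split: if_splits)
  ultimately show ?thesis unfolding popm_ok_def by blast
qed

text \<open>Settling follows the silent moves only as long as they erase symbols. Whether a final
  state occurs on the whole silent path is therefore split: the bit answers for the part already
  done, \<open>meets_final\<close> for the rest.\<close>

lemma settle_popm_of:
  assumes "settle (pop (popm_of M m)) z (s, f) = (z', (s', f'))"
  shows "ereach M (z, s) (z', s') \<and> (z' = [] \<or> \<not> (\<exists>t. pops M s' (hd z') t)) \<and>
    (f' \<or> meets_final M (z', s') \<longleftrightarrow> f \<or> meets_final M (z, s))"
  using assms
proof (induction z arbitrary: s f)
  case Nil
  then show ?case by simp
next
  case (Cons b z)
  show ?case
  proof (cases "\<exists>t. pops M s b t")
    case False
    then have "pop (popm_of M m) (s, f) b = None" by (simp add: popm_of_def)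
    then show ?thesis using Cons.prems False by auto
  next
    case True
    then obtain t where t: "pops M s b t" by blast
    then have "pop (popm_of M m) (s, f) b = Some (t, f \<or> meets_final M ([b], s))"
      by (auto simp: popm_of_def the_pops)
    then have "settle (pop (popm_of M m)) z (t, f \<or> meets_final M ([b], s)) = (z', (s', f'))"
      using Cons.prems by simp
    note IH = Cons.IH[OF this]
    have r: "ereach M (b # z, s) (z, t)" using ereach_append[of M "([b], s)" "([], t)" z] t
      by (simp add: pops_def)
    have "meets_final M (b # z, s) \<longleftrightarrow> meets_final M ([b], s) \<or> meets_final M (z, t)"
    proof
      assume "meets_final M (b # z, s)"
      then obtain c where "ereach M (b # z, s) c" "snd c \<in> final_states M" by (auto simp: meets_final_def)
      then show "meets_final M ([b], s) \<or> meets_final M (z, t)"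
        using ereach_split[of M b z s c] pops_unique[OF t] unfolding meets_final_def by (metis snd_conv)
    next
      assume "meets_final M ([b], s) \<or> meets_final M (z, t)"
      then show "meets_final M (b # z, s)"
        using r ereach_append[of M "([b], s)" _ z] unfolding meets_final_def
        by (metis append_Cons append_Nil fst_conv rtranclp_trans snd_conv)
    qed
    then show ?thesis using IH r by (meson rtranclp_trans)
  qed
qed

text \<open>The second output is the state in which the next letter would be read, or
  \<open>None\<close> if the silent moves empty the stack or never end. A letter that comes in the
  latter case does not stop the new machine, which goes on with meaningless values;
  \<open>along\<close> inspects all proper prefixes and rejects such words.\<close>

lemma popm_of_accepts:
  assumes M: "is_dpda M" and w: "w \<in> lists (input_alph M)"
    and zs: "z \<in> lists (stack_alph M)" "s \<in> states M"
  shows "(\<exists>c. greach M g w (z, s) c \<and> maccepts M m c) \<longleftrightarrow>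
    fst (outc (popm_of M m) (foldl (pstep (popm_of M m)) (settle (pop (popm_of M m)) z (s, False)) w)) \<and>
    along (\<lambda>p l. \<exists>t.
      snd (outc (popm_of M m) (foldl (pstep (popm_of M m)) (settle (pop (popm_of M m)) z (s, False)) p)) = Some t \<and> g l t) w"
  using w zs
proof (induction w arbitrary: z s rule: list.induct)
  case Nil
  let ?N = "popm_of M m"
  obtain z' s' f' where st: "settle (pop ?N) z (s, False) = (z', (s', f'))" by (metis prod.exhaust)
  note A = settle_popm_of[OF st]
  have "(\<exists>c. ereach M (z, s) c \<and> maccepts M m c) \<longleftrightarrow> fst (outc ?N (z', (s', f')))"
  proof (cases m)
    case By_Final_State
    \<comment> \<open>The top symbol is never erased, so the silent moves do not see the stack below
      it and the output can be computed from the top alone.\<close>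
    have "meets_final M (z', s') \<longleftrightarrow> meets_final M (case hdo z' of None \<Rightarrow> [] | Some b \<Rightarrow> [b], s')"
    proof (cases z')
      case (Cons b y)
      have "meets_final M (b # y, s') \<longleftrightarrow> meets_final M ([b], s')"
        using ereach_split[of M b y s'] A Cons ereach_append[of M "([b], s')" _ y] unfolding meets_final_def
        by (metis append_Cons append_Nil fst_conv list.sel(1) list.distinct(1) snd_conv)
      then show ?thesis by (simp add: Cons)
    qed simp
    then show ?thesis using A
      by (auto simp: maccepts_def By_Final_State meets_final_def outc_def popm_of_def)
  next
    case By_Empty_Stack
    have "(\<exists>c. ereach M (z, s) c \<and> fst c = []) \<longleftrightarrow> z' = []"
    proof
      assume "\<exists>c. ereach M (z, s) c \<and> fst c = []"
      then obtain t where t: "ereach M (z, s) ([], t)" by (metis prod.collapse)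
      \<comment> \<open>An empty stack ends the silent path, so the settled configuration lies on
        the way to it.\<close>
      then have c: "ereach M (z', s') ([], t)" using A by (intro estep_unique[OF t]) auto
      show "z' = []"
      proof (cases z')
        case (Cons b y)
        then show ?thesis using ereach_split[of M b y s' "([], t)"] c A by (auto simp: pops_def)
      qed
    qed (use A in \<open>metis fst_conv\<close>)
    then show ?thesis by (cases z') (auto simp: By_Empty_Stack maccepts_def outc_def popm_of_def)
  qed
  then show ?case by (simp add: st)
next
  case (Cons a w)
  let ?N = "popm_of M m"
  obtain z' s' f' where st: "settle (pop ?N) z (s, False) = (z', (s', f'))" by (metis prod.exhaust)
  note A = settle_popm_of[OF st]
  show ?case
  proof (cases "\<exists>b y c. z' = b # y \<and> rests M s' b c")
    case True
    then obtain b y \<beta> t where z': "z' = b # y" and r: "rests M s' b (\<beta>, t)" by auto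
    have \<beta>: "\<beta> \<noteq> []" using r by (simp add: rests_def)
    have "ereach M (z', s') (\<beta> @ y, t)"
      using r ereach_append[of M "([b], s')" "(\<beta>, t)" y] by (simp add: z' rests_def)
    then have reach: "ereach M (z, s) (\<beta> @ y, t)" using A by (meson rtranclp_trans)
    have quiet: "estep M (\<beta> @ y, t) = None" using r by (simp add: estep_append_Cons[OF \<beta>] rests_def)
    have out: "snd (outc ?N (z', (s', f'))) = Some t"
      using r by (auto simp: outc_def z' popm_of_def the_rests[OF r])
    obtain e \<beta>' where \<beta>': "\<beta> = e # \<beta>'" using \<beta> by (cases \<beta>) auto
    have "\<beta> @ y \<in> lists (stack_alph M)" and t: "t \<in> states M"
      using ereach_closed[OF reach M] Cons.prems by simp_all
    then have e: "e \<in> stack_alph M" by (simp add: \<beta>')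
    \<comment> \<open>The other half of the dichotomy: at rest on a nonempty stack, every letter of
      the alphabet can be read.\<close>
    have "trans M (None, e, t) = None" using r \<beta>' by (simp add: rests_def estep_def)
    then have "(None, e, t) \<notin> dom (trans M)" by blast
    moreover have "a \<in> input_alph M" using Cons.prems by simp
    ultimately have "(Some a, e, t) \<in> dom (trans M)" using M e t unfolding is_dpda_def by blast
    then obtain z1 t1 where d: "rstep M a (\<beta>, t) = Some (z1, t1)" by (auto simp: rstep_def \<beta>')
    show ?thesis
    proof -
      have rs: "rstep M a (\<beta> @ y, t) = Some (z1 @ y, t1)" by (simp add: rstep_append_Cons[OF \<beta>] d)
      have "pstep ?N (z', (s', f')) a = settle (pop ?N) (z1 @ y) (t1, False)"
      proof -
        have "rd ?N a (s', f') (Some b) = ((t1, False), z1)"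
          using r by (auto simp: popm_of_def the_rests[OF r] d)
        then show ?thesis by (simp add: pstep_def z')
      qed
      then have fold: "foldl (pstep ?N) (settle (pop ?N) z (s, False)) (a # v) =
          foldl (pstep ?N) (settle (pop ?N) (z1 @ y) (t1, False)) v" for v
        by (simp add: st)
      have "(\<exists>c. greach M g (a # w) (z, s) c \<and> maccepts M m c) \<longleftrightarrow>
          g a t \<and> (\<exists>c. greach M g w (z1 @ y, t1) c \<and> maccepts M m c)"
        unfolding greach_Cons_rest[OF M reach quiet] by (simp add: rs)
      moreover have "w \<in> lists (input_alph M)" using Cons.prems by simp
      moreover have "z1 @ y \<in> lists (stack_alph M)" "t1 \<in> states M"
        using step_closed[OF M _ _ disjI2[OF rs]] \<open>\<beta> @ y \<in> _\<close> t by simp_all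
      note Cons.IH[OF calculation(2) this]
      ultimately show ?thesis unfolding along.simps fold by (simp add: st out) blast
    qed
  next
    case False
    have out: "snd (outc ?N (z', (s', f'))) = None"
      using False by (cases z') (auto simp: outc_def popm_of_def)
    have "\<not> greach M g (a # w) (z, s) c" for c
    proof
      assume "greach M g (a # w) (z, s) c"
      then obtain d d' where d: "ereach M (z, s) d" "rstep M a d = Some d'" by auto
      then have q: "estep M d = None" using rstep_imp_estep_None[OF M] by blast
      have d': "ereach M (z', s') d" using estep_unique[OF d(1) q] A by blast
      have ne: "fst d \<noteq> []" using d(2) by (auto simp: rstep_def)
      show False
      proof (cases z')
        case Nil
        then show ?thesis using d' ne by (auto elim: converse_rtranclpE simp: erel_def)
      next
        case (Cons b y)
        then have "\<not> (\<exists>t. pops M s' b t)" using A by simp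
        then obtain \<beta> t where bt: "d = (\<beta> @ y, t)" "ereach M ([b], s') (\<beta>, t)"
          using ereach_split[of M b y s' d] d' Cons by blast
        then have "\<beta> \<noteq> []" using \<open>\<not> (\<exists>t. pops M s' b t)\<close> by (auto simp: pops_def)
        then have "rests M s' b (\<beta>, t)" using bt q by (simp add: rests_def estep_append_Cons)
        then show ?thesis using False Cons by blast
      qed
    qed
    then show ?thesis unfolding along.simps by (simp add: st out)
  qed
qed

lemma foldl_monitor:
  "foldl (cstep F (\<lambda>ok l x. (ok \<and> Q x, Feed l))) (True, []) w = (along (\<lambda>p _. Q (F p)) w, w)"
  by (induction w rule: rev_induct) auto

text \<open>The controller feeds every letter and keeps one bit, which tells whether the outputs on
  all proper prefixes satisfied \<open>Q\<close>. A condition on the whole run thus becomes part of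
  the output at its end.\<close>

lemma pdfun_monitor:
  assumes "pdfun A F"
  shows "pdfun A (\<lambda>w. h (along (\<lambda>p _. Q (F p)) w) (F w))"
proof -
  let ?act = "\<lambda>ok l x. (ok \<and> Q x, Feed l)"
  have "pdfun A (\<lambda>v. case foldl (cstep F ?act) (True, []) v of (q, w) \<Rightarrow> h q (F w))"
    by (rule pdfun_control[OF assms, where Q = UNIV]) auto
  then show ?thesis by (simp only: foldl_monitor prod.case)
qed

text \<open>One \<open>F\<close> serves all guards: a guard depends on the letter and on the state
  in which it is read, and this state is the second output.\<close>

lemma dpda_pdfun:
  fixes M :: "('a, nat, nat) dpda"
  assumes M: "is_dpda M"
  shows "\<exists>F :: 'a list \<Rightarrow> bool \<times> nat option. pdfun (input_alph M) F \<and>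
    (\<forall>g. \<forall>w\<in>lists (input_alph M).
      (\<exists>c\<in>accepting_configs M m. (gstep M g)\<^sup>*\<^sup>* (w, [start_symbol M], start_state M) c) \<longleftrightarrow>
      fst (F w) \<and> along (\<lambda>p l. \<exists>t. snd (F p) = Some t \<and> g l t) w)"
proof -
  let ?N = "popm_of M m"
  let ?F = "\<lambda>w. outc ?N (prun ?N w)"
  have "pdfun (input_alph M) ?F" using popm_of_ok[OF M] by (rule pdfunI) simp
  moreover have "(\<exists>c\<in>accepting_configs M m. (gstep M g)\<^sup>*\<^sup>* (w, [start_symbol M], start_state M) c) \<longleftrightarrow>
      fst (?F w) \<and> along (\<lambda>p l. \<exists>t. snd (?F p) = Some t \<and> g l t) w"
    if "w \<in> lists (input_alph M)" for g w
  proof -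
    have "pstart ?N = settle (pop ?N) [start_symbol M] (start_state M, False)"
      by (simp add: pstart_def) (simp add: popm_of_def)
    then show ?thesis
      unfolding accepting_iff[OF M] prun_def using M that
      by (subst popm_of_accepts) (auto simp: is_dpda_def)
  qed
  ultimately show ?thesis by (intro exI[of _ ?F] conjI allI ballI)
qed

lemma dpda_language_imp_pdfun:
  assumes "is_dpda_language A K"
  shows "finite A \<and> K \<subseteq> lists A \<and> pdfun A (\<lambda>w. w \<in> K)"
proof -
  obtain M :: "('a, nat, nat) dpda" and m where M: "is_dpda M" and A: "input_alph M = A" and K: "K = dpda_lang M m"
    using assms unfolding is_dpda_language_def by blast
  obtain F :: "'a list \<Rightarrow> bool \<times> nat option" where F: "pdfun A F"
    and acc: "\<forall>g. \<forall>w\<in>lists A.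
      (\<exists>c\<in>accepting_configs M m. (gstep M g)\<^sup>*\<^sup>* (w, [start_symbol M], start_state M) c) \<longleftrightarrow>
      fst (F w) \<and> along (\<lambda>p l. \<exists>t. snd (F p) = Some t \<and> g l t) w"
    using dpda_pdfun[OF M, of m, unfolded A] by (elim exE conjE)
  have "w \<in> K \<longleftrightarrow> along (\<lambda>p _. snd (F p) \<noteq> None) w \<and> fst (F w)" if "w \<in> lists A" for w
    using that acc[rule_format, OF that, of "\<lambda>_ _. True"] by (auto simp: K dpda_lang_def A dpda_step_eq_gstep)
  then have "pdfun A (\<lambda>w. w \<in> K)"
    by (intro pdfun_cong[OF pdfun_monitor[OF F, of "\<lambda>ok x. ok \<and> fst x" "\<lambda>x. snd x \<noteq> None"]]) simp
  moreover have "finite A" using M A by (auto simp: is_dpda_def)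
  moreover have "K \<subseteq> lists A" by (auto simp: K dpda_lang_def A)
  ultimately show ?thesis by blast
qed


subsection \<open>Two tapes\<close>

fun lefts :: "('a + 'b) list \<Rightarrow> 'a list"
  where "lefts [] = []" | "lefts (Inl a # w) = a # lefts w" | "lefts (Inr b # w) = lefts w"

fun rights :: "('a + 'b) list \<Rightarrow> 'b list"
  where "rights [] = []" | "rights (Inl a # w) = rights w" | "rights (Inr b # w) = b # rights w"

lemma lefts_append [simp]: "lefts (v @ w) = lefts v @ lefts w"
  and rights_append [simp]: "rights (v @ w) = rights v @ rights w"
  by (induction v rule: lefts.induct) auto

lemma lefts_map [simp]: "lefts (map Inl u) = u" "lefts (map Inr v) = []"
  and rights_map [simp]: "rights (map Inl u) = []" "rights (map Inr v) = v"
proof -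
  show "lefts (map Inl u) = u" "rights (map Inl u) = []" by (induction u) simp_all
  show "lefts (map Inr v) = []" "rights (map Inr v) = v" by (induction v) simp_all
qed

text \<open>The nonemptiness conditions on the factors select the factorization into maximal runs of
  sharp and flat letters, and every word over the two copies has one.\<close>

lemma tape_shuffles_iff: "w \<in> tape_shuffles u v \<longleftrightarrow> lefts w = u \<and> rights w = v"
proof
  assume "w \<in> tape_shuffles u v"
  then obtain us vs where w: "w = concat (map2 (\<lambda>x y. map Inl x @ map Inr y) us vs)"
    and l: "length us = length vs" and u: "concat us = u" "concat vs = v"
    unfolding tape_shuffles_def by blast
  show "lefts w = u \<and> rights w = v"
    unfolding w u[symmetric] using l by (induction rule: list_induct2) auto
next
  define Z where "Z us vs = concat (map2 (\<lambda>x y. map Inl x @ map Inr y) us vs)" for us :: "'a list list" and vs :: "'a list list"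
  have Z [simp]: "Z [] vs = []" "Z us [] = []" "Z (x # us) (y # vs) = map Inl x @ map Inr y @ Z us vs" for x y us vs
    by (simp_all add: Z_def)
  \<comment> \<open>Letters are added in front. \<open>tl us\<close> and \<open>butlast vs\<close>
    are exactly the factors that have to be nonempty.\<close>
  have "\<exists>us vs. w = Z us vs \<and> length us = length vs \<and>
      concat us = lefts w \<and> concat vs = rights w \<and> (\<forall>x\<in>set (tl us). x \<noteq> []) \<and> (\<forall>y\<in>set (butlast vs). y \<noteq> [])"
  proof (induction w)
    case Nil
    show ?case by (intro exI[of _ "[]"]) simp
  next
    case (Cons l w)
    then obtain us vs where w: "w = Z us vs" and ln: "length us = length vs"
      and cc: "concat us = lefts w" "concat vs = rights w"
      and ne: "\<forall>x\<in>set (tl us). x \<noteq> []" "\<forall>y\<in>set (butlast vs). y \<noteq> []"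
      by blast
    show ?case
    proof (cases l)
      case (Inl a)
      show ?thesis
      proof (cases us)
        case Nil
        then show ?thesis using ln cc w Inl by (intro exI[of _ "[[a]]"] exI[of _ "[[]]"]) simp
      next
        case us: (Cons x us')
        then obtain y vs' where vs: "vs = y # vs'" using ln by (cases vs) auto
        show ?thesis
          using us vs ln cc ne by (intro exI[of _ "(a # x) # us'"] exI[of _ vs]) (simp add: w Inl)
      qed
    next
      case (Inr b)
      show ?thesis
      \<comment> \<open>In front of a nonempty sharp factor, or of nothing, a flat letter opens a
        new pair with an empty sharp factor; otherwise it joins the first flat factor.\<close>
      proof (cases "us = [] \<or> hd us \<noteq> []")
        case True
        have "\<forall>x\<in>set us. x \<noteq> []" using True ne(1) by (cases us) auto
        moreover have "\<forall>y\<in>set (butlast ([b] # vs)). y \<noteq> []" using ne(2) by (cases vs) auto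
        ultimately show ?thesis using ln cc
          by (intro exI[of _ "[] # us"] exI[of _ "[b] # vs"] conjI) (simp_all add: w Inr)
      next
        case False
        then obtain us' where us: "us = [] # us'" by (cases us) auto
        then obtain y vs' where vs: "vs = y # vs'" using ln by (cases vs) auto
        have "\<forall>y\<in>set (butlast ((b # y) # vs')). y \<noteq> []" using ne(2) vs by (cases vs') auto
        then show ?thesis using us vs ln cc ne(1)
          by (intro exI[of _ us] exI[of _ "(b # y) # vs'"] conjI) (simp_all add: w Inr)
      qed
    qed
  qed
  then obtain us vs where *: "w = Z us vs" "length us = length vs"
      "concat us = lefts w" "concat vs = rights w" "\<forall>x\<in>set (tl us). x \<noteq> []" "\<forall>y\<in>set (butlast vs). y \<noteq> []"
    by blast
  have "us ! i \<noteq> []" if i: "0 < i" "i < length us" for i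
  proof -
    obtain x us' where "us = x # us'" using i by (cases us) auto
    then show ?thesis using i *(5) by (cases i) simp_all
  qed
  moreover have "vs ! j \<noteq> []" if "Suc j < length vs" for j
  proof -
    have "butlast vs ! j \<in> set (butlast vs)" using that by (intro nth_mem) simp
    then show ?thesis using that *(6) nth_butlast[of j vs] by simp
  qed
  moreover assume "lefts w = u \<and> rights w = v"
  ultimately show "w \<in> tape_shuffles u v"
    unfolding tape_shuffles_def using *(1-4) unfolding Z_def by blast
qed

text \<open>The first output bit of \<open>F\<close> selects the tape to be read next, the second one tells acceptance.\<close>

function tape_run :: "(('a + 'a) list \<Rightarrow> bool \<times> bool) \<Rightarrow> ('a + 'a) list \<Rightarrow> 'a list \<Rightarrow> 'a list \<Rightarrow> bool"
  where "tape_run F w u v =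
    (if u = [] \<and> v = [] then snd (F w)
     else if fst (F w) then (case u of [] \<Rightarrow> False | a # u' \<Rightarrow> tape_run F (w @ [Inl a]) u' v)
     else (case v of [] \<Rightarrow> False | b # v' \<Rightarrow> tape_run F (w @ [Inr b]) u v'))"
  by auto
termination by (relation "measure (\<lambda>(F, w, u, v). length u + length v)") auto

declare tape_run.simps [simp del]

text \<open>The outputs dictate from which tape each letter comes. So at most one shuffle is
  compatible with them, and the existential quantifier turns into a recursion.\<close>

lemma tape_run_iff:
  "tape_run F w u v \<longleftrightarrow> (\<exists>x. lefts x = u \<and> rights x = v \<and> snd (F (w @ x)) \<and>
    along (\<lambda>p l. isl l = fst (F (w @ p))) x)"
proof (induction F w u v rule: tape_run.induct)
  case (1 F w u v)
  define E where "E w u v x \<longleftrightarrow> lefts x = u \<and> rights x = v \<and> snd (F (w @ x)) \<and>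
    along (\<lambda>p l. isl l = fst (F (w @ p))) x" for w u v x
  have E_Nil: "E w u v [] \<longleftrightarrow> u = [] \<and> v = [] \<and> snd (F w)" for w u v
    by (auto simp: E_def)
  have E_Inl: "E w u v (Inl a # x) \<longleftrightarrow> fst (F w) \<and> (\<exists>u'. u = a # u' \<and> E (w @ [Inl a]) u' v x)" for w u v a x
    by (auto simp: E_def)
  have E_Inr: "E w u v (Inr a # x) \<longleftrightarrow> \<not> fst (F w) \<and> (\<exists>v'. v = a # v' \<and> E (w @ [Inr a]) u v' x)" for w u v a x
    by (auto simp: E_def)
  have ex: "(\<exists>x. E w u v x) \<longleftrightarrow> E w u v [] \<or> (\<exists>a y. E w u v (Inl a # y)) \<or> (\<exists>b y. E w u v (Inr b # y))"
    by (metis list.exhaust sum.exhaust)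
  have "tape_run F w u v \<longleftrightarrow> (\<exists>x. E w u v x)"
  proof (cases "u = [] \<and> v = []")
    case True
    then show ?thesis unfolding ex E_Nil E_Inl E_Inr by (simp add: tape_run.simps)
  next
    case uv: False
    show ?thesis
    proof (cases "fst (F w)")
      case True
      have "tape_run F w u v = (case u of [] \<Rightarrow> False | a # u' \<Rightarrow> tape_run F (w @ [Inl a]) u' v)"
        by (subst tape_run.simps) (simp only: uv True if_True if_False not_True_eq_False)
      also have "\<dots> = (\<exists>a u'. u = a # u' \<and> (\<exists>x. E (w @ [Inl a]) u' v x))"
        using 1(1)[OF uv True] by (cases u) (simp_all add: E_def)
      finally show ?thesis unfolding ex E_Nil E_Inl E_Inr using uv True by blast
    next
      case False
      have "tape_run F w u v = (case v of [] \<Rightarrow> False | a # v' \<Rightarrow> tape_run F (w @ [Inr a]) u v')"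
        by (subst tape_run.simps) (simp only: uv False if_True if_False not_True_eq_False)
      also have "\<dots> = (\<exists>a v'. v = a # v' \<and> (\<exists>x. E (w @ [Inr a]) u v' x))"
        using 1(2)[OF uv False] by (cases v) (simp_all add: E_def)
      finally show ?thesis unfolding ex E_Nil E_Inl E_Inr using uv False by blast
    qed
  qed
  then show ?case by (simp only: E_def)
qed

lemma finite_two_tape_alph: "finite (two_tape_alph A) \<longleftrightarrow> finite A"
proof
  assume "finite (two_tape_alph A)"
  then have "finite ((\<lambda>a. Inl (Some a)) -` two_tape_alph A)" by (rule finite_vimageI) (auto simp: inj_on_def)
  then show "finite A" by (rule rev_finite_subset) (auto simp: two_tape_alph_def)
qed (simp add: two_tape_alph_def)

lemma shuffle_in_two_tape_alph:
  assumes "lefts w = with_end u" "rights w = with_end v" "u \<in> lists A" "v \<in> lists A"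
  shows "w \<in> lists (two_tape_alph A)"
proof -
  have "set w = Inl ` set (lefts w) \<union> Inr ` set (rights w)" for w :: "('a option + 'a option) list"
    by (induction w rule: lefts.induct) auto
  then show ?thesis using assms by (auto simp: with_end_def two_tape_alph_def in_lists_conv_set subset_iff)
qed

lemma two_tape_imp_pdfun:
  assumes "is_two_tape_language A R"
  shows "finite A \<and> (\<exists>F. pdfun (two_tape_alph A) F \<and>
    R = {(u, v). u \<in> lists A \<and> v \<in> lists A \<and> tape_run F [] (with_end u) (with_end v)})"
proof -
  obtain M :: "('a tape_letter, nat, nat) dpda" and S1 S2 m where M: "is_dpda M"
    and A: "input_alph M = two_tape_alph A" and S: "states M = S1 \<union> S2" "S1 \<inter> S2 = {}"
    and R: "R = two_tape_lang A M S1 S2 m"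
    using assms unfolding is_two_tape_language_def by blast
  obtain F :: "'a tape_letter list \<Rightarrow> bool \<times> nat option" where F: "pdfun (two_tape_alph A) F"
    and acc: "\<forall>g. \<forall>w\<in>lists (two_tape_alph A).
      (\<exists>c\<in>accepting_configs M m. (gstep M g)\<^sup>*\<^sup>* (w, [start_symbol M], start_state M) c) \<longleftrightarrow>
      fst (F w) \<and> along (\<lambda>p l. \<exists>t. snd (F p) = Some t \<and> g l t) w"
    using dpda_pdfun[OF M, of m, unfolded A] by (elim exE conjE)
  define Q where "Q x \<longleftrightarrow> (\<exists>t. snd x = Some t \<and> t \<in> S1 \<union> S2)" for x :: "bool \<times> nat option"
  \<comment> \<open>Where no next reading state exists, the tape bit falls back to the flat tape.
    Reading on then violates \<open>Q\<close> at this prefix, so the acceptance bit stays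
    false.\<close>
  define G where "G w = ((\<exists>t\<in>S1. snd (F w) = Some t), along (\<lambda>p _. Q (F p)) w \<and> fst (F w))" for w
  have "pdfun (two_tape_alph A) G"
    unfolding G_def
    by (rule pdfun_monitor[OF F, of "\<lambda>ok x. ((\<exists>t\<in>S1. snd x = Some t), ok \<and> fst x)" Q])
  moreover have "(\<exists>w\<in>tape_shuffles (with_end u) (with_end v). \<exists>c\<in>accepting_configs M m.
      (two_tape_step M S1 S2)\<^sup>*\<^sup>* (w, [start_symbol M], start_state M) c) \<longleftrightarrow>
      tape_run G [] (with_end u) (with_end v)" if uv: "u \<in> lists A" "v \<in> lists A" for u v
  proof -
    have eq: "(\<exists>t. snd (F p) = Some t \<and> (case l of Inl _ \<Rightarrow> t \<in> S1 | Inr _ \<Rightarrow> t \<in> S2)) \<longleftrightarrow>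
        Q (F p) \<and> isl l = fst (G p)" for p and l :: "'a tape_letter"
      using S(2) by (cases l) (auto simp: Q_def G_def)
    have "(\<exists>c\<in>accepting_configs M m. (two_tape_step M S1 S2)\<^sup>*\<^sup>* (w, [start_symbol M], start_state M) c) \<longleftrightarrow>
        snd (G w) \<and> along (\<lambda>p l. isl l = fst (G p)) w"
      if "lefts w = with_end u" "rights w = with_end v" for w
      unfolding two_tape_step_eq_gstep acc[rule_format, OF shuffle_in_two_tape_alph[OF that uv]] eq
      by (auto simp: G_def along_conj)
    then show ?thesis unfolding tape_run_iff by (auto simp: Bex_def tape_shuffles_iff)
  qed
  moreover have "finite A" using M A by (simp add: is_dpda_def finite_two_tape_alph)
  ultimately show ?thesis unfolding R two_tape_lang_def by (intro conjI exI[of _ G]) auto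
qed


subsection \<open>Back to pushdown automata\<close>

text \<open>\<open>Init\<close> loads the initial stack, since an automaton starts with a single
  symbol. \<open>Settling\<close> carries out the silent pops. \<open>Quiet\<close> stores the tape
  bit and the acceptance bit and is the only kind of state that reads letters.\<close>

datatype cstate = Init | Settling nat | Quiet nat bool bool

instance cstate :: countable
  by countable_datatype

text \<open>The bottom symbol \<^const>\<open>None\<close> stands for the empty stack of the simulated machine. Once its silent
  moves are exhausted, the automaton writes the output into its state, so that tape choice and
  acceptance depend on the state only.\<close>

fun ctrans ::
  "('a, nat, nat, bool \<times> bool) popm \<Rightarrow> 'a option \<Rightarrow> nat option \<Rightarrow> cstate \<Rightarrow> (cstate \<times> nat option list) option"
  where
    "ctrans N None b Init = Some (Settling (snd (pinit N)), None # rev (map Some (fst (pinit N))))"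
  | "ctrans N None None (Settling s) =
      Some (Quiet s (fst (out N s None)) (snd (out N s None)), [None])"
  | "ctrans N None (Some b) (Settling s) = (case pop N s b of
        Some t \<Rightarrow> Some (Settling t, [])
      | None \<Rightarrow> Some (Quiet s (fst (out N s (Some b))) (snd (out N s (Some b))), [Some b]))"
  | "ctrans N (Some a) b (Quiet s x y) = (case rd N a s b of (t, \<alpha>) \<Rightarrow>
      Some (Settling t, (if b = None then [None] else []) @ rev (map Some \<alpha>)))"
  | "ctrans N _ _ _ = None"

definition cstates :: "('a, nat, nat, 'x) popm \<Rightarrow> cstate set"
  where "cstates N = {q. case q of Init \<Rightarrow> True | Settling s \<Rightarrow> s \<in> pstates N | Quiet s _ _ \<Rightarrow> s \<in> pstates N}"

lemma in_cstates [simp]: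
  "Init \<in> cstates N" "Settling s \<in> cstates N \<longleftrightarrow> s \<in> pstates N" "Quiet s x y \<in> cstates N \<longleftrightarrow> s \<in> pstates N"
  by (simp_all add: cstates_def)

lemma finite_cstates:
  assumes "finite (pstates N)"
  shows "finite (cstates N)"
proof (rule finite_subset)
  show "cstates N \<subseteq> insert Init (Settling ` pstates N \<union> (\<Union>x. \<Union>y. (\<lambda>s. Quiet s x y) ` pstates N))"
  proof
    fix q assume "q \<in> cstates N"
    then show "q \<in> insert Init (Settling ` pstates N \<union> (\<Union>x. \<Union>y. (\<lambda>s. Quiet s x y) ` pstates N))"
      by (cases q) auto
  qed
qed (use assms in simp)

text \<open>The table is cut down to the images of \<open>to_nat\<close>, because
  \<open>from_nat\<close> returns arbitrary values elsewhere.\<close>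

definition dpda_of :: "'a set \<Rightarrow> ('a, nat, nat, bool \<times> bool) popm \<Rightarrow> ('a, nat, nat) dpda"
  where "dpda_of A N =
    (let S = cstates N;
         B = insert None (Some ` psyms N)
     in \<lparr>states = to_nat ` S, input_alph = A, stack_alph = to_nat ` B,
         trans = (\<lambda>(x, b, s). if x \<in> insert None (Some ` A) \<and> b \<in> to_nat ` B \<and> s \<in> to_nat ` S
           then map_option (\<lambda>(t, \<alpha>). (to_nat t, map to_nat \<alpha>)) (ctrans N x (from_nat b) (from_nat s)) else None),
         start_state = to_nat Init, start_symbol = to_nat (None :: nat option),
         final_states = to_nat ` {q \<in> S. \<exists>s x. q = Quiet s x True}\<rparr>)"

lemma dpda_of_simps:
  "states (dpda_of A N) = to_nat ` cstates N"
  "input_alph (dpda_of A N) = A"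
  "stack_alph (dpda_of A N) = to_nat ` insert None (Some ` psyms N)"
  "start_state (dpda_of A N) = to_nat Init"
  "start_symbol (dpda_of A N) = to_nat (None :: nat option)"
  by (simp_all add: dpda_of_def Let_def)

lemma trans_dpda_of:
  assumes "x \<in> insert None (Some ` A)" "b \<in> insert None (Some ` psyms N)"
    and "s \<in> cstates N"
  shows "trans (dpda_of A N) (x, to_nat b, to_nat s) =
    map_option (\<lambda>(t, \<alpha>). (to_nat t, map to_nat \<alpha>)) (ctrans N x b s)"
proof -
  have "to_nat b \<in> to_nat ` insert None (Some ` psyms N)" using assms(2) by (rule imageI)
  moreover have "to_nat s \<in> to_nat ` cstates N"
    using assms(3) by (rule imageI)
  ultimately show ?thesis using assms(1) by (simp only: dpda_of_def Let_def dpda.simps prod.case from_nat_to_nat if_True simp_thms)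
qed

lemma trans_dpda_of_SomeD:
  assumes "trans (dpda_of A N) (x, b, s) = Some r"
  obtains b' s' where "b = to_nat b'" "s = to_nat s'"
    "x \<in> insert None (Some ` A)" "b' \<in> insert None (Some ` psyms N)"
    "s' \<in> cstates N"
proof -
  have "x \<in> insert None (Some ` A)" "b \<in> to_nat ` insert None (Some ` psyms N)"
    "s \<in> to_nat ` cstates N"
    using assms by (auto simp: dpda_of_def Let_def split: if_splits)
  then show ?thesis using that by blast
qed

lemma ctrans_closed:
  assumes ok: "popm_ok A N" and c: "ctrans N x b s = Some (t, \<alpha>)"
    and x: "x \<in> insert None (Some ` A)" and b: "b \<in> insert None (Some ` psyms N)"
    and s: "s \<in> cstates N"
  shows "t \<in> cstates N"
    and "\<alpha> \<in> lists (insert None (Some ` psyms N))"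
proof -
  have rd: "rd N a s b \<in> pstates N \<times> lists (psyms N)" if "a \<in> A" "s \<in> pstates N" for a s
    using ok that b unfolding popm_ok_def by blast
  have pp: "t \<in> pstates N" if "pop N s b = Some t" "s \<in> pstates N" "b \<in> psyms N" for s b t
    using ok that unfolding popm_ok_def by blast
  have i: "pinit N \<in> lists (psyms N) \<times> pstates N" using ok unfolding popm_ok_def by blast
  have "t \<in> cstates N \<and>
    \<alpha> \<in> lists (insert None (Some ` psyms N))"
  proof (cases x)
    case None
    then show ?thesis using c s b i pp
      by (cases s; cases b) (auto simp: image_iff split: option.splits)
  next
    case (Some a)
    then obtain s0 y z where s0: "s = Quiet s0 y z" using c by (cases s) auto
    obtain t' \<alpha>' where r: "rd N a s0 b = (t', \<alpha>')" by fastforce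
    have "a \<in> A" "s0 \<in> pstates N" using x s s0 Some by auto
    from rd[OF this] r have "t' \<in> pstates N" "\<alpha>' \<in> lists (psyms N)" by auto
    then show ?thesis using c r by (auto simp: Some s0)
  qed
  then show "t \<in> cstates N"
    and "\<alpha> \<in> lists (insert None (Some ` psyms N))" by blast+
qed

text \<open>\<open>Init\<close> and \<open>Settling\<close> have only silent moves,
  \<open>Quiet\<close> only reading moves, whatever lies on top of the stack. This is the dichotomy
  that \<open>is_dpda\<close> asks for.\<close>

lemma ctrans_total:
  "(\<exists>r. ctrans N None b s = Some r) \<and> (\<forall>a. ctrans N (Some a) b s = None) \<or>
   ctrans N None b s = None \<and> (\<forall>a. \<exists>r. ctrans N (Some a) b s = Some r)"
  by (cases s; cases b) (auto split: option.split prod.split)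

lemma is_dpda_dpda_of:
  assumes ok: "popm_ok A N" and A: "finite A"
  shows "is_dpda (dpda_of A N)"
proof -
  let ?M = "dpda_of A N"
  let ?S = "cstates N"
  let ?B = "insert None (Some ` psyms N)"
  have "dom (trans ?M) \<subseteq> insert None (Some ` input_alph ?M) \<times> stack_alph ?M \<times> states ?M"
  proof
    fix y assume "y \<in> dom (trans ?M)"
    then obtain x b s r where y: "y = (x, b, s)" and r: "trans ?M (x, b, s) = Some r" by (cases y) auto
    from r show "y \<in> insert None (Some ` input_alph ?M) \<times> stack_alph ?M \<times> states ?M"
      by (rule trans_dpda_of_SomeD) (simp only: y dpda_of_simps mem_Times_iff fst_conv snd_conv imageI simp_thms)
  qed
  moreover have "ran (trans ?M) \<subseteq> states ?M \<times> lists (stack_alph ?M)"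
  proof
    fix y assume "y \<in> ran (trans ?M)"
    then obtain x b s where r: "trans ?M (x, b, s) = Some y" by (auto simp: ran_def)
    then obtain b' s' where *: "b = to_nat b'" "s = to_nat s'" and m: "x \<in> insert None (Some ` A)" "b' \<in> ?B" "s' \<in> ?S"
      by (rule trans_dpda_of_SomeD)
    obtain t \<alpha> where ta: "ctrans N x b' s' = Some (t, \<alpha>)" "y = (to_nat t, map to_nat \<alpha>)"
      using r trans_dpda_of[OF m] unfolding * by auto
    have "\<alpha> \<in> lists ?B" "t \<in> ?S" using ctrans_closed[OF ok ta(1) m] by blast+
    then show "y \<in> states ?M \<times> lists (stack_alph ?M)"
      unfolding ta(2) dpda_of_simps by (auto simp: in_lists_conv_set)
  qed
  moreover have "((None, b, s) \<in> dom (trans ?M) \<and> (\<forall>a\<in>input_alph ?M. (Some a, b, s) \<notin> dom (trans ?M))) \<or>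
      ((None, b, s) \<notin> dom (trans ?M) \<and> (\<forall>a\<in>input_alph ?M. (Some a, b, s) \<in> dom (trans ?M)))"
    if "b \<in> stack_alph ?M" "s \<in> states ?M" for b s
  proof -
    from that obtain b' s' where *: "b = to_nat b'" "s = to_nat s'" "b' \<in> ?B" "s' \<in> ?S"
      unfolding dpda_of_simps by blast
    have "(x, b, s) \<in> dom (trans ?M) \<longleftrightarrow> (\<exists>r. ctrans N x b' s' = Some r)" if "x \<in> insert None (Some ` A)" for x
      unfolding *(1,2) dom_def using trans_dpda_of[OF that *(3,4)] by auto
    then show ?thesis using ctrans_total[of N b' s'] by (auto simp: dpda_of_simps)
  qed
  moreover have "finite (states ?M)" "finite (stack_alph ?M)" "finite (input_alph ?M)"
    "start_state ?M \<in> states ?M" "start_symbol ?M \<in> stack_alph ?M"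
    using ok A unfolding dpda_of_simps popm_ok_def by (auto simp: finite_cstates)
  moreover have "final_states ?M \<subseteq> states ?M" by (auto simp: dpda_of_def Let_def)
  ultimately show ?thesis unfolding is_dpda_def by blast
qed

definition cenc :: "nat list \<Rightarrow> cstate \<Rightarrow> nat list \<times> nat"
  where "cenc z q = (map to_nat (map Some z @ [None]), to_nat q)"

definition quiet :: "('a, nat, nat, bool \<times> bool) popm \<Rightarrow> nat list \<times> nat \<Rightarrow> cstate"
  where "quiet N c = Quiet (snd c) (fst (outc N c)) (snd (outc N c))"

lemma estep_cenc:
  assumes "z \<in> lists (psyms N)"
    and "q \<in> cstates N"
  shows "estep (dpda_of A N) (cenc z q) = map_option (\<lambda>(t, \<alpha>). (map to_nat (rev \<alpha> @ tl (map Some z @ [None])), to_nat t))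
      (ctrans N None (hdo z) q)"
proof -
  have "trans (dpda_of A N) (None, to_nat (hdo z), to_nat q) =
      map_option (\<lambda>(t, \<alpha>). (to_nat t, map to_nat \<alpha>)) (ctrans N None (hdo z) q)"
    using hdo_closed[OF assms(1)] assms(2) by (intro trans_dpda_of) auto
  then show ?thesis
    by (cases z) (auto simp: estep_def cenc_def rev_map option.map_comp comp_def split_def)
qed

lemma rstep_cenc:
  assumes "z \<in> lists (psyms N)" "a \<in> A"
    and "q \<in> cstates N"
  shows "rstep (dpda_of A N) a (cenc z q) = map_option (\<lambda>(t, \<alpha>). (map to_nat (rev \<alpha> @ tl (map Some z @ [None])), to_nat t))
      (ctrans N (Some a) (hdo z) q)"
proof -
  have "trans (dpda_of A N) (Some a, to_nat (hdo z), to_nat q) =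
      map_option (\<lambda>(t, \<alpha>). (to_nat t, map to_nat \<alpha>)) (ctrans N (Some a) (hdo z) q)"
    using hdo_closed[OF assms(1)] assms(2,3) by (intro trans_dpda_of) auto
  then show ?thesis
    by (cases z) (auto simp: rstep_def cenc_def rev_map option.map_comp comp_def split_def)
qed

lemma ereach_settle:
  assumes ok: "popm_ok A N"
  shows "z \<in> lists (psyms N) \<Longrightarrow> s \<in> pstates N \<Longrightarrow>
    ereach (dpda_of A N) (cenc z (Settling s)) (cenc (fst (settle (pop N) z s)) (quiet N (settle (pop N) z s)))"
proof (induction z arbitrary: s rule: list.induct)
  case Nil
  then have "erel (dpda_of A N) (cenc [] (Settling s)) (cenc [] (quiet N ([], s)))"
    by (simp add: erel_def estep_cenc) (simp add: cenc_def quiet_def outc_def)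
  then show ?case by (simp add: r_into_rtranclp)
next
  case (Cons b z)
  show ?case
  proof (cases "pop N s b")
    case None
    then have "erel (dpda_of A N) (cenc (b # z) (Settling s)) (cenc (b # z) (quiet N (b # z, s)))"
      using Cons.prems by (simp add: erel_def estep_cenc) (simp add: cenc_def quiet_def outc_def)
    then show ?thesis using None by (simp add: r_into_rtranclp)
  next
    case (Some t)
    then have "erel (dpda_of A N) (cenc (b # z) (Settling s)) (cenc z (Settling t))"
      using Cons.prems by (simp add: erel_def estep_cenc) (simp add: cenc_def)
    moreover have "t \<in> pstates N" using ok Some Cons.prems unfolding popm_ok_def by auto
    ultimately show ?thesis using Cons.IH[of t] Cons.prems Some by (simp add: converse_rtranclp_into_rtranclp)
  qed
qed

text \<open>Letters are read in quiet states only, and these store the tape bit. A guard on states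
  therefore acts as a condition \<open>h\<close> on the output.\<close>

lemma dpda_of_accepts:
  assumes ok: "popm_ok A N" and A: "finite A"
    and g: "\<And>l s x y. g l (to_nat (Quiet s x y)) = h l x"
  shows "w \<in> lists A \<Longrightarrow> z \<in> lists (psyms N) \<Longrightarrow> s \<in> pstates N \<Longrightarrow>
   (\<exists>c. greach (dpda_of A N) g w (cenc z (Settling s)) c \<and> maccepts (dpda_of A N) By_Final_State c) \<longleftrightarrow>
    snd (outc N (foldl (pstep N) (settle (pop N) z s) w)) \<and>
    along (\<lambda>p l. h l (fst (outc N (foldl (pstep N) (settle (pop N) z s) p)))) w"
proof (induction w arbitrary: z s rule: list.induct)
  case Nil
  let ?M = "dpda_of A N"
  obtain z' s' where st: "settle (pop N) z s = (z', s')" by fastforce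
  have zs: "z' \<in> lists (psyms N)" "s' \<in> pstates N"
    using settle_closed[of z "psyms N" s "pstates N" "pop N"] Nil ok unfolding st popm_ok_def by auto
  have reach: "ereach ?M (cenc z (Settling s)) (cenc z' (quiet N (z', s')))"
    using ereach_settle[OF ok Nil(2,3)] by (simp add: st)
  have q: "estep ?M (cenc z' (quiet N (z', s'))) = None"
    using zs by (subst estep_cenc) (auto simp: quiet_def)
  have fin: "t \<in> final_states ?M \<longleftrightarrow> (\<exists>s x. s \<in> pstates N \<and> t = to_nat (Quiet s x True))" for t
    by (auto simp: dpda_of_def Let_def)
  have "(\<exists>c. ereach ?M (cenc z (Settling s)) c \<and> snd c \<in> final_states ?M) \<longleftrightarrow> snd (outc N (z', s'))"
  proof
    assume "\<exists>c. ereach ?M (cenc z (Settling s)) c \<and> snd c \<in> final_states ?M"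
    then obtain c t x where c: "ereach ?M (cenc z (Settling s)) c" "snd c = to_nat (Quiet t x True)"
      unfolding fin by blast
    \<comment> \<open>Final states are quiet, so this configuration is at rest, and a silent path
      has only one configuration at rest.\<close>
    have "estep ?M c = None"
    proof (rule ccontr)
      assume "estep ?M c \<noteq> None"
      then obtain b r where "trans ?M (None, b, to_nat (Quiet t x True)) = Some r"
        using c(2) by (auto simp: estep_def split: list.splits)
      moreover from this show False
      proof (rule trans_dpda_of_SomeD)
        fix b' s' assume *: "b = to_nat b'" "to_nat (Quiet t x True) = to_nat s'" "(None :: 'a option) \<in> insert None (Some ` A)"
          "b' \<in> insert None (Some ` psyms N)" "s' \<in> cstates N"
        have "s' = Quiet t x True" using *(2) by simp
        then have "ctrans N None b' s' = None" by simp
        then have "trans ?M (None, to_nat b', to_nat s') = None" using trans_dpda_of[OF *(3-5)] by simp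
        then show False using *(1,2) calculation by simp
      qed
    qed
    then have "c = cenc z' (quiet N (z', s'))" using rest_unique[OF reach q c(1)] by blast
    then have "to_nat (Quiet t x True) = to_nat (quiet N (z', s'))" using c(2) by (simp add: cenc_def)
    then show "snd (outc N (z', s'))" by (simp add: quiet_def)
  next
    assume "snd (outc N (z', s'))"
    then show "\<exists>c. ereach ?M (cenc z (Settling s)) c \<and> snd c \<in> final_states ?M"
      using reach zs(2) unfolding fin by (intro exI[of _ "cenc z' (quiet N (z', s'))"]) (auto simp: cenc_def quiet_def)
  qed
  then show ?case by (simp add: maccepts_def st)
next
  case (Cons a w)
  let ?M = "dpda_of A N"
  obtain z' s' where st: "settle (pop N) z s = (z', s')" by fastforce
  have zs: "z' \<in> lists (psyms N)" "s' \<in> pstates N"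
    using settle_closed[of z "psyms N" s "pstates N" "pop N"] Cons.prems ok unfolding st popm_ok_def by auto
  have reach: "ereach ?M (cenc z (Settling s)) (cenc z' (quiet N (z', s')))"
    using ereach_settle[OF ok Cons.prems(2,3)] by (simp add: st)
  have q: "estep ?M (cenc z' (quiet N (z', s'))) = None"
    using zs by (subst estep_cenc) (auto simp: quiet_def)
  have a: "a \<in> A" "w \<in> lists A" using Cons.prems(1) by auto
  obtain t \<alpha> where r: "rd N a s' (hdo z') = (t, \<alpha>)" by fastforce
  have "(t, \<alpha>) \<in> pstates N \<times> lists (psyms N)"
    using ok a zs(2) hdo_closed[OF zs(1)] unfolding popm_ok_def r[symmetric] by blast
  moreover have "tl z' \<in> lists (psyms N)" using zs(1) by (cases z') auto
  ultimately have cl: "t \<in> pstates N" "\<alpha> @ tl z' \<in> lists (psyms N)" by auto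
  have rs: "rstep ?M a (cenc z' (quiet N (z', s'))) = Some (cenc (\<alpha> @ tl z') (Settling t))"
    using zs a r by (subst rstep_cenc) (cases z'; auto simp: quiet_def cenc_def)+
  have fold: "foldl (pstep N) (settle (pop N) z s) (a # v) =
      foldl (pstep N) (settle (pop N) (\<alpha> @ tl z') t) v" for v
    by (simp add: st pstep_def r)
  have "(\<exists>c. greach ?M g (a # w) (cenc z (Settling s)) c \<and> maccepts ?M By_Final_State c) \<longleftrightarrow>
      h a (fst (outc N (z', s'))) \<and>
      (\<exists>c. greach ?M g w (cenc (\<alpha> @ tl z') (Settling t)) c \<and> maccepts ?M By_Final_State c)"
    unfolding greach_Cons_rest[OF is_dpda_dpda_of[OF ok A] reach q]
    by (simp add: rs) (simp add: cenc_def quiet_def g)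
  then show ?case unfolding Cons.IH[OF a(2) cl(2,1)] along.simps fold by (simp add: st) blast
qed

lemma dpda_of_accepting_iff:
  assumes ok: "popm_ok A N" and A: "finite A" and w: "w \<in> lists A"
    and g: "\<And>l s x y. g l (to_nat (Quiet s x y)) = h l x"
  shows "(\<exists>c\<in>accepting_configs (dpda_of A N) By_Final_State.
      (gstep (dpda_of A N) g)\<^sup>*\<^sup>* (w, [start_symbol (dpda_of A N)], start_state (dpda_of A N)) c) \<longleftrightarrow>
    snd (outc N (prun N w)) \<and> along (\<lambda>p l. h l (fst (outc N (prun N p)))) w"
proof -
  let ?M = "dpda_of A N"
  let ?c = "([start_symbol ?M], start_state ?M)" and ?d = "cenc (fst (pinit N)) (Settling (snd (pinit N)))"
  have M: "is_dpda ?M" by (rule is_dpda_dpda_of[OF ok A])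
  have i: "fst (pinit N) \<in> lists (psyms N)" "snd (pinit N) \<in> pstates N"
    using ok unfolding popm_ok_def by auto
  have c: "?c = cenc [] Init" by (simp add: cenc_def dpda_of_simps)
  have e: "estep ?M ?c = Some ?d" unfolding c by (subst estep_cenc) (auto simp: cenc_def rev_map)
  then have step: "ereach ?M ?c ?d" by (simp add: r_into_rtranclp erel_def)
  have nf: "\<not> maccepts ?M By_Final_State ?c" by (auto simp: maccepts_def dpda_of_def Let_def)
  have reach: "ereach ?M ?c x \<longleftrightarrow> x = ?c \<or> ereach ?M ?d x" for x
  proof
    assume "ereach ?M ?c x"
    then show "x = ?c \<or> ereach ?M ?d x"
      by (cases rule: converse_rtranclpE) (use e in \<open>auto simp: erel_def\<close>)
  qed (use step in \<open>auto intro: rtranclp_trans\<close>)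
  have "greach ?M g w ?c x \<and> maccepts ?M By_Final_State x \<longleftrightarrow> greach ?M g w ?d x \<and> maccepts ?M By_Final_State x" for x
  proof (cases w)
    case Nil
    then show ?thesis using nf by (auto simp: reach)
  next
    case (Cons a v)
    have "rstep ?M a ?c = None" using rstep_imp_estep_None[OF M, of a ?c] e by (cases "rstep ?M a ?c") auto
    then show ?thesis unfolding Cons greach.simps reach by auto
  qed
  then show ?thesis
    unfolding accepting_iff[OF M] using dpda_of_accepts[of A N g h, OF ok A g w i] by (simp add: prun_def pstart_def)
qed

lemma pdfun_imp_dpda_language:
  assumes "finite A" "pdfun A F"
  shows "is_dpda_language A {w \<in> lists A. F w}"
proof -
  \<comment> \<open>On one tape the tape bit is a dummy.\<close>
  have "pdfun A (\<lambda>w. (True, F w))"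
    using pdfun_monitor[OF assms(2), of "\<lambda>_ x. (True, x)" "\<lambda>_. True"] .
  then obtain N :: "('a, nat, nat, bool \<times> bool) popm" where ok: "popm_ok A N"
    and N: "\<And>w. w \<in> lists A \<Longrightarrow> (True, F w) = outc N (prun N w)"
    unfolding pdfun_def by blast
  have t: "along (\<lambda>_ _. True) w" for w :: "'a list" by (induction w) auto
  have "w \<in> dpda_lang (dpda_of A N) By_Final_State \<longleftrightarrow> w \<in> lists A \<and> F w" for w
  proof (cases "w \<in> lists A")
    case True
    have "snd (outc N (prun N w)) = F w" using N[OF True, symmetric] by simp
    then show ?thesis unfolding dpda_lang_def dpda_step_eq_gstep
      using dpda_of_accepting_iff[OF ok assms(1) True, of "\<lambda>_ _. True" "\<lambda>_ _. True"] True
      by (simp add: dpda_of_simps t)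
  qed (auto simp: dpda_lang_def dpda_of_simps)
  then have "dpda_lang (dpda_of A N) By_Final_State = {w \<in> lists A. F w}" by blast
  then show ?thesis unfolding is_dpda_language_def
    using is_dpda_dpda_of[OF ok assms(1)] by (metis dpda_of_simps(2))
qed

lemma pdfun_imp_two_tape:
  assumes "finite A" "pdfun (two_tape_alph A) F"
  shows "is_two_tape_language A {(u, v). u \<in> lists A \<and> v \<in> lists A \<and> tape_run F [] (with_end u) (with_end v)}"
proof -
  let ?A = "two_tape_alph A"
  obtain N :: "('a tape_letter, nat, nat, bool \<times> bool) popm" where ok: "popm_ok ?A N"
    and N: "\<And>w. w \<in> lists ?A \<Longrightarrow> F w = outc N (prun N w)"
    using assms(2) unfolding pdfun_def by blast
  have fin: "finite ?A" using assms(1) by (simp add: finite_two_tape_alph)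
  let ?M = "dpda_of ?A N"
  \<comment> \<open>Quiet states with tape bit \<open>False\<close> read the flat tape. All others,
    including those that read nothing, go to \<open>S1\<close>, which makes this a
    partition.\<close>
  define S2 where "S2 = {q \<in> states ?M. \<exists>s y. q = to_nat (Quiet s False y)}"
  define S1 where "S1 = states ?M - S2"
  have S: "states ?M = S1 \<union> S2" "S1 \<inter> S2 = {}" by (auto simp: S1_def S2_def)
  define g where "g = (\<lambda>(l :: 'a tape_letter) s. isl l \<longleftrightarrow> \<not> (\<exists>s' y. s = to_nat (Quiet s' False y)))"
  have step: "two_tape_step ?M S1 S2 = gstep ?M g"
    unfolding two_tape_step_eq_gstep
  proof (intro ext)
    fix c c'
    have st: "snd (snd c) \<in> states ?M" if "dpda_move ?M x c c'" for x
      using that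
    proof cases
      case (read a b s t \<alpha> v y)
      then have "(Some a, b, s) \<in> dom (trans ?M)" by blast
      then show ?thesis using is_dpda_dpda_of[OF ok fin] read(2) unfolding is_dpda_def by auto
    next
      case (silent b s t \<alpha> v y)
      then have "(None, b, s) \<in> dom (trans ?M)" by blast
      then show ?thesis using is_dpda_dpda_of[OF ok fin] silent(2) unfolding is_dpda_def by auto
    qed
    have "(case l of Inl _ \<Rightarrow> s \<in> S1 | Inr _ \<Rightarrow> s \<in> S2) = g l s" if "s \<in> states ?M" for l s
      using that by (cases l) (auto simp: S1_def S2_def g_def)
    then show "gstep ?M (\<lambda>l s. case l of Inl _ \<Rightarrow> s \<in> S1 | Inr _ \<Rightarrow> s \<in> S2) c c' = gstep ?M g c c'"
      unfolding gstep_def using st by blast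
  qed
  have along: "along (\<lambda>p l. isl l = fst (outc N (prun N p))) w \<longleftrightarrow> along (\<lambda>p l. isl l = fst (F p)) w"
    if "w \<in> lists ?A" for w
    using that by (induction w rule: rev_induct) (auto simp: N)
  have "(\<exists>w\<in>tape_shuffles (with_end u) (with_end v). \<exists>c\<in>accepting_configs ?M By_Final_State.
      (two_tape_step ?M S1 S2)\<^sup>*\<^sup>* (w, [start_symbol ?M], start_state ?M) c) \<longleftrightarrow>
      tape_run F [] (with_end u) (with_end v)" if uv: "u \<in> lists A" "v \<in> lists A" for u v
  proof -
    have "(\<exists>c\<in>accepting_configs ?M By_Final_State. (two_tape_step ?M S1 S2)\<^sup>*\<^sup>* (w, [start_symbol ?M], start_state ?M) c) \<longleftrightarrow>
        snd (F w) \<and> along (\<lambda>p l. isl l = fst (F p)) w"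
      if "lefts w = with_end u" "rights w = with_end v" for w
    proof -
      have w: "w \<in> lists ?A" using shuffle_in_two_tape_alph[OF that uv] .
      show ?thesis unfolding step along[OF w, symmetric] N[OF w]
        by (rule dpda_of_accepting_iff[OF ok fin w]) (auto simp: g_def)
    qed
    then show ?thesis unfolding tape_run_iff by (auto simp: Bex_def tape_shuffles_iff)
  qed
  then have "{(u, v). u \<in> lists A \<and> v \<in> lists A \<and> tape_run F [] (with_end u) (with_end v)} =
      two_tape_lang A ?M S1 S2 By_Final_State"
    unfolding two_tape_lang_def by blast
  then show ?thesis unfolding is_two_tape_language_def
    using is_dpda_dpda_of[OF ok fin] dpda_of_simps(2)[of ?A N] S by blast
qed

section \<open>Closure properties\<close>

subsection \<open>Sequential transducers\<close>

definition olist :: "'a option \<Rightarrow> 'a list"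
  where "olist x = (case x of None \<Rightarrow> [] | Some a \<Rightarrow> [a])"

lemma olist_simps [simp]: "olist None = []" "olist (Some a) = [a]"
  by (simp_all add: olist_def)

text \<open>At most one letter is emitted per letter read, because one command feeds at most one
  letter. Nothing is emitted at the end of the word.\<close>

fun tr :: "('q \<Rightarrow> 'c \<Rightarrow> 'q \<times> 'a option) \<Rightarrow> 'q \<Rightarrow> 'c list \<Rightarrow> 'a list"
  where
    "tr \<delta> q [] = []"
  | "tr \<delta> q (c # v) = olist (snd (\<delta> q c)) @ tr \<delta> (fst (\<delta> q c)) v"

definition trs :: "('q \<Rightarrow> 'c \<Rightarrow> 'q \<times> 'a option) \<Rightarrow> 'q \<Rightarrow> 'c list \<Rightarrow> 'q"
  where "trs \<delta> q v = foldl (\<lambda>q c. fst (\<delta> q c)) q v"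

lemma trs_simps [simp]: "trs \<delta> q [] = q" "trs \<delta> q (c # v) = trs \<delta> (fst (\<delta> q c)) v"
  "trs \<delta> q (v @ w) = trs \<delta> (trs \<delta> q v) w"
  by (simp_all add: trs_def)

lemma tr_append [simp]: "tr \<delta> q (v @ w) = tr \<delta> q v @ tr \<delta> (trs \<delta> q v) w"
  by (induction v arbitrary: q) auto

definition transducer :: "'q set \<Rightarrow> 'q \<Rightarrow> 'c set \<Rightarrow> 'a set \<Rightarrow> ('q \<Rightarrow> 'c \<Rightarrow> 'q \<times> 'a option) \<Rightarrow> bool"
  where "transducer Q q0 C A \<delta> \<longleftrightarrow> finite Q \<and> q0 \<in> Q \<and>
    (\<forall>q\<in>Q. \<forall>c\<in>C. fst (\<delta> q c) \<in> Q \<and> set (olist (snd (\<delta> q c))) \<subseteq> A)"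

lemma tr_lists: "transducer Q q0 C A \<delta> \<Longrightarrow> v \<in> lists C \<Longrightarrow> tr \<delta> q0 v \<in> lists A"
proof -
  assume t: "transducer Q q0 C A \<delta>" and v: "v \<in> lists C"
  have "q \<in> Q \<Longrightarrow> set (tr \<delta> q v) \<subseteq> A" for q
    using v
  proof (induction v arbitrary: q rule: list.induct)
    case (Cons c v)
    then have "fst (\<delta> q c) \<in> Q" "set (olist (snd (\<delta> q c))) \<subseteq> A"
      using t unfolding transducer_def by auto
    then show ?case using Cons by auto
  qed simp
  then show ?thesis using t unfolding transducer_def by auto
qed

lemma pdfun_tr:
  fixes \<delta> :: "'q :: countable \<Rightarrow> 'c \<Rightarrow> 'q \<times> 'a option"
  assumes F: "pdfun A F" and t: "transducer Q q0 C A \<delta>"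
  shows "pdfun C (\<lambda>v. F (tr \<delta> q0 v))"
proof -
  let ?act = "\<lambda>q c (x :: 'b). (fst (\<delta> q c), case snd (\<delta> q c) of None \<Rightarrow> Nop | Some a \<Rightarrow> Feed a)"
  have fold: "foldl (cstep F ?act) (q, w) v = (trs \<delta> q v, w @ tr \<delta> q v)" for q w v
    by (induction v arbitrary: q w) (auto split: option.split)
  have "pdfun C (\<lambda>v. case foldl (cstep F ?act) (q0, []) v of (q, w) \<Rightarrow> F w)"
    using t unfolding transducer_def
    by (intro pdfun_control[OF F, where Q = Q]) (force split: option.splits)+
  then show ?thesis by (simp add: fold)
qed

lemma pdfun_out: "pdfun A F \<Longrightarrow> pdfun A (\<lambda>w. h (F w))"
  using pdfun_monitor[of A F "\<lambda>_. h"] by simp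


subsection \<open>Languages on one tape\<close>

lemma P_language_pdfun: "finite A \<Longrightarrow> pdfun A F \<Longrightarrow> P_language A {w \<in> lists A. F w}"
  unfolding P_language_def using pdfun_imp_dpda_language
  by (intro exI[of _ "{{w \<in> lists A. F w}}"]) simp

lemma P_language_Int: "P_language A K \<Longrightarrow> P_language A L \<Longrightarrow> P_language A (K \<inter> L)"
  unfolding P_language_def by (elim exE conjE, rule_tac x = "F \<union> Fa" in exI) auto

lemma P_language_subset: "P_language A L \<Longrightarrow> finite A \<and> L \<subseteq> lists A"
  unfolding P_language_def using dpda_language_imp_pdfun by blast

text \<open>The intersection is moved through \<open>\<Phi>\<close>, after which only single
  automata have to be transformed.\<close>

lemma P_language_image:
  assumes L: "P_language A L"
    and K: "\<And>K. is_dpda_language A K \<Longrightarrow> is_dpda_language C (\<Phi> K)"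
    and Int: "\<And>F. F \<noteq> {} \<Longrightarrow> \<Phi> (\<Inter>F) = \<Inter>(\<Phi> ` F)"
  shows "P_language C (\<Phi> L)"
proof -
  obtain F where "finite F" "F \<noteq> {}" "\<forall>K\<in>F. is_dpda_language A K" "L = \<Inter>F"
    using L unfolding P_language_def by blast
  then show ?thesis unfolding P_language_def using K Int[of F]
    by (intro exI[of _ "\<Phi> ` F"]) simp
qed

lemma P_language_vimage:
  fixes \<delta> :: "'q :: countable \<Rightarrow> 'c \<Rightarrow> 'q \<times> 'a option"
  assumes L: "P_language A L" and t: "transducer Q q0 C A \<delta>" and C: "finite C"
  shows "P_language C {v \<in> lists C. tr \<delta> q0 v \<in> L}"
  using L
proof (rule P_language_image[where \<Phi> = "\<lambda>L. {v \<in> lists C. tr \<delta> q0 v \<in> L}"])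
  fix K assume "is_dpda_language A K"
  then have "pdfun A (\<lambda>w. w \<in> K)" using dpda_language_imp_pdfun by blast
  from pdfun_imp_dpda_language[OF C pdfun_tr[OF this t]]
  show "is_dpda_language C {v \<in> lists C. tr \<delta> q0 v \<in> K}" .
qed auto

text \<open>\<open>None\<close> terminates a chunk, and \<open>u\<close> collects the current one. A
  last chunk without terminator is dropped.\<close>

fun chunks :: "'a option list \<Rightarrow> 'a list \<Rightarrow> 'a list list"
  where
    "chunks [] u = []"
  | "chunks (None # w) u = u # chunks w []"
  | "chunks (Some a # w) u = chunks w (u @ [a])"

lemma chunks_map [simp]:
  "chunks (map Some y @ None # w) u = (u @ y) # chunks w []"
  "chunks (map Some y) u = []"
  by (induction y arbitrary: u) auto

text \<open>At each terminator the verdict on the finished chunk is added to the controller's bit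
  and the machine is reset.\<close>

lemma pdfun_chunks:
  assumes F: "pdfun A F"
  shows "pdfun (insert None (Some ` A)) (\<lambda>w. \<forall>u\<in>set (chunks w []). F u)"
proof -
  let ?act = "\<lambda>ok c x. case c of None \<Rightarrow> (ok \<and> x, Reset) | Some a \<Rightarrow> (ok, Feed a)"
  have fold: "fst (foldl (cstep F ?act) (ok, u) w) \<longleftrightarrow> ok \<and> (\<forall>x\<in>set (chunks w u). F x)" for ok u w
  proof (induction w arbitrary: ok u)
    case (Cons c w)
    then show ?case by (cases c) auto
  qed simp
  have "pdfun (insert None (Some ` A)) (\<lambda>v. case foldl (cstep F ?act) (True, []) v of (q, w) \<Rightarrow> q)"
    by (rule pdfun_control[OF F, where Q = UNIV]) (auto split: option.splits)
  then show ?thesis by (simp add: case_prod_unfold fold)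
qed

lemma P_language_chunks:
  assumes L: "P_language A L"
  shows "P_language (insert None (Some ` A)) {w \<in> lists (insert None (Some ` A)). \<forall>u\<in>set (chunks w []). u \<in> L}"
  using L
proof (rule P_language_image[where \<Phi> = "\<lambda>L. {w \<in> lists (insert None (Some ` A)). \<forall>u\<in>set (chunks w []). u \<in> L}"])
  fix K assume "is_dpda_language A K"
  then have "pdfun A (\<lambda>w. w \<in> K)" "finite A" using dpda_language_imp_pdfun by blast+
  then show "is_dpda_language (insert None (Some ` A)) {w \<in> lists (insert None (Some ` A)). \<forall>u\<in>set (chunks w []). u \<in> K}"
    by (intro pdfun_imp_dpda_language pdfun_chunks) auto
qed auto

lemma pdfun_fixed_word:
  fixes e :: "'a :: countable list"
  shows "pdfun A (\<lambda>w. w = e)"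
proof -
  \<comment> \<open>\<open>Some r\<close> means that \<open>r\<close> remains to be read,
    \<open>None\<close> that the input has already failed.\<close>
  let ?\<delta> = "\<lambda>q a. case q of None \<Rightarrow> None | Some r \<Rightarrow> (case r of [] \<Rightarrow> None | x # r' \<Rightarrow> if a = x then Some r' else None)"
  have None: "foldl ?\<delta> None w = None" for w by (induction w) auto
  have fold: "foldl ?\<delta> (Some r) w = Some [] \<longleftrightarrow> w = r" for r w
  proof (induction w arbitrary: r)
    case (Cons a w)
    then show ?case by (cases r) (auto simp: None)
  qed auto
  have "pdfun A (\<lambda>v. (\<lambda>q. q = Some []) (foldl ?\<delta> (Some e) v))"
  proof (rule pdfun_finite_automaton[where Q = "insert None (Some ` (\<lambda>k. drop k e) ` {..length e})"])
    show "Some e \<in> insert None (Some ` (\<lambda>k. drop k e) ` {..length e})" by (auto intro!: image_eqI[of _ _ 0])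
    fix q a assume "q \<in> insert None (Some ` (\<lambda>k. drop k e) ` {..length e})"
    then consider "q = None" | k where "k \<le> length e" "q = Some (drop k e)" by auto
    then show "?\<delta> q a \<in> insert None (Some ` (\<lambda>k. drop k e) ` {..length e})"
    proof cases
      case 2
      show ?thesis
      proof (cases "k = length e")
        case False
        then have "drop k e = e ! k # drop (Suc k) e" "Suc k \<le> length e" using 2 by (simp_all add: Cons_nth_drop_Suc)
        then show ?thesis using 2 by auto
      qed (use 2 in auto)
    qed auto
  qed simp
  then show ?thesis by (simp add: fold)
qed

text \<open>The stack holds what remains of the first word; the state is \<^const>\<open>None\<close> as long as no
  difference has been found.\<close>

lemma pdfun_compare:
  fixes A :: "'a :: {countable, linorder} set"
  assumes A: "finite A"
  obtains F where "pdfun (A <+> A) F" "\<And>s v. s \<in> lists A \<Longrightarrow> v \<in> lists A \<Longrightarrow> F (map Inl s @ map Inr v) = (rev s = v, rev s < v)"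
proof -
  \<comment> \<open>\<open>Some True\<close> records that the reversed first word is smaller. If the
    stack is empty when another letter arrives, that word is a proper prefix, hence smaller. If
    symbols are left at the end, it is larger, and both output bits are false.\<close>
  define N :: "('a + 'a, 'a, bool option, bool \<times> bool) popm" where "N =
    \<lparr>pstates = UNIV, psyms = A, pop = (\<lambda>_ _. None),
     rd = (\<lambda>l q b. case q of
         None \<Rightarrow> (case l of
           Inl a \<Rightarrow> (None, a # olist b)
         | Inr a \<Rightarrow> (case b of None \<Rightarrow> (Some True, []) | Some c \<Rightarrow>
             if c = a then (None, []) else (Some (c < a), [c])))
       | Some x \<Rightarrow> (Some x, olist b)),
     out = (\<lambda>q b. (q = None \<and> b = None, q = Some True)),
     pinit = ([], None)\<rparr>"
  have ok: "popm_ok (A <+> A) N"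
    using A by (auto simp: popm_ok_def N_def olist_def split: option.splits sum.splits)
  have st: "settle (pop N) z q = (z, q)" for z q by (cases z) (auto simp: N_def)
  have rest: "olist (hdo z) @ tl z = z" for z :: "'a list" by (cases z) auto
  have push: "foldl (pstep N) (z, None) (map Inl s) = (rev s @ z, None)" for z s
  proof (induction s arbitrary: z)
    case (Cons a s)
    have "pstep N (z, None) (Inl a) = (a # z, None)" unfolding pstep_def by (simp add: N_def st[unfolded N_def, simplified] rest)
    then show ?case using Cons by simp
  qed simp
  have stuck: "foldl (pstep N) (z, Some x) w = (z, Some x)" for z x w
  proof (induction w)
    case (Cons a w)
    have "pstep N (z, Some x) a = (z, Some x)" unfolding pstep_def by (simp add: N_def st[unfolded N_def, simplified] rest)
    then show ?case using Cons by simp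
  qed simp
  have cmp: "outc N (foldl (pstep N) (z, None) (map Inr v)) = (z = v, z < v)" for z v
  proof (induction v arbitrary: z)
    case Nil
    then show ?case by (cases z) (auto simp: outc_def N_def)
  next
    case (Cons a v)
    have step: "pstep N (z, None) (Inr a) = (case z of [] \<Rightarrow> ([], Some True) | c # y \<Rightarrow>
        if c = a then (y, None) else (z, Some (c < a)))"
      unfolding pstep_def by (cases z) (simp_all add: N_def st[unfolded N_def, simplified])
    have [simp]: "outc N (y, Some x) = (False, x)" for y x by (simp add: outc_def N_def)
    show ?case
    proof (cases z)
      case Nil
      then show ?thesis using step by (simp add: stuck)
    next
      case (Cons c y)
      then show ?thesis using Cons.IH[of y] step by (simp add: stuck)
    qed
  qed
  have "pstart N = ([], None)" unfolding pstart_def st by (simp add: N_def)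
  then have "outc N (prun N (map Inl s @ map Inr v)) = (rev s = v, rev s < v)" for s v
    using push[of "[]" s] cmp[of "rev s" v] by (simp add: prun_def)
  moreover have "pdfun (A <+> A) (\<lambda>w. outc N (prun N w))" using ok by (rule pdfunI) simp
  ultimately show ?thesis using that by blast
qed


subsection \<open>Relations on two tapes\<close>

lemma ATP_pdfun:
  assumes "finite A" "pdfun (two_tape_alph A) F"
    and "\<And>u v. u \<in> lists A \<Longrightarrow> v \<in> lists A \<Longrightarrow> tape_run F [] (with_end u) (with_end v) \<longleftrightarrow> (u, v) \<in> R"
    and "R \<subseteq> lists A \<times> lists A"
  shows "is_two_tape_language A R"
proof -
  have "R = {(u, v). u \<in> lists A \<and> v \<in> lists A \<and> tape_run F [] (with_end u) (with_end v)}"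
    using assms(3,4) by blast
  then show ?thesis using pdfun_imp_two_tape[OF assms(1,2)] by simp
qed

lemma ATP_language_single: "is_two_tape_language A R \<Longrightarrow> ATP_language A R"
  unfolding ATP_language_def by (intro exI[of _ "{R}"]) simp

lemma ATP_language_Int: "ATP_language A K \<Longrightarrow> ATP_language A L \<Longrightarrow> ATP_language A (K \<inter> L)"
  unfolding ATP_language_def by (elim exE conjE, rule_tac x = "F \<union> Fa" in exI) auto

lemma ATP_language_image:
  assumes L: "ATP_language A R"
    and K: "\<And>K. is_two_tape_language A K \<Longrightarrow> is_two_tape_language C (\<Phi> K)"
    and Int: "\<And>F. F \<noteq> {} \<Longrightarrow> \<Phi> (\<Inter>F) = \<Inter>(\<Phi> ` F)"
  shows "ATP_language C (\<Phi> R)"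
proof -
  obtain F where "finite F" "F \<noteq> {}" "\<forall>K\<in>F. is_two_tape_language A K" "R = \<Inter>F"
    using L unfolding ATP_language_def by blast
  then show ?thesis unfolding ATP_language_def using K Int[of F]
    by (intro exI[of _ "\<Phi> ` F"]) simp
qed

lemma ATP_language_from_P:
  assumes L: "P_language A L"
    and K: "\<And>K. is_dpda_language A K \<Longrightarrow> is_two_tape_language C (\<Phi> K)"
    and Int: "\<And>F. F \<noteq> {} \<Longrightarrow> \<Phi> (\<Inter>F) = \<Inter>(\<Phi> ` F)"
  shows "ATP_language C (\<Phi> L)"
proof -
  obtain F where "finite F" "F \<noteq> {}" "\<forall>K\<in>F. is_dpda_language A K" "L = \<Inter>F"
    using L unfolding P_language_def by blast
  then show ?thesis unfolding ATP_language_def using K Int[of F]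
    by (intro exI[of _ "\<Phi> ` F"]) simp
qed

definition end_tr :: "('q \<Rightarrow> 'c \<Rightarrow> 'q \<times> 'a option) \<Rightarrow> 'q \<Rightarrow> 'c option \<Rightarrow> 'q \<times> 'a option option"
  where "end_tr \<delta> q c = (case c of None \<Rightarrow> (q, Some None) | Some c \<Rightarrow> map_prod id (map_option Some) (\<delta> q c))"

text \<open>Two copies of the transducer run along the shuffle, one for each tape, so the
  translation of a tape does not depend on how the tapes are interleaved.\<close>

definition pair_tr :: "('q \<Rightarrow> 'c \<Rightarrow> 'q \<times> 'a option) \<Rightarrow> 'q \<times> 'q \<Rightarrow> 'c + 'c \<Rightarrow> ('q \<times> 'q) \<times> ('a + 'a) option"
  where "pair_tr \<delta> = (\<lambda>(p, q) c. case c of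
      Inl a \<Rightarrow> ((fst (\<delta> p a), q), map_option Inl (snd (\<delta> p a)))
    | Inr a \<Rightarrow> ((p, fst (\<delta> q a)), map_option Inr (snd (\<delta> q a))))"

lemma tr_end_tr: "tr (end_tr \<delta>) q (with_end u) = with_end (tr \<delta> q u)"
proof -
  have "olist (map_option Some x) = map Some (olist x)" for x :: "'a option" by (cases x) auto
  then have "tr (end_tr \<delta>) q (map Some u @ [None]) = map Some (tr \<delta> q u) @ [None]"
    by (induction u arbitrary: q) (auto simp: end_tr_def)
  then show ?thesis by (simp add: with_end_def)
qed

text \<open>While a letter emits nothing, the output of \<open>F\<close> is unchanged and the same
  tape is read on, so the original run keeps pace with the run on the translated tapes. Because the
  end marker is last and is always emitted, a tape is exhausted exactly when its translation is;
  otherwise unread letters without output could be left behind.\<close>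

lemma tape_run_tr:
  fixes \<delta> :: "'q \<Rightarrow> 'c \<Rightarrow> 'q \<times> 'a option"
  assumes "trs (pair_tr (end_tr \<delta>)) (q, q) w = (p1, p2)"
    and "u = [] \<or> last u = None" "v = [] \<or> last v = None"
  shows "tape_run (\<lambda>w. F (tr (pair_tr (end_tr \<delta>)) (q, q) w)) w u v \<longleftrightarrow>
    tape_run F (tr (pair_tr (end_tr \<delta>)) (q, q) w) (tr (end_tr \<delta>) p1 u) (tr (end_tr \<delta>) p2 v)"
  using assms
proof (induction "length u + length v" arbitrary: w u v p1 p2 rule: less_induct)
  case less
  let ?d = "pair_tr (end_tr \<delta>)" and ?e = "end_tr \<delta>"
  let ?F = "\<lambda>w. F (tr ?d (q, q) w)"
  have ne: "tr ?e p x \<noteq> []" if "x \<noteq> []" "x = [] \<or> last x = None" for p x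
  proof -
    have "x = butlast x @ [None]" using that append_butlast_last_id[of x] by simp
    then show ?thesis by (metis append_is_Nil_conv end_tr_def list.distinct(1) olist_simps(2) option.simps(4) snd_conv tr.simps(2) tr_append)
  qed
  show ?case
  proof (cases "u = [] \<and> v = []")
    case True
    then show ?thesis by (simp add: tape_run.simps)
  next
    case False
    then have nn: "\<not> (tr ?e p1 u = [] \<and> tr ?e p2 v = [])"
      using ne[of u p1] ne[of v p2] less.prems by blast
    show ?thesis
    proof (cases "fst (?F w)")
      case True
      show ?thesis
      proof (cases u)
        case Nil
        then show ?thesis using True False nn by (simp add: tape_run.simps)
      next
        case (Cons a u')
        have t: "trs ?d (q, q) (w @ [Inl a]) = (fst (?e p1 a), p2)"
          using less.prems(1) by (simp add: pair_tr_def)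
        have "tape_run ?F w u v = tape_run ?F (w @ [Inl a]) u' v"
          by (subst tape_run.simps) (simp add: Cons True)
        also have "\<dots> = tape_run F (tr ?d (q, q) (w @ [Inl a])) (tr ?e (fst (?e p1 a)) u') (tr ?e p2 v)"
          using less.prems by (intro less.hyps[OF _ t]) (auto simp: Cons split: if_splits)
        also have "\<dots> = tape_run F (tr ?d (q, q) w) (tr ?e p1 u) (tr ?e p2 v)"
        proof (cases "snd (?e p1 a)")
          case None
          then show ?thesis using less.prems(1) by (simp add: Cons pair_tr_def)
        next
          case (Some b)
          then show ?thesis using less.prems(1) True
            by (subst (2) tape_run.simps) (simp add: Cons pair_tr_def)
        qed
        finally show ?thesis .
      qed
    next
      case F: False
      show ?thesis
      proof (cases v)
        case Nil
        then show ?thesis using F False nn by (simp add: tape_run.simps)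
      next
        case (Cons a v')
        have t: "trs ?d (q, q) (w @ [Inr a]) = (p1, fst (?e p2 a))"
          using less.prems(1) by (simp add: pair_tr_def)
        have "tape_run ?F w u v = tape_run ?F (w @ [Inr a]) u v'"
          by (subst tape_run.simps) (simp add: Cons F)
        also have "\<dots> = tape_run F (tr ?d (q, q) (w @ [Inr a])) (tr ?e p1 u) (tr ?e (fst (?e p2 a)) v')"
          using less.prems by (intro less.hyps[OF _ t]) (auto simp: Cons split: if_splits)
        also have "\<dots> = tape_run F (tr ?d (q, q) w) (tr ?e p1 u) (tr ?e p2 v)"
        proof (cases "snd (?e p2 a)")
          case None
          then show ?thesis using less.prems(1) by (simp add: Cons pair_tr_def)
        next
          case (Some b)
          then show ?thesis using less.prems(1) F
            by (subst (2) tape_run.simps) (simp add: Cons pair_tr_def)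
        qed
        finally show ?thesis .
      qed
    qed
  qed
qed

lemma ATP_language_vimage:
  fixes \<delta> :: "'q :: countable \<Rightarrow> 'c \<Rightarrow> 'q \<times> 'a option"
  assumes R: "ATP_language A R" and t: "transducer Q q0 C A \<delta>" and C: "finite C"
  shows "ATP_language C {(u, v). u \<in> lists C \<and> v \<in> lists C \<and> (tr \<delta> q0 u, tr \<delta> q0 v) \<in> R}"
  using R
proof (rule ATP_language_image[where \<Phi> = "\<lambda>R. {(u, v). u \<in> lists C \<and> v \<in> lists C \<and> (tr \<delta> q0 u, tr \<delta> q0 v) \<in> R}"])
  fix K assume "is_two_tape_language A K"
  then obtain F where F: "pdfun (two_tape_alph A) F"
    and K: "K = {(u, v). u \<in> lists A \<and> v \<in> lists A \<and> tape_run F [] (with_end u) (with_end v)}"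
    using two_tape_imp_pdfun by blast
  have "transducer (Q \<times> Q) (q0, q0) (two_tape_alph C) (two_tape_alph A) (pair_tr (end_tr \<delta>))"
    unfolding transducer_def
  proof (intro conjI ballI)
    show "finite (Q \<times> Q)" "(q0, q0) \<in> Q \<times> Q" using t by (auto simp: transducer_def)
    fix q c assume q: "q \<in> Q \<times> Q" and c: "c \<in> two_tape_alph C"
    have *: "fst (\<delta> q c) \<in> Q" "\<And>a. snd (\<delta> q c) = Some a \<Longrightarrow> a \<in> A" if "q \<in> Q" "c \<in> C" for q c
      using t that unfolding transducer_def by fastforce+
    show "fst (pair_tr (end_tr \<delta>) q c) \<in> Q \<times> Q"
      using q c by (auto simp: pair_tr_def end_tr_def two_tape_alph_def * split: option.split)
    have o: "set (olist (map_option Inl (map_option Some x))) \<subseteq> two_tape_alph A"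
      "set (olist (map_option Inr (map_option Some x))) \<subseteq> two_tape_alph A" if "\<And>a. x = Some a \<Longrightarrow> a \<in> A" for x
      using that by (cases x; auto simp: two_tape_alph_def)+
    have N: "Inl None \<in> two_tape_alph A" "Inr None \<in> two_tape_alph A" by (auto simp: two_tape_alph_def)
    from c consider "c = Inl None" | "c = Inr None" | a where "c = Inl (Some a)" "a \<in> C" | a where "c = Inr (Some a)" "a \<in> C"
      unfolding two_tape_alph_def by auto
    then show "set (olist (snd (pair_tr (end_tr \<delta>) q c))) \<subseteq> two_tape_alph A"
    proof cases
      case 3
      have "set (olist (map_option Inl (map_option Some (snd (\<delta> (fst q) a))))) \<subseteq> two_tape_alph A"
        using q 3 by (intro o *(2)) auto
      then show ?thesis by (simp add: 3 pair_tr_def end_tr_def case_prod_unfold)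
    next
      case 4
      have "set (olist (map_option Inr (map_option Some (snd (\<delta> (snd q) a))))) \<subseteq> two_tape_alph A"
        using q 4 by (intro o *(2)) auto
      then show ?thesis by (simp add: 4 pair_tr_def end_tr_def case_prod_unfold)
    qed (use N in \<open>simp_all add: pair_tr_def end_tr_def case_prod_unfold\<close>)
  qed
  from pdfun_tr[OF F this]
  show "is_two_tape_language C {(u, v). u \<in> lists C \<and> v \<in> lists C \<and> (tr \<delta> q0 u, tr \<delta> q0 v) \<in> K}"
  proof (rule ATP_pdfun[OF C])
    fix u v assume uv: "u \<in> lists C" "v \<in> lists C"
    have "tape_run (\<lambda>w. F (tr (pair_tr (end_tr \<delta>)) (q0, q0) w)) [] (with_end u) (with_end v) \<longleftrightarrow>
        tape_run F [] (with_end (tr \<delta> q0 u)) (with_end (tr \<delta> q0 v))"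
      by (subst tape_run_tr[of _ _ _ q0 q0]) (simp_all add: tr_end_tr, simp_all add: with_end_def)
    then show "tape_run (\<lambda>w. F (tr (pair_tr (end_tr \<delta>)) (q0, q0) w)) [] (with_end u) (with_end v) \<longleftrightarrow>
        (u, v) \<in> {(u, v). u \<in> lists C \<and> v \<in> lists C \<and> (tr \<delta> q0 u, tr \<delta> q0 v) \<in> K}"
      using uv tr_lists[OF t] by (simp add: K)
  qed auto
qed auto

text \<open>The two copies are exchanged on the way to \<open>F\<close>, and the tape bit is
  negated.\<close>

lemma ATP_language_converse:
  assumes R: "ATP_language A R"
  shows "ATP_language A (R\<inverse>)"
  using R
proof (rule ATP_language_image)
  fix K assume "is_two_tape_language A K"
  then obtain F where A: "finite A" and F: "pdfun (two_tape_alph A) F"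
    and K: "K = {(u, v). u \<in> lists A \<and> v \<in> lists A \<and> tape_run F [] (with_end u) (with_end v)}"
    using two_tape_imp_pdfun by blast
  define sw :: "'a option + 'a option \<Rightarrow> 'a option + 'a option" where "sw = case_sum Inr Inl"
  let ?\<delta> = "\<lambda>(_ :: unit) c. ((), Some (sw c))"
  have "tr ?\<delta> () w = map sw w" for w by (induction w) auto
  moreover have "transducer UNIV () (two_tape_alph A) (two_tape_alph A) ?\<delta>"
    by (auto simp: transducer_def sw_def two_tape_alph_def)
  ultimately have "pdfun (two_tape_alph A) (\<lambda>w. F (map sw w))" using pdfun_tr[OF F, of UNIV "()" _ ?\<delta>] by simp
  then have pd: "pdfun (two_tape_alph A) (\<lambda>w. (\<lambda>(x, y). (\<not> x, y)) (F (map sw w)))" by (rule pdfun_out)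
  define G where "G = (\<lambda>w. (\<lambda>(x, y). (\<not> x, y)) (F (map sw w)))"
  have G: "fst (G w) \<longleftrightarrow> \<not> fst (F (map sw w))" "snd (G w) \<longleftrightarrow> snd (F (map sw w))" for w
    by (simp_all add: G_def case_prod_unfold)
  have run: "tape_run G w v u = tape_run F (map sw w) u v" for w u v
  proof (induction "length u + length v" arbitrary: w u v rule: less_induct)
    case less
    show ?case
    proof (cases "fst (F (map sw w))")
      case True
      then show ?thesis using less[of "tl u" v "w @ [Inr (hd u)]"]
        by (subst tape_run.simps, subst (2) tape_run.simps) (cases u; simp add: G sw_def)
    next
      case False
      then show ?thesis using less[of u "tl v" "w @ [Inl (hd v)]"]
        by (subst tape_run.simps, subst (2) tape_run.simps) (cases v; simp add: G sw_def)
    qed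
  qed
  have "pdfun (two_tape_alph A) G" using pd unfolding G_def .
  then   show "is_two_tape_language A (K\<inverse>)"
    by (rule ATP_pdfun[OF A]) (auto simp: run K)
qed auto

lemma ATP_language_Id:
  fixes A :: "'a :: countable set"
  assumes A: "finite A"
  shows "ATP_language A {(u, v). u \<in> lists A \<and> u = v}"
proof (rule ATP_language_single)
  \<comment> \<open>The tapes are read alternately: \<open>None\<close> waits for a sharp letter,
    \<open>Some (Some l)\<close> for its flat partner \<open>l\<close>, and \<open>Some None\<close>
    is dead. The end markers are compared as well, which excludes words of different length.\<close>
  define \<delta> :: "'a option option option \<Rightarrow> 'a option + 'a option \<Rightarrow> 'a option option option" where
    "\<delta> q c = (case q of None \<Rightarrow> (case c of Inl l \<Rightarrow> Some (Some l) | Inr _ \<Rightarrow> Some None)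
      | Some None \<Rightarrow> Some None
      | Some (Some l) \<Rightarrow> (if c = Inr l then None else Some None))" for q c
  have \<delta>: "\<delta> None (Inl l) = Some (Some l)" "\<delta> (Some None) c = Some None"
    "\<delta> (Some (Some l)) (Inr l') = (if l' = l then None else Some None)" for l l' c
    by (simp_all add: \<delta>_def)
  let ?F = "\<lambda>w. (\<lambda>q. (q = None, q = None)) (foldl \<delta> None w)"
  have "pdfun (two_tape_alph A) ?F"
  proof (rule pdfun_finite_automaton[where Q = "insert None (insert (Some None) ((Some \<circ> Some) ` insert None (Some ` A)))"])
    show "\<delta> q c \<in> insert None (insert (Some None) ((Some \<circ> Some) ` insert None (Some ` A)))"
      if "c \<in> two_tape_alph A" for q c
      using that by (auto simp: \<delta>_def two_tape_alph_def split: option.split)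
  qed (use A in auto)
  moreover have dead: "\<not> tape_run ?F w u v" if "foldl \<delta> None w = Some None" for w u v
  proof -
    have "foldl \<delta> (Some None) x = Some None" for x by (induction x) (auto simp: \<delta>)
    then show ?thesis unfolding tape_run_iff using that by simp
  qed
  have run: "tape_run ?F w u v \<longleftrightarrow> u = v" if "foldl \<delta> None w = None" for w u v
    using that
  proof (induction u arbitrary: w v)
    case Nil
    then show ?case by (subst tape_run.simps) auto
  next
    case (Cons a u)
    have fa: "foldl \<delta> None (w @ [Inl a]) = Some (Some a)" using Cons.prems by (simp add: \<delta>)
    have "tape_run ?F w (a # u) v = tape_run ?F (w @ [Inl a]) u v"
      using Cons.prems by (subst tape_run.simps) simp
    also have "\<dots> = (case v of [] \<Rightarrow> False | b # v' \<Rightarrow> tape_run ?F (w @ [Inl a] @ [Inr b]) u v')"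
      using fa by (subst tape_run.simps) (simp split: list.split)
    also have "\<dots> = (a # u = v)"
    proof (cases v)
      case (Cons b v')
      have f: "foldl \<delta> None (w @ [Inl a] @ [Inr b]) = (if a = b then None else Some None)"
        using fa by (simp add: \<delta>)
      show ?thesis
      proof (cases "a = b")
        case True
        then show ?thesis using Cons.IH[of "w @ [Inl a] @ [Inr b]" v'] f Cons by simp
      next
        case False
        then show ?thesis using dead[of "w @ [Inl a] @ [Inr b]"] f Cons by simp
      qed
    qed simp
    finally show ?case .
  qed
  ultimately show "is_two_tape_language A {(u, v). u \<in> lists A \<and> u = v}"
    by (intro ATP_pdfun[OF A, of ?F]) (auto simp: run with_end_def)
qed

text \<open>The first tape is read up to its end marker, the verdict is frozen, and only then is the
  second tape read. This gives \<open>L \<times> lists A\<close>; intersecting with the converse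
  restricts the second word.\<close>

lemma ATP_language_Times:
  assumes L: "P_language A L"
  shows "ATP_language A (L \<times> L)"
proof -
  have A: "finite A" and LA: "L \<subseteq> lists A" using P_language_subset[OF L] by auto
  have "ATP_language A (L \<times> lists A)"
    using L
  proof (rule ATP_language_from_P[where \<Phi> = "\<lambda>L. L \<times> lists A"])
    fix K assume "is_dpda_language A K"
    then have F: "pdfun A (\<lambda>w. w \<in> K)" and KA: "K \<subseteq> lists A" using dpda_language_imp_pdfun by blast+
    define act :: "bool option \<Rightarrow> 'a option + 'a option \<Rightarrow> bool \<Rightarrow> bool option \<times> 'a command" where
      "act q c x = (case q of Some _ \<Rightarrow> (q, Nop) | None \<Rightarrow> (case c of
          Inl None \<Rightarrow> (Some x, Nop) | Inl (Some a) \<Rightarrow> (None, Feed a) | Inr _ \<Rightarrow> (None, Nop)))" for q c x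
    have act: "act (Some y) c x = (Some y, Nop)" "act None (Inl None) x = (Some x, Nop)"
      "act None (Inl (Some a)) x = (None, Feed a)" for y c x a
      by (simp_all add: act_def)
    let ?run = "foldl (cstep (\<lambda>w. w \<in> K) act) (None, [])"
    let ?G = "\<lambda>v. case ?run v of (q, w) \<Rightarrow> (q = None, q = Some True)"
    have "pdfun (two_tape_alph A) ?G"
      by (rule pdfun_control[OF F, where Q = UNIV])
        (auto simp: act_def two_tape_alph_def split: option.splits sum.splits)
    then show "is_two_tape_language A (K \<times> lists A)"
    proof (rule ATP_pdfun[OF A])
      have 2: "tape_run ?G w [] v \<longleftrightarrow> x" if "fst (?run w) = Some x" for w v x
        using that
      proof (induction v arbitrary: w)
        case Nil
        then show ?case by (subst tape_run.simps) (auto simp: case_prod_unfold)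
      next
        case (Cons b v)
        have "fst (?run (w @ [Inr b])) = Some x" using Cons.prems by (cases "?run w") (auto simp: act)
        then show ?case using Cons by (subst tape_run.simps) (auto simp: case_prod_unfold)
      qed
      have 1: "tape_run ?G w (with_end u) v \<longleftrightarrow> x @ u \<in> K" if "?run w = (None, x)" for w u v x
        using that
      proof (induction u arbitrary: w x)
        case Nil
        have "fst (?run (w @ [Inl None])) = Some (x \<in> K)" using Nil by (simp add: act)
        then show ?case using 2 Nil by (subst tape_run.simps) (simp add: with_end_def)
      next
        case (Cons a u)
        have "?run (w @ [Inl (Some a)]) = (None, x @ [a])" using Cons.prems by (simp add: act)
        then show ?case using Cons.IH[of "w @ [Inl (Some a)]" "x @ [a]"] Cons.prems
          by (subst tape_run.simps) (simp add: with_end_def)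
      qed
      show "tape_run ?G [] (with_end u) (with_end v) \<longleftrightarrow> (u, v) \<in> K \<times> lists A"
        if "u \<in> lists A" "v \<in> lists A" for u v
        using 1[of "[]" "[]" u "with_end v"] that by simp
    qed (use KA in auto)
  qed auto
  from ATP_language_Int[OF this ATP_language_converse[OF this]]
  have "ATP_language A (L \<times> lists A \<inter> (L \<times> lists A)\<inverse>)" .
  moreover have "L \<times> lists A \<inter> (L \<times> lists A)\<inverse> = L \<times> L" using LA by auto
  ultimately show ?thesis by simp
qed

section \<open>Words in the wreath product\<close>

lemma semidirect_product_group:
  assumes N: "group N" and H: "group H"
    and hom: "\<And>h. h \<in> carrier H \<Longrightarrow> \<alpha> h \<in> hom N N"
    and act: "\<And>h h' n. h \<in> carrier H \<Longrightarrow> h' \<in> carrier H \<Longrightarrow> n \<in> carrier N \<Longrightarrow> \<alpha> (h \<otimes>\<^bsub>H\<^esub> h') n = \<alpha> h (\<alpha> h' n)"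
    and one: "\<And>n. n \<in> carrier N \<Longrightarrow> \<alpha> \<one>\<^bsub>H\<^esub> n = n"
  shows "group (semidirect_product N H \<alpha>)"
proof -
  interpret N: group N by (rule N)
  interpret H: group H by (rule H)
  have cl: "\<alpha> h n \<in> carrier N" if "h \<in> carrier H" "n \<in> carrier N" for h n
    using hom[OF that(1)] that(2) by (auto simp: hom_def)
  have mult: "\<alpha> h (n \<otimes>\<^bsub>N\<^esub> n') = \<alpha> h n \<otimes>\<^bsub>N\<^esub> \<alpha> h n'" if "h \<in> carrier H" "n \<in> carrier N" "n' \<in> carrier N" for h n n'
    using hom[OF that(1)] that(2,3) by (auto simp: hom_def)
  show ?thesis
  proof (rule groupI)
    fix x assume "x \<in> carrier (semidirect_product N H \<alpha>)"
    then obtain n h where x: "x = (n, h)" "n \<in> carrier N" "h \<in> carrier H" by (auto simp: semidirect_product_def)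
    show "\<exists>y\<in>carrier (semidirect_product N H \<alpha>).
        y \<otimes>\<^bsub>semidirect_product N H \<alpha>\<^esub> x = \<one>\<^bsub>semidirect_product N H \<alpha>\<^esub>"
      using x cl by (intro bexI[of _ "(inv\<^bsub>N\<^esub> (\<alpha> (inv\<^bsub>H\<^esub> h) n), inv\<^bsub>H\<^esub> h)"]) (auto simp: semidirect_product_def)
    have "\<alpha> \<one>\<^bsub>H\<^esub> n = n" using one x by blast
    then show "\<one>\<^bsub>semidirect_product N H \<alpha>\<^esub> \<otimes>\<^bsub>semidirect_product N H \<alpha>\<^esub> x = x"
      using x by (simp add: semidirect_product_def)
  qed (auto simp: semidirect_product_def cl mult act N.m_assoc H.m_assoc)
qed

lemma word_value_closed:
  assumes "group G" "\<phi> \<in> A \<rightarrow> carrier G" "w \<in> lists A"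
  shows "word_value G \<phi> w \<in> carrier G"
proof -
  interpret group G by fact
  show ?thesis using assms(3)
    by (induction w rule: list.induct) (use assms(2) in \<open>auto simp: word_value_def\<close>)
qed

lemma word_value_append:
  assumes G: "group G" and \<phi>: "\<phi> \<in> A \<rightarrow> carrier G" and v: "v \<in> lists A" and w: "w \<in> lists A"
  shows "word_value G \<phi> (v @ w) = word_value G \<phi> v \<otimes>\<^bsub>G\<^esub> word_value G \<phi> w"
proof -
  interpret group G by fact
  have c: "word_value G \<phi> x \<in> carrier G" if "x \<in> lists A" for x using word_value_closed[OF G \<phi> that] .
  show ?thesis using v
  proof (induction v rule: list.induct)
    case Nil
    then show ?case using c[OF w] by (simp add: word_value_def)
  next
    case (Cons a v)
    then have a: "\<phi> a \<in> carrier G" "v \<in> lists A" using \<phi> by auto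
    have "word_value G \<phi> (a # x) = \<phi> a \<otimes>\<^bsub>G\<^esub> word_value G \<phi> x" for x by (simp add: word_value_def)
    then show ?case using Cons.IH a c[OF w] c[OF a(2)] by (simp add: m_assoc)
  qed
qed

lemma word_value_Nil [simp]: "word_value G \<phi> [] = \<one>\<^bsub>G\<^esub>"
  and word_value_Cons: "word_value G \<phi> (a # w) = \<phi> a \<otimes>\<^bsub>G\<^esub> word_value G \<phi> w"
  by (simp_all add: word_value_def)

text \<open>The letter \<open>TI b\<close> is the formal inverse of \<open>TB b\<close>; \<open>Mk\<close>, \<open>Sep1\<close>, \<open>Sep2\<close>, \<open>End\<close> and \<open>Fin\<close>
  are punctuation of value \<open>\<one>\<close>. A block \<open>Mk m w Sep1 x Sep2 w\<inverse> End\<close> represents the function with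
  value \<open>x\<close> at \<open>w\<close>. The mark \<open>m\<close> tells whether the word has cursor \<open>w\<close> (\<open>Here\<close> and \<open>Triv\<close>) and
  in that case whether the value there is trivial (\<open>Triv\<close>): the automata have to know this
  before they read \<open>x\<close>.\<close>

datatype mark = Plain | Here | Triv

datatype letter = Mk mark | TB nat | Sep1 | UA nat | Sep2 | TI nat | End | Fin

instance mark :: countable
  by countable_datatype

instance letter :: countable
  by countable_datatype

text \<open>The inverse word \<open>s\<close> is a parameter of its own: a finite automaton can
  check the format of a block, but \<open>s = rev w\<close> requires a stack and is tested
  separately.\<close>

definition rblock :: "mark \<Rightarrow> nat list \<Rightarrow> nat list \<Rightarrow> nat list \<Rightarrow> letter list"
  where "rblock m w x s = Mk m # map TB w @ Sep1 # map UA x @ Sep2 # map TI s @ [End]"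

abbreviation block :: "mark \<Rightarrow> nat list \<Rightarrow> nat list \<Rightarrow> letter list"
  where "block m w x \<equiv> rblock m w x (rev w)"

section \<open>Values of words in the wreath product\<close>

locale wreath =
  fixes U :: "('u, 'x) monoid_scheme" and T :: "('t, 'y) monoid_scheme"
    and A B :: "nat set" and \<phi> :: "nat \<Rightarrow> 'u" and \<psi> :: "nat \<Rightarrow> 't" and LU LT :: "nat list set"
  assumes U: "group U" and T: "group T"
    and A: "finite A" and B: "finite B"
    and \<phi>: "\<phi> \<in> A \<rightarrow> carrier U" and \<psi>: "\<psi> \<in> B \<rightarrow> carrier T"
    and LU: "P_structure U A \<phi> LU" and LT: "P_structure T B \<psi> LT"
begin

sublocale U: group U by (rule U)
sublocale T: group T by (rule T)

abbreviation G where "G \<equiv> wreath_product U T"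

abbreviation N where "N \<equiv> sum_group (carrier T) (\<lambda>_. U)"

lemma carrier_N: "carrier N = {f \<in> carrier T \<rightarrow>\<^sub>E carrier U. finite {x \<in> carrier T. f x \<noteq> \<one>\<^bsub>U\<^esub>}}"
  by (simp add: carrier_sum_group U)

lemma f_closed: "f \<in> carrier N \<Longrightarrow> y \<in> carrier T \<Longrightarrow> f y \<in> carrier U"
  by (auto simp: carrier_N)

lemma N: "group N"
  by (simp add: U)

lemma translate_closed:
  assumes t: "t \<in> carrier T" and f: "f \<in> carrier N"
  shows "translate T t f \<in> carrier N"
proof -
  have "{x \<in> carrier T. translate T t f x \<noteq> \<one>\<^bsub>U\<^esub>} \<subseteq> (\<lambda>x. t \<otimes>\<^bsub>T\<^esub> x) ` {x \<in> carrier T. f x \<noteq> \<one>\<^bsub>U\<^esub>}"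
  proof
    fix x assume x: "x \<in> {x \<in> carrier T. translate T t f x \<noteq> \<one>\<^bsub>U\<^esub>}"
    then have "x = t \<otimes>\<^bsub>T\<^esub> (inv\<^bsub>T\<^esub> t \<otimes>\<^bsub>T\<^esub> x)" using t by (simp add: T.m_assoc[symmetric])
    moreover have "inv\<^bsub>T\<^esub> t \<otimes>\<^bsub>T\<^esub> x \<in> {x \<in> carrier T. f x \<noteq> \<one>\<^bsub>U\<^esub>}" using x t by (auto simp: translate_def)
    ultimately show "x \<in> (\<lambda>x. t \<otimes>\<^bsub>T\<^esub> x) ` {x \<in> carrier T. f x \<noteq> \<one>\<^bsub>U\<^esub>}" by blast
  qed
  moreover have "finite {x \<in> carrier T. f x \<noteq> \<one>\<^bsub>U\<^esub>}" using f by (simp add: carrier_N)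
  ultimately have "finite {x \<in> carrier T. translate T t f x \<noteq> \<one>\<^bsub>U\<^esub>}" by (meson finite_imageI finite_subset)
  moreover have "translate T t f \<in> carrier T \<rightarrow>\<^sub>E carrier U"
    using f t by (auto simp: translate_def carrier_N)
  ultimately show ?thesis by (simp add: carrier_N)
qed

lemma G: "group G"
  unfolding wreath_product_def
proof (rule semidirect_product_group[OF N T])
  fix h assume h: "h \<in> carrier T"
  show "translate T h \<in> hom N N"
  proof (rule homI)
    fix n n' assume "n \<in> carrier N" "n' \<in> carrier N"
    show "translate T h (n \<otimes>\<^bsub>N\<^esub> n') = translate T h n \<otimes>\<^bsub>N\<^esub> translate T h n'"
      unfolding mult_sum_group using h by (simp add: translate_def cong: restrict_cong)
  qed (rule translate_closed[OF h])
next
  fix h h' n assume *: "h \<in> carrier T" "h' \<in> carrier T" "n \<in> carrier N"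
  then show "translate T (h \<otimes>\<^bsub>T\<^esub> h') n = translate T h (translate T h' n)"
    by (simp add: translate_def T.inv_mult_group T.m_assoc cong: restrict_cong)
next
  fix n assume "n \<in> carrier N"
  then have "n \<in> extensional (carrier T)" by (simp add: carrier_N PiE_def)
  then show "translate T \<one>\<^bsub>T\<^esub> n = n" by (simp add: translate_def extensional_restrict cong: restrict_cong)
qed

lemma carrier_G: "carrier G = carrier N \<times> carrier T"
  by (simp add: wreath_product_def semidirect_product_def)

lemma mult_G: "(f, t) \<otimes>\<^bsub>G\<^esub> (f', t') = ((\<lambda>x\<in>carrier T. f x \<otimes>\<^bsub>U\<^esub> translate T t f' x), t \<otimes>\<^bsub>T\<^esub> t')"
  by (simp add: wreath_product_def semidirect_product_def)

lemma one_G: "\<one>\<^bsub>G\<^esub> = (\<one>\<^bsub>N\<^esub>, \<one>\<^bsub>T\<^esub>)"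
  by (simp add: wreath_product_def semidirect_product_def)

definition delta :: "'t \<Rightarrow> 'u \<Rightarrow> 't \<Rightarrow> 'u"
  where "delta t u = (\<lambda>x\<in>carrier T. if x = t then u else \<one>\<^bsub>U\<^esub>)"

fun \<Phi> :: "letter \<Rightarrow> ('t \<Rightarrow> 'u) \<times> 't"
  where
    "\<Phi> (TB b) = (\<one>\<^bsub>N\<^esub>, \<psi> b)"
  | "\<Phi> (TI b) = (\<one>\<^bsub>N\<^esub>, inv\<^bsub>T\<^esub> \<psi> b)"
  | "\<Phi> (UA a) = (delta \<one>\<^bsub>T\<^esub> (\<phi> a), \<one>\<^bsub>T\<^esub>)"
  | "\<Phi> _ = \<one>\<^bsub>G\<^esub>"

definition C :: "letter set"
  where "C = range Mk \<union> TB ` B \<union> TI ` B \<union> UA ` A \<union> {Sep1, Sep2, End, Fin}"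

lemma finite_C: "finite C"
proof -
  have "range Mk = {Mk Plain, Mk Here, Mk Triv}" using mark.exhaust by auto
  then show ?thesis unfolding C_def using A B by simp
qed

lemma in_C [simp]: "Mk m \<in> C" "TB b \<in> C \<longleftrightarrow> b \<in> B" "TI b \<in> C \<longleftrightarrow> b \<in> B" "UA a \<in> C \<longleftrightarrow> a \<in> A"
  "Sep1 \<in> C" "Sep2 \<in> C" "End \<in> C" "Fin \<in> C"
  by (auto simp: C_def)

lemma delta_closed: "u \<in> carrier U \<Longrightarrow> delta t u \<in> carrier N"
proof -
  assume u: "u \<in> carrier U"
  have "{x \<in> carrier T. delta t u x \<noteq> \<one>\<^bsub>U\<^esub>} \<subseteq> {t}" by (auto simp: delta_def)
  then have "finite {x \<in> carrier T. delta t u x \<noteq> \<one>\<^bsub>U\<^esub>}" by (rule finite_subset) simp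
  then show ?thesis using u by (auto simp: carrier_N delta_def)
qed

lemma one_N_closed: "\<one>\<^bsub>N\<^esub> \<in> carrier N"
  using group.is_monoid[OF N] by (rule monoid.one_closed)

lemma \<Phi>_closed: "\<Phi> \<in> C \<rightarrow> carrier G"
proof
  fix l assume "l \<in> C"
  then show "\<Phi> l \<in> carrier G"
    using \<phi> \<psi> one_N_closed delta_closed
    by (cases l) (auto simp: carrier_G one_G simp del: one_sum_group)
qed

abbreviation val where "val \<equiv> word_value G \<Phi>"
abbreviation valT where "valT \<equiv> word_value T \<psi>"
abbreviation valU where "valU \<equiv> word_value U \<phi>"

lemmas val_append = word_value_append[OF G \<Phi>_closed]
  and val_closed = word_value_closed[OF G \<Phi>_closed]
  and valT_closed = word_value_closed[OF T \<psi>]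
  and valU_closed = word_value_closed[OF U \<phi>]

lemma delta_one: "delta t \<one>\<^bsub>U\<^esub> = \<one>\<^bsub>N\<^esub>"
  by (auto simp: delta_def)

lemma mult_one_left: "f \<in> carrier N \<Longrightarrow> t \<in> carrier T \<Longrightarrow> t' \<in> carrier T \<Longrightarrow>
    (\<one>\<^bsub>N\<^esub>, t) \<otimes>\<^bsub>G\<^esub> (f, t') = (translate T t f, t \<otimes>\<^bsub>T\<^esub> t')"
proof -
  assume f: "f \<in> carrier N" and t: "t \<in> carrier T"
  have "translate T t f \<in> carrier T \<rightarrow>\<^sub>E carrier U" using translate_closed[OF t f] by (simp add: carrier_N)
  then have "(\<lambda>x\<in>carrier T. \<one>\<^bsub>N\<^esub> x \<otimes>\<^bsub>U\<^esub> translate T t f x) = translate T t f"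
    by (auto simp: PiE_iff extensional_def)
  then show ?thesis by (simp add: mult_G del: one_sum_group)
qed

lemma translate_one: "t \<in> carrier T \<Longrightarrow> translate T t \<one>\<^bsub>N\<^esub> = \<one>\<^bsub>N\<^esub>"
  by (auto simp: translate_def)

lemma mult_one_right: "f \<in> carrier N \<Longrightarrow> t \<in> carrier T \<Longrightarrow> t' \<in> carrier T \<Longrightarrow>
    (f, t) \<otimes>\<^bsub>G\<^esub> (\<one>\<^bsub>N\<^esub>, t') = (f, t \<otimes>\<^bsub>T\<^esub> t')"
proof -
  assume f: "f \<in> carrier N" and t: "t \<in> carrier T"
  have "(\<lambda>x\<in>carrier T. f x \<otimes>\<^bsub>U\<^esub> \<one>\<^bsub>N\<^esub> x) = f"
  proof (rule extensionalityI[of _ "carrier T"])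
    show "f \<in> extensional (carrier T)" using f by (simp add: carrier_N PiE_def)
    fix x assume "x \<in> carrier T"
    then show "(\<lambda>x\<in>carrier T. f x \<otimes>\<^bsub>U\<^esub> \<one>\<^bsub>N\<^esub> x) x = f x" using f_closed[OF f] by simp
  qed simp
  then show ?thesis using translate_one[OF t] by (simp add: mult_G del: one_sum_group)
qed

lemma translate_delta:
  assumes "t \<in> carrier T" "s \<in> carrier T"
  shows "translate T t (delta s u) = delta (t \<otimes>\<^bsub>T\<^esub> s) u"
proof -
  have "inv\<^bsub>T\<^esub> t \<otimes>\<^bsub>T\<^esub> x = s \<longleftrightarrow> x = t \<otimes>\<^bsub>T\<^esub> s" if "x \<in> carrier T" for x
    using T.inv_solve_left[of s t x] that assms by auto
  then show ?thesis using assms by (simp add: translate_def delta_def cong: restrict_cong)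
qed

lemma val_TB: "w \<in> lists B \<Longrightarrow> val (map TB w) = (\<one>\<^bsub>N\<^esub>, valT w)"
proof (induction w rule: list.induct)
  case (Cons b w)
  then have b: "\<psi> b \<in> carrier T" "w \<in> lists B" using \<psi> by auto
  have "val (map TB (b # w)) = (\<one>\<^bsub>N\<^esub>, \<psi> b) \<otimes>\<^bsub>G\<^esub> (\<one>\<^bsub>N\<^esub>, valT w)"
    using Cons b by (simp add: word_value_Cons del: one_sum_group)
  also have "\<dots> = (\<one>\<^bsub>N\<^esub>, valT (b # w))"
    using b one_N_closed valT_closed by (simp add: mult_one_right word_value_Cons del: one_sum_group)
  finally show ?case .
qed (simp add: one_G)

lemma val_TI: "w \<in> lists B \<Longrightarrow> val (map TI (rev w)) = (\<one>\<^bsub>N\<^esub>, inv\<^bsub>T\<^esub> valT w)"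
proof (induction w rule: list.induct)
  case (Cons b w)
  then have b: "\<psi> b \<in> carrier T" "b \<in> B" "w \<in> lists B" using \<psi> by auto
  have e: "val [TI b] = (\<one>\<^bsub>N\<^esub>, inv\<^bsub>T\<^esub> \<psi> b)"
    using b one_N_closed by (simp add: word_value_Cons one_G mult_one_right del: one_sum_group)
  have "val (map TI (rev (b # w))) = (\<one>\<^bsub>N\<^esub>, inv\<^bsub>T\<^esub> valT w) \<otimes>\<^bsub>G\<^esub> (\<one>\<^bsub>N\<^esub>, inv\<^bsub>T\<^esub> \<psi> b)"
    using Cons b val_append[of "map TI (rev w)" "[TI b]"] e by (auto simp: in_lists_conv_set simp del: one_sum_group)
  also have "\<dots> = (\<one>\<^bsub>N\<^esub>, inv\<^bsub>T\<^esub> valT (b # w))"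
    using b one_N_closed valT_closed by (simp add: mult_one_right word_value_Cons T.inv_mult_group del: one_sum_group)
  finally show ?case .
qed (simp add: one_G)

lemma delta_mult:
  assumes "u \<in> carrier U" "u' \<in> carrier U"
  shows "(\<lambda>x\<in>carrier T. delta t u x \<otimes>\<^bsub>U\<^esub> delta t u' x) = delta t (u \<otimes>\<^bsub>U\<^esub> u')"
proof (rule extensionalityI[of _ "carrier T"])
  show "delta t (u \<otimes>\<^bsub>U\<^esub> u') \<in> extensional (carrier T)" by (simp add: delta_def)
qed (use assms in \<open>simp_all add: delta_def\<close>)

lemma val_UA: "x \<in> lists A \<Longrightarrow> val (map UA x) = (delta \<one>\<^bsub>T\<^esub> (valU x), \<one>\<^bsub>T\<^esub>)"
proof (induction x rule: list.induct)
  case (Cons a x)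
  then have a: "\<phi> a \<in> carrier U" "x \<in> lists A" using \<phi> by auto
  have "val (map UA (a # x)) = (delta \<one>\<^bsub>T\<^esub> (\<phi> a), \<one>\<^bsub>T\<^esub>) \<otimes>\<^bsub>G\<^esub> (delta \<one>\<^bsub>T\<^esub> (valU x), \<one>\<^bsub>T\<^esub>)"
    using Cons a by (simp add: word_value_Cons)
  also have "\<dots> = (delta \<one>\<^bsub>T\<^esub> (valU (a # x)), \<one>\<^bsub>T\<^esub>)"
    using a valU_closed[OF a(2)]
    by (simp add: mult_G translate_delta word_value_Cons delta_mult)
  finally show ?case .
qed (simp add: one_G delta_one)

text \<open>Conjugation by \<open>valT w\<close> moves a value from the identity of \<open>T\<close>
  to the point \<open>valT w\<close>, since \<open>T\<close> acts by translation.\<close>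

lemma val_block:
  assumes w: "w \<in> lists B" and x: "x \<in> lists A"
  shows "val (block m w x) = (delta (valT w) (valU x), \<one>\<^bsub>T\<^esub>)"
proof -
  interpret G: group G by (rule G)
  note wc = valT_closed[OF w] and xc = valU_closed[OF x]
  have l: "map TB w \<in> lists C" "map UA x \<in> lists C" "map TI (rev w) \<in> lists C"
    using w x by (auto simp: in_lists_conv_set)
  note c = l[THEN val_closed]
  have p: "val (l # v) = val v" if "l \<in> {Mk m, Sep1, Sep2, End, Fin}" "v \<in> lists C" for l v
    using that val_closed[of v] by (auto simp: word_value_Cons)
  have E: "val (map TI (rev w) @ [End]) = val (map TI (rev w))"
    using l c(3) by (simp add: val_append p)
  have "val (block m w x) = val (map TB w @ Sep1 # map UA x @ Sep2 # map TI (rev w) @ [End])"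
    unfolding rblock_def using l by (intro p) auto
  also have "\<dots> = val (map TB w) \<otimes>\<^bsub>G\<^esub> val (map UA x @ Sep2 # map TI (rev w) @ [End])"
    using l by (simp add: val_append p)
  also have "\<dots> = val (map TB w) \<otimes>\<^bsub>G\<^esub> (val (map UA x) \<otimes>\<^bsub>G\<^esub> val (map TI (rev w)))"
    using l E by (simp add: val_append p)
  also have "\<dots> = (\<one>\<^bsub>N\<^esub>, valT w) \<otimes>\<^bsub>G\<^esub> (delta \<one>\<^bsub>T\<^esub> (valU x), inv\<^bsub>T\<^esub> valT w)"
    unfolding val_TB[OF w] val_UA[OF x] val_TI[OF w] using wc xc delta_closed
    by (subst mult_one_right) auto
  also have "\<dots> = (delta (valT w) (valU x), \<one>\<^bsub>T\<^esub>)"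
    using wc xc delta_closed by (subst mult_one_left) (auto simp: translate_delta)
  finally show ?thesis .
qed

lemma block_lists: "v \<in> lists B \<Longrightarrow> x \<in> lists A \<Longrightarrow> block m v x \<in> lists C"
  by (auto simp: in_lists_conv_set rblock_def)

lemma blocks_lists:
  assumes "set ws \<subseteq> lists B" "\<And>v. v \<in> set ws \<Longrightarrow> x v \<in> lists A"
  shows "concat (map (\<lambda>v. block (m v) v (x v)) ws) \<in> lists C"
  using assms
proof (induction ws rule: list.induct)
  case (Cons v ws)
  then have "block (m v) v (x v) \<in> lists C" by (intro block_lists) simp_all
  then show ?case using Cons by simp
qed simp

lemma val_blocks:
  assumes "W \<subseteq> lists B" "distinct ws" "set ws \<subseteq> W" "inj_on valT W" "\<And>w. w \<in> set ws \<Longrightarrow> x w \<in> lists A"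
    and "f \<in> carrier N" "\<And>w. w \<in> set ws \<Longrightarrow> f (valT w) = valU (x w)"
    and "\<And>y. y \<in> carrier T \<Longrightarrow> y \<notin> valT ` set ws \<Longrightarrow> f y = \<one>\<^bsub>U\<^esub>"
  shows "val (concat (map (\<lambda>w. block (m w) w (x w)) ws)) = (f, \<one>\<^bsub>T\<^esub>)"
  using assms(2-)
proof (induction ws arbitrary: f rule: list.induct)
  case Nil
  have "f = \<one>\<^bsub>N\<^esub>"
  proof (rule extensionalityI[of _ "carrier T"])
    show "f \<in> extensional (carrier T)" using Nil by (simp add: carrier_N PiE_def)
  qed (use Nil in simp_all)
  then show ?case by (simp add: one_G del: one_sum_group)
next
  case (Cons w ws)
  \<comment> \<open>The remaining blocks spell \<open>f\<close> with its value at the first position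
    made trivial.\<close>
  let ?f = "\<lambda>y\<in>carrier T. if y = valT w then \<one>\<^bsub>U\<^esub> else f y"
  have w: "w \<in> lists B" "x w \<in> lists A" using Cons.prems assms(1) by auto
  have ne: "valT w' \<noteq> valT w" if "w' \<in> set ws" for w'
    using Cons.prems that by (auto dest: inj_onD)
  have fin: "finite {y \<in> carrier T. f y \<noteq> \<one>\<^bsub>U\<^esub>}" using Cons.prems by (auto simp: carrier_N)
  have "finite {y \<in> carrier T. ?f y \<noteq> \<one>\<^bsub>U\<^esub>}"
    by (rule finite_subset[OF _ fin]) auto
  then have f: "?f \<in> carrier N" using Cons.prems(5) by (auto simp: carrier_N)
  have IH: "val (concat (map (\<lambda>w. block (m w) w (x w)) ws)) = (?f, \<one>\<^bsub>T\<^esub>)"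
  proof (rule Cons.IH)
    fix w' assume w': "w' \<in> set ws"
    have "w' \<in> lists B" using w' Cons.prems(2) assms(1) by (simp add: subset_iff)
    then show "?f (valT w') = valU (x w')"
      using ne[OF w'] Cons.prems(6)[of w'] w' valT_closed by simp
  next
    fix y assume y: "y \<in> carrier T" "y \<notin> valT ` set ws"
    show "?f y = \<one>\<^bsub>U\<^esub>"
    proof (cases "y = valT w")
      case False
      then have "f y = \<one>\<^bsub>U\<^esub>" using y by (intro Cons.prems(7)) simp_all
      then show ?thesis by (simp add: y(1))
    qed (use y(1) in simp)
  next
    show "?f \<in> carrier N" by (rule f)
    show "distinct ws" "set ws \<subseteq> W" "inj_on valT W" using Cons.prems(1-3) by simp_all
    show "x w' \<in> lists A" if "w' \<in> set ws" for w' using Cons.prems(4)[of w'] that by simp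
  qed
  have "val (concat (map (\<lambda>w. block (m w) w (x w)) (w # ws))) =
      (delta (valT w) (valU (x w)), \<one>\<^bsub>T\<^esub>) \<otimes>\<^bsub>G\<^esub> (?f, \<one>\<^bsub>T\<^esub>)"
  proof -
    have "concat (map (\<lambda>w. block (m w) w (x w)) ws) \<in> lists C"
    proof (rule blocks_lists)
      show "set ws \<subseteq> lists B" using Cons.prems(2) assms(1) by (simp add: subset_iff)
      show "x v \<in> lists A" if "v \<in> set ws" for v using Cons.prems(4)[of v] that by simp
    qed
    then show ?thesis by (simp add: val_append[OF block_lists[OF w]] val_block[OF w] IH)
  qed
  also have "\<dots> = (f, \<one>\<^bsub>T\<^esub>)"
  proof -
    have fw: "f (valT w) = valU (x w)" using Cons.prems(6) by simp
    have "(\<lambda>y\<in>carrier T. delta (valT w) (valU (x w)) y \<otimes>\<^bsub>U\<^esub> translate T \<one>\<^bsub>T\<^esub> ?f y) y = f y" for y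
    proof (cases "y \<in> carrier T")
      case True
      then have "f y \<in> carrier U" using Cons.prems(5) f_closed by blast
      then show ?thesis using True fw valU_closed[OF w(2)] by (simp add: delta_def translate_def)
    next
      case False
      moreover have "f \<in> extensional (carrier T)" using Cons.prems(5) by (simp add: carrier_N PiE_def)
      ultimately show ?thesis by (simp add: extensional_def)
    qed
    then have "(\<lambda>y\<in>carrier T. delta (valT w) (valU (x w)) y \<otimes>\<^bsub>U\<^esub> translate T \<one>\<^bsub>T\<^esub> ?f y) = f" by (rule ext)
    then show ?thesis by (simp add: mult_G)
  qed
  finally show ?case .
qed

end

section \<open>Normal forms and their bijection with the group\<close>

definition raw :: "(mark \<times> nat list \<times> nat list \<times> nat list) list \<Rightarrow> nat list \<Rightarrow> letter list"
  where "raw bs w = concat (map (\<lambda>(m, v, x, s). rblock m v x s) bs) @ Fin # map TB w"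

context wreath
begin

definition repT where "repT = inv_into LT valT"
definition repU where "repU = inv_into LU valU"

lemma LT_lists: "LT \<subseteq> lists B" and LU_lists: "LU \<subseteq> lists A"
  using LT LU by (auto simp: P_structure_def)

lemma bij_T: "bij_betw valT LT (carrier T)" and bij_U: "bij_betw valU LU (carrier U)"
  using LT LU by (auto simp: P_structure_def)

lemma repT: "t \<in> carrier T \<Longrightarrow> repT t \<in> LT" "t \<in> carrier T \<Longrightarrow> valT (repT t) = t"
  "w \<in> LT \<Longrightarrow> repT (valT w) = w"
  using bij_T unfolding repT_def bij_betw_def
  by (auto simp: inv_into_into f_inv_into_f inv_into_f_f)

lemma repU: "u \<in> carrier U \<Longrightarrow> repU u \<in> LU" "u \<in> carrier U \<Longrightarrow> valU (repU u) = u"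
  "x \<in> LU \<Longrightarrow> repU (valU x) = x"
  using bij_U unfolding repU_def bij_betw_def
  by (auto simp: inv_into_into f_inv_into_f inv_into_f_f)

lemma valT_in: "w \<in> LT \<Longrightarrow> valT w \<in> carrier T" and valU_in: "x \<in> LU \<Longrightarrow> valU x \<in> carrier U"
  using bij_T bij_U by (auto simp: bij_betw_def)

definition supp :: "('t \<Rightarrow> 'u) \<Rightarrow> 't set"
  where "supp f = {y \<in> carrier T. f y \<noteq> \<one>\<^bsub>U\<^esub>}"

text \<open>The cursor \<open>t\<close> is listed even where \<open>f t\<close> is trivial, so that
  multiplication by a generator of \<open>U\<close> neither creates nor deletes a block. The fixed
  order makes the spelling unique.\<close>

definition positions :: "('t \<Rightarrow> 'u) \<Rightarrow> 't \<Rightarrow> nat list list"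
  where "positions f t = sorted_list_of_set (repT ` insert t (supp f))"

definition mk :: "('t \<Rightarrow> 'u) \<Rightarrow> 't \<Rightarrow> nat list \<Rightarrow> mark"
  where "mk f t v = (if valT v \<noteq> t then Plain else if f t = \<one>\<^bsub>U\<^esub> then Triv else Here)"

definition nf :: "('t \<Rightarrow> 'u) \<Rightarrow> 't \<Rightarrow> letter list"
  where "nf f t = raw (map (\<lambda>v. (mk f t v, v, repU (f (valT v)), rev v)) (positions f t)) (repT t)"

text \<open>A description of the normal forms without reference to \<open>f\<close> and
  \<open>t\<close>, by conditions that automata can test one at a time.\<close>

definition good :: "(mark \<times> nat list \<times> nat list \<times> nat list) list \<Rightarrow> nat list \<Rightarrow> bool"
  where "good bs w \<longleftrightarrow> sorted_wrt (<) (map (\<lambda>(m, v, x, s). v) bs) \<and>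
    (\<forall>(m, v, x, s)\<in>set bs. s = rev v \<and> v \<in> LT \<and> x \<in> LU \<and> (x = repU \<one>\<^bsub>U\<^esub> \<longleftrightarrow> m = Triv) \<and> (m \<noteq> Plain \<longleftrightarrow> v = w)) \<and>
    w \<in> (\<lambda>(m, v, x, s). v) ` set bs"

lemma supp_subset: "supp f \<subseteq> carrier T"
  by (auto simp: supp_def)

lemma finite_supp: "f \<in> carrier N \<Longrightarrow> finite (supp f)"
  by (simp add: supp_def carrier_N)

lemma set_positions: "f \<in> carrier N \<Longrightarrow> set (positions f t) = repT ` insert t (supp f)"
  unfolding positions_def by (rule set_sorted_list_of_set) (simp add: finite_supp)

lemma valT_positions:
  assumes "f \<in> carrier N" "t \<in> carrier T"
  shows "valT ` set (positions f t) = insert t (supp f)" "set (positions f t) \<subseteq> LT"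
proof -
  have "valT ` repT ` insert t (supp f) = (\<lambda>y. y) ` insert t (supp f)"
    unfolding image_image
  proof (intro image_cong refl)
    fix y assume "y \<in> insert t (supp f)"
    then have "y \<in> carrier T" using assms supp_subset by blast
    then show "valT (repT y) = y" by (rule repT(2))
  qed
  then show "valT ` set (positions f t) = insert t (supp f)" using assms by (simp add: set_positions)
  have "insert t (supp f) \<subseteq> carrier T" using assms supp_subset by blast
  then show "set (positions f t) \<subseteq> LT" unfolding set_positions[OF assms(1)] using repT(1) by blast
qed

lemma val_positions:
  assumes "f \<in> carrier N" "distinct ws" "set ws \<subseteq> LT" "supp f \<subseteq> valT ` set ws"
    "\<And>v. v \<in> set ws \<Longrightarrow> x v \<in> lists A \<and> f (valT v) = valU (x v)"
  shows "val (concat (map (\<lambda>v. block (m v) v (x v)) ws)) = (f, \<one>\<^bsub>T\<^esub>)"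
  using assms bij_T by (intro val_blocks[where W = LT] LT_lists) (auto simp: bij_betw_def supp_def)

lemma val_cursor:
  assumes v: "v \<in> lists C" "val v = (f, \<one>\<^bsub>T\<^esub>)" and f: "f \<in> carrier N" and w: "w \<in> lists B"
  shows "val (v @ Fin # map TB w) = (f, valT w)"
proof -
  interpret G: group G by (rule G)
  have l: "map TB w \<in> lists C" using w by (auto simp: in_lists_conv_set)
  then have "val (v @ Fin # map TB w) = (f, \<one>\<^bsub>T\<^esub>) \<otimes>\<^bsub>G\<^esub> (\<one>\<^bsub>G\<^esub> \<otimes>\<^bsub>G\<^esub> val (map TB w))"
    using v by (simp add: val_append word_value_Cons)
  also have "\<dots> = (f, valT w)"
    using val_closed[OF l] valT_closed[OF w] f by (simp add: val_TB[OF w] mult_one_right del: one_sum_group)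
  finally show ?thesis .
qed

lemma distinct_positions: "distinct (positions f t)"
  by (simp add: positions_def)

lemma val_nf:
  assumes f: "f \<in> carrier N" and t: "t \<in> carrier T"
  shows "val (nf f t) = (f, t)" "nf f t \<in> lists C"
proof -
  let ?bs = "concat (map (\<lambda>v. block (mk f t v) v (repU (f (valT v)))) (positions f t))"
  have e: "nf f t = ?bs @ Fin # map TB (repT t)"
    by (simp add: nf_def raw_def comp_def)
  note p = valT_positions[OF f t]
  have x: "repU (f (valT v)) \<in> lists A \<and> f (valT v) = valU (repU (f (valT v)))" if "v \<in> set (positions f t)" for v
    using that p f_closed[OF f] repU valT_in LU_lists by (auto simp: subset_iff)
  have l: "?bs \<in> lists C" using p(2) LT_lists x by (intro blocks_lists) auto
  have "repT t \<in> lists B" using repT(1)[OF t] LT_lists by blast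
  moreover from this show "nf f t \<in> lists C" unfolding e using l by (auto simp: in_lists_conv_set)
  moreover have "val ?bs = (f, \<one>\<^bsub>T\<^esub>)"
    using p x by (intro val_positions[OF f]) (auto simp: distinct_positions)
  ultimately show "val (nf f t) = (f, t)" unfolding e using val_cursor[OF l _ f] repT(2)[OF t] by simp
qed

lemma good_nf:
  assumes f: "f \<in> carrier N" and t: "t \<in> carrier T"
  shows "good (map (\<lambda>v. (mk f t v, v, repU (f (valT v)), rev v)) (positions f t)) (repT t)"
proof -
  note p = valT_positions[OF f t]
  have "sorted_wrt (<) (positions f t)" by (simp add: positions_def)
  moreover have "v \<in> LT \<and> repU (f (valT v)) \<in> LU \<and> (repU (f (valT v)) = repU \<one>\<^bsub>U\<^esub> \<longleftrightarrow> mk f t v = Triv) \<and>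
      (mk f t v \<noteq> Plain \<longleftrightarrow> v = repT t)" if v: "v \<in> set (positions f t)" for v
  proof -
    have vL: "v \<in> LT" using p v by blast
    have fv: "f (valT v) \<in> carrier U" using f_closed[OF f valT_in[OF vL]] .
    have 1: "repU (f (valT v)) = repU \<one>\<^bsub>U\<^esub> \<longleftrightarrow> f (valT v) = \<one>\<^bsub>U\<^esub>"
      using repU(2)[OF fv] repU(2)[OF U.one_closed] by metis
    have 2: "v = repT t \<longleftrightarrow> valT v = t" using repT(3)[OF vL] repT(2)[OF t] by auto
    have 3: "valT v = t \<or> f (valT v) \<noteq> \<one>\<^bsub>U\<^esub>"
      using p(1) v by (auto simp: supp_def)
    show ?thesis using vL repU(1)[OF fv] 1 2 3 by (auto simp: mk_def)
  qed
  moreover have "repT t \<in> set (positions f t)" using f by (simp add: set_positions)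
  ultimately show ?thesis unfolding good_def by (auto simp: comp_def image_iff)
qed

lemma good_imp_nf:
  assumes g: "good bs w"
  shows "\<exists>f\<in>carrier N. \<exists>t\<in>carrier T. raw bs w = nf f t"
proof -
  let ?v = "\<lambda>(m, v, x, s). v" and ?x = "\<lambda>(m, v, x, s). x"
  have sorted: "sorted_wrt (<) (map ?v bs)" and w: "w \<in> ?v ` set bs"
    and ball: "\<forall>(m, v, x, s)\<in>set bs. s = rev v \<and> v \<in> LT \<and> x \<in> LU \<and> (x = repU \<one>\<^bsub>U\<^esub> \<longleftrightarrow> m = Triv) \<and> (m \<noteq> Plain \<longleftrightarrow> v = w)"
    by (fact g[unfolded good_def, THEN conjunct1] g[unfolded good_def, THEN conjunct2, THEN conjunct2]
      g[unfolded good_def, THEN conjunct2, THEN conjunct1])+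
  have b: "s = rev v \<and> v \<in> LT \<and> x \<in> LU \<and> (x = repU \<one>\<^bsub>U\<^esub> \<longleftrightarrow> m = Triv) \<and> (m \<noteq> Plain \<longleftrightarrow> v = w)"
    if "(m, v, x, s) \<in> set bs" for m v x s
    using bspec[OF ball that] by simp
  define t where "t = valT w"
  obtain m0 v0 x0 s0 where 0: "(m0, v0, x0, s0) \<in> set bs" "v0 = w"
    using w by (auto simp: case_prod_unfold)
  have wL: "w \<in> LT" using b[OF 0(1)] 0(2) by simp
  have t: "t \<in> carrier T" using valT_in[OF wL] by (simp add: t_def)
  \<comment> \<open>The function is looked up among the blocks. Positions are distinct and
    \<open>valT\<close> is injective on \<open>LT\<close>, so no block hides another.\<close>
  define f where "f = (\<lambda>y\<in>carrier T. case map_of (map (\<lambda>(m, v, x, s). (valT v, x)) bs) y of None \<Rightarrow> \<one>\<^bsub>U\<^esub> | Some x \<Rightarrow> valU x)"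
  have dist: "distinct (map ?v bs)" using sorted by (simp add: strict_sorted_iff)
  have "distinct (map (\<lambda>(m, v, x, s). valT v) bs)"
  proof -
    have "inj_on valT (set (map ?v bs))"
    proof (rule inj_on_subset)
      show "inj_on valT LT" using bij_T by (simp add: bij_betw_def)
      show "set (map ?v bs) \<subseteq> LT"
      proof
        fix v assume "v \<in> set (map ?v bs)"
        then obtain m x s where "(m, v, x, s) \<in> set bs" by auto
        then show "v \<in> LT" using b by simp
      qed
    qed
    then have "distinct (map valT (map ?v bs))" using dist distinct_map by blast
    then show ?thesis by (simp add: comp_def case_prod_unfold)
  qed
  then have d: "distinct (map fst (map (\<lambda>(m, v, x, s). (valT v, x)) bs))" by (simp add: comp_def case_prod_unfold)
  have fv: "f (valT v) = valU x" if "(m, v, x, s) \<in> set bs" for m v x s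
  proof -
    have "map_of (map (\<lambda>(m, v, x, s). (valT v, x)) bs) (valT v) = Some x"
      using d that by (intro map_of_is_SomeI) force+
    then show ?thesis using valT_in b[OF that] by (simp add: f_def)
  qed
  have supp1: "supp f \<subseteq> valT ` ?v ` set bs"
  proof
    fix y assume y: "y \<in> supp f"
    then obtain x where "map_of (map (\<lambda>(m, v, x, s). (valT v, x)) bs) y = Some x"
      by (auto simp: supp_def f_def split: option.splits)
    then have "(y, x) \<in> set (map (\<lambda>(m, v, x, s). (valT v, x)) bs)" by (rule map_of_SomeD)
    then show "y \<in> valT ` ?v ` set bs" by (force simp: image_iff)
  qed
  have f: "f \<in> carrier N"
  proof -
    have "f y \<in> carrier U" if y: "y \<in> carrier T" for y
    proof (cases "map_of (map (\<lambda>(m, v, x, s). (valT v, x)) bs) y")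
      case None
      then show ?thesis by (simp add: f_def y)
    next
      case (Some x)
      then have "(y, x) \<in> set (map (\<lambda>(m, v, x, s). (valT v, x)) bs)" by (rule map_of_SomeD)
      then obtain m v s where "(m, v, x, s) \<in> set bs" by auto
      then have "x \<in> LU" using b by simp
      then show ?thesis using valU_in Some by (simp add: f_def y)
    qed
    moreover have "finite (supp f)" using supp1 by (rule finite_subset) simp
    moreover have "f \<in> extensional (carrier T)" by (simp add: f_def)
    ultimately show ?thesis by (auto simp: carrier_N supp_def PiE_iff)
  qed
  have ne: "f (valT v) \<noteq> \<one>\<^bsub>U\<^esub> \<longleftrightarrow> m \<noteq> Triv" if "(m, v, x, s) \<in> set bs" for m v x s
  proof -
    have "x \<in> LU" "x = repU \<one>\<^bsub>U\<^esub> \<longleftrightarrow> m = Triv" using b[OF that] by simp_all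
    then show ?thesis using fv[OF that] repU(2)[OF U.one_closed] repU(3)[of x] by metis
  qed
  \<comment> \<open>A block with trivial value is marked \<open>Triv\<close> and hence sits at the
    cursor; this accounts for the inserted \<open>t\<close>.\<close>
  have set: "valT ` ?v ` set bs = insert t (supp f)"
  proof
    show "valT ` ?v ` set bs \<subseteq> insert t (supp f)"
    proof clarify
      fix m v x s assume *: "(m, v, x, s) \<in> set bs" "valT v \<notin> supp f"
      then have "m = Triv" using ne[OF *(1)] valT_in b[OF *(1)] by (auto simp: supp_def)
      then show "valT v = t" using b[OF *(1)] by (simp add: t_def)
    qed
    show "insert t (supp f) \<subseteq> valT ` ?v ` set bs" using supp1 w by (auto simp: t_def)
  qed
  have "repT ` valT ` ?v ` set bs = ?v ` set bs"
    unfolding image_image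
  proof (intro image_cong refl)
    fix c assume c: "c \<in> set bs"
    obtain m v x s where "c = (m, v, x, s)" by (cases c)
    then show "repT (valT (?v c)) = ?v c" using b[of m v x s] c repT(3) by simp
  qed
  then have "set (map ?v bs) = repT ` insert t (supp f)" using set by simp
  \<comment> \<open>A strictly sorted list is determined by its set.\<close>
  then have pos: "positions f t = map ?v bs"
    unfolding positions_def using sorted[unfolded strict_sorted_iff]
    by (simp only: sorted_list_of_set.idem_if_sorted_distinct flip: \<open>set (map ?v bs) = _\<close>)
  have "map (\<lambda>v. (mk f t v, v, repU (f (valT v)), rev v)) (positions f t) = bs"
  proof -
    have "(\<lambda>v. (mk f t v, v, repU (f (valT v)), rev v)) (?v c) = c" if "c \<in> set bs" for c
    proof -
      obtain m v x s where c: "c = (m, v, x, s)" by (cases c)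
      note * = b[OF that[unfolded c]] and ** = fv[OF that[unfolded c]] and *** = ne[OF that[unfolded c]]
      have vt: "valT v = t \<longleftrightarrow> v = w"
        using repT(3)[of v] repT(3)[OF wL] * unfolding t_def by metis
      have "mk f t v = m"
      proof (cases "v = w")
        case True
        then have "f t = \<one>\<^bsub>U\<^esub> \<longleftrightarrow> m = Triv" "m \<noteq> Plain" "valT v = t" using * *** vt by simp_all
        then show ?thesis by (cases m) (simp_all add: mk_def)
      next
        case False
        then show ?thesis using * vt by (simp add: mk_def)
      qed
      then show ?thesis using * ** by (simp add: c repU(3))
    qed
    then show ?thesis unfolding pos map_map by (intro map_idI) simp
  qed
  moreover have "repT t = w" using repT(3)[OF wL] by (simp add: t_def)
  ultimately have "raw bs w = nf f t" by (simp add: nf_def)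
  then show ?thesis using f t by blast
qed

definition L :: "letter list set"
  where "L = {raw bs w | bs w. good bs w}"

lemma L_eq: "L = (\<lambda>(f, t). nf f t) ` carrier G"
proof
  show "L \<subseteq> (\<lambda>(f, t). nf f t) ` carrier G"
  proof
    fix v assume "v \<in> L"
    then obtain f t where "f \<in> carrier N" "t \<in> carrier T" "v = nf f t"
      unfolding L_def using good_imp_nf by blast
    then show "v \<in> (\<lambda>(f, t). nf f t) ` carrier G"
      by (intro image_eqI[of _ _ "(f, t)"]) (simp_all add: carrier_G)
  qed
  show "(\<lambda>(f, t). nf f t) ` carrier G \<subseteq> L"
  proof
    fix v assume "v \<in> (\<lambda>(f, t). nf f t) ` carrier G"
    then obtain g where g: "g \<in> carrier N \<times> carrier T" "v = nf (fst g) (snd g)"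
      by (auto simp: carrier_G simp del: one_sum_group)
    then have "good (map (\<lambda>v. (mk (fst g) (snd g) v, v, repU (fst g (valT v)), rev v)) (positions (fst g) (snd g))) (repT (snd g))"
      by (intro good_nf) auto
    then show "v \<in> L" unfolding L_def g(2) nf_def by blast
  qed
qed

lemma bij_L: "bij_betw val L (carrier G)"
proof (rule bij_betw_byWitness[where f' = "\<lambda>(f, t). nf f t"])
  have *: "val (case g of (f, t) \<Rightarrow> nf f t) = g" if "g \<in> carrier G" for g
    using that val_nf(1)[of "fst g" "snd g"] by (simp add: carrier_G case_prod_unfold mem_Times_iff)
  then show "\<forall>g\<in>carrier G. val (case g of (f, t) \<Rightarrow> nf f t) = g" by blast
  have L: "\<exists>g\<in>carrier G. v = (case g of (f, t) \<Rightarrow> nf f t)" if "v \<in> L" for v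
    using that unfolding L_eq by (rule imageE) blast
  show "\<forall>v\<in>L. (case val v of (f, t) \<Rightarrow> nf f t) = v" using * L by metis
  show "val ` L \<subseteq> carrier G" using * L by (metis image_subsetI)
  show "(\<lambda>(f, t). nf f t) ` carrier G \<subseteq> L" unfolding L_eq ..
qed

lemma L_lists: "L \<subseteq> lists C"
proof
  fix v assume "v \<in> L"
  then obtain g where "g \<in> carrier N \<times> carrier T" "v = nf (fst g) (snd g)"
    unfolding L_eq carrier_G by (auto simp del: one_sum_group)
  then show "v \<in> lists C" using val_nf(2)[of "fst g" "snd g"] by (simp add: mem_Times_iff)
qed

end

subsection \<open>The normal forms are a \<open>\<P>\<close> language\<close>

instance mark :: finite
proof
  have "m \<in> {Plain, Here, Triv}" for m by (cases m) simp_all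
  then have "(UNIV :: mark set) \<subseteq> {Plain, Here, Triv}" by blast
  then show "finite (UNIV :: mark set)" by (rule finite_subset) simp
qed

text \<open>All transducers below remember the mark of the current block (\<^const>\<open>None\<close> after \<^const>\<open>Fin\<close>)
  and emit according to it.\<close>

definition etr :: "(mark option \<Rightarrow> letter \<Rightarrow> 'a option) \<Rightarrow> mark option \<Rightarrow> letter \<Rightarrow> mark option \<times> 'a option"
  where "etr e q l = (let q' = (case l of Mk m \<Rightarrow> Some m | Fin \<Rightarrow> None | _ \<Rightarrow> q) in (q', e q' l))"

lemma etr_simps [simp]:
  "etr e q (Mk m) = (Some m, e (Some m) (Mk m))" "etr e q Fin = (None, e None Fin)"
  "etr e q (TB b) = (q, e q (TB b))" "etr e q (TI b) = (q, e q (TI b))" "etr e q (UA a) = (q, e q (UA a))"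
  "etr e q Sep1 = (q, e q Sep1)" "etr e q Sep2 = (q, e q Sep2)" "etr e q End = (q, e q End)"
  by (simp_all add: etr_def Let_def)

definition em :: "('c \<Rightarrow> 'a option) \<Rightarrow> 'c list \<Rightarrow> 'a list"
  where "em e v = concat (map (\<lambda>l. olist (e l)) v)"

lemma em_simps [simp]: "em e [] = []" "em e (l # v) = olist (e l) @ em e v" "em e (v @ w) = em e v @ em e w"
  by (simp_all add: em_def)

lemma em_map_Some: "(\<And>x. e (k x) = Some (h x)) \<Longrightarrow> em e (map k v) = map h v"
  and em_map_None: "(\<And>x. e (k x) = None) \<Longrightarrow> em e (map k v) = []"
  by (induction v) simp_all

lemma etr_map [simp]:
  "trs (etr e) q (map TB v) = q" "tr (etr e) q (map TB v) = em (e q) (map TB v)"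
  "trs (etr e) q (map TI v) = q" "tr (etr e) q (map TI v) = em (e q) (map TI v)"
  "trs (etr e) q (map UA v) = q" "tr (etr e) q (map UA v) = em (e q) (map UA v)"
  by (induction v) simp_all

lemma etr_rblock [simp]:
  "trs (etr e) q (rblock m v x s) = Some m" "tr (etr e) q (rblock m v x s) = em (e (Some m)) (rblock m v x s)"
  by (simp_all add: rblock_def)

text \<open>The remembered mark is constant within a block and is replaced at the start of the next
  one, so each block is translated letter by letter and independently of the others.\<close>

lemma tr_raw:
  "tr (etr e) q (raw bs w) =
    concat (map (\<lambda>(m, v, x, s). em (e (Some m)) (rblock m v x s)) bs) @ em (e None) (Fin # map TB w)"
proof (induction bs arbitrary: q)
  case Nil
  have "tr (etr e) q (Fin # map TB w) = em (e None) (Fin # map TB w)"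
    by simp
  then show ?case by (simp add: raw_def)
next
  case (Cons b bs)
  obtain m v x s where b: "b = (m, v, x, s)" by (cases b)
  have "raw (b # bs) w = rblock m v x s @ raw bs w" by (simp add: raw_def b)
  then show ?case using Cons.IH[of "Some m"] by (simp add: b)
qed

lemma em_rblock:
  "em e (rblock m v x s) = olist (e (Mk m)) @ em e (map TB v) @ olist (e Sep1) @ em e (map UA x) @ olist (e Sep2) @
    em e (map TI s) @ olist (e End)"
  by (simp add: rblock_def)

lemma chunks_blocks:
  "set (chunks (concat (map (\<lambda>b. if P b then map Some (y b) @ [None] else []) bs)) []) = y ` {b \<in> set bs. P b}"
proof (induction bs)
  case (Cons b bs)
  then show ?case by (cases "P b") auto
qed simp


subsubsection \<open>The format\<close>

text \<open>The states are 0 between blocks, 1 in a position, 2 in a value, 3 in an inverse word, 4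
  after \<open>Fin\<close>, and 5 dead. The bit \<open>sn\<close> tells that a mark other than
  \<open>Plain\<close> has been seen: a second one is refused, and \<open>Fin\<close> demands
  one.\<close>

definition fstep :: "nat \<times> bool \<Rightarrow> letter \<Rightarrow> nat \<times> bool"
  where "fstep = (\<lambda>(n, sn) l. case l of
      Mk m \<Rightarrow> if n = 0 \<and> (m = Plain \<or> \<not> sn) then (1, sn \<or> m \<noteq> Plain) else (5, sn)
    | TB _ \<Rightarrow> if n = 1 \<or> n = 4 then (n, sn) else (5, sn)
    | Sep1 \<Rightarrow> if n = 1 then (2, sn) else (5, sn)
    | UA _ \<Rightarrow> if n = 2 then (2, sn) else (5, sn)
    | Sep2 \<Rightarrow> if n = 2 then (3, sn) else (5, sn)
    | TI _ \<Rightarrow> if n = 3 then (3, sn) else (5, sn)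
    | End \<Rightarrow> if n = 3 then (0, sn) else (5, sn)
    | Fin \<Rightarrow> if n = 0 \<and> sn then (4, sn) else (5, sn))"

lemma fstep_simps [simp]:
  "fstep (n, sn) (Mk m) = (if n = 0 \<and> (m = Plain \<or> \<not> sn) then (1, sn \<or> m \<noteq> Plain) else (5, sn))"
  "fstep (n, sn) (TB b) = (if n = 1 \<or> n = 4 then (n, sn) else (5, sn))"
  "fstep (n, sn) Sep1 = (if n = 1 then (2, sn) else (5, sn))"
  "fstep (n, sn) (UA a) = (if n = 2 then (2, sn) else (5, sn))"
  "fstep (n, sn) Sep2 = (if n = 2 then (3, sn) else (5, sn))"
  "fstep (n, sn) (TI b) = (if n = 3 then (3, sn) else (5, sn))"
  "fstep (n, sn) End = (if n = 3 then (0, sn) else (5, sn))"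
  "fstep (n, sn) Fin = (if n = 0 \<and> sn then (4, sn) else (5, sn))"
  by (simp_all add: fstep_def)

definition marks :: "(mark \<times> nat list \<times> nat list \<times> nat list) list \<Rightarrow> nat"
  where "marks bs = length (filter (\<lambda>(m, v, x, s). m \<noteq> Plain) bs)"

lemma marks_simps [simp]: "marks [] = 0" "marks ((m, v, x, s) # bs) = (if m = Plain then 0 else 1) + marks bs"
  by (simp_all add: marks_def)

text \<open>These are the words accepted from state \<open>(n, sn)\<close>, built backwards: inside
  a block, the rest of the block comes first, followed by a \<open>raw\<close> word with the mark
  that is still missing, if any.\<close>

definition tails :: "nat \<Rightarrow> bool \<Rightarrow> letter list set"
  where "tails n sn =
    (let R = {raw bs w | bs w. marks bs = (if sn then 0 else 1)};
         R3 = {map TI s @ End # r | s r. r \<in> R};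
         R2 = {map UA x @ Sep2 # r | x r. r \<in> R3}
     in if n = 0 then R else if n = 1 then {map TB v @ Sep1 # r | v r. r \<in> R2}
     else if n = 2 then R2 else if n = 3 then R3 else if n = 4 then range (map TB) else {})"

lemma tails_simps:
  "tails 0 sn = {raw bs w | bs w. marks bs = (if sn then 0 else 1)}"
  "tails 1 sn = {map TB v @ Sep1 # r | v r. r \<in> tails 2 sn}"
  "tails 2 sn = {map UA x @ Sep2 # r | x r. r \<in> tails 3 sn}"
  "tails 3 sn = {map TI s @ End # r | s r. r \<in> tails 0 sn}"
  "tails 4 sn = range (map TB)"
  by (simp_all only: tails_def Let_def) simp_all

lemma raw_Cons: "raw ((m, v, x, s) # bs) w = Mk m # map TB v @ Sep1 # map UA x @ Sep2 # map TI s @ End # raw bs w"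
  by (simp add: raw_def rblock_def)

lemma fstep_dead: "foldl fstep (5, sn) v = (5, sn)"
proof (induction v)
  case (Cons l v)
  have "fstep (5, sn) l = (5, sn)" by (cases l) simp_all
  then show ?case using Cons by simp
qed simp

lemma tails_step:
  assumes "v \<in> tails n' sn'" "fstep (n, sn) l = (n', sn')" "n' \<noteq> 5" "n \<le> 5"
  shows "l # v \<in> tails n sn"
proof (cases l)
  case (Mk m)
  then have n: "n = 0" "m = Plain \<or> \<not> sn" "n' = 1" "sn' = (sn \<or> m \<noteq> Plain)" using assms(2,3) by (auto split: if_splits)
  obtain w x s bs u where v: "v = map TB w @ Sep1 # map UA x @ Sep2 # map TI s @ End # raw bs u" "marks bs = (if sn' then 0 else 1)"
    using assms(1) unfolding n(3) tails_simps by blast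
  have "l # v = raw ((m, w, x, s) # bs) u" "marks ((m, w, x, s) # bs) = (if sn then 0 else 1)"
    using v(2) n by (auto simp: v(1) Mk raw_Cons)
  then show ?thesis unfolding tails_simps n(1) by blast
next
  case (TB b)
  then have n: "n = 1 \<or> n = 4" "n' = n" "sn' = sn" using assms(2,3) by (auto split: if_splits)
  from n(1) show ?thesis
  proof
    assume 1: "n = 1"
    obtain w r where "v = map TB w @ Sep1 # r" "r \<in> tails 2 sn"
      using assms(1) unfolding n(2,3) 1 tails_simps by blast
    then have "l # v = map TB (b # w) @ Sep1 # r" "r \<in> tails 2 sn" by (simp_all add: TB)
    then show ?thesis unfolding 1 tails_simps by blast
  next
    assume 4: "n = 4"
    obtain w where "v = map TB w" using assms(1) unfolding n(2,3) 4 tails_simps by blast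
    then have "l # v = map TB (b # w)" by (simp add: TB)
    then show ?thesis unfolding 4 tails_simps by (rule range_eqI)
  qed
next
  case Sep1
  then have n: "n = 1" "n' = 2" "sn' = sn" using assms(2,3) by (auto split: if_splits)
  have "l # v = map TB [] @ Sep1 # v" by (simp add: Sep1)
  then show ?thesis using assms(1) unfolding n tails_simps by blast
next
  case (UA a)
  then have n: "n = 2" "n' = 2" "sn' = sn" using assms(2,3) by (auto split: if_splits)
  obtain w r where "v = map UA w @ Sep2 # r" "r \<in> tails 3 sn" using assms(1) unfolding n tails_simps by blast
  then have "l # v = map UA (a # w) @ Sep2 # r" "r \<in> tails 3 sn" by (simp_all add: UA)
  then show ?thesis unfolding n tails_simps by blast
next
  case Sep2
  then have n: "n = 2" "n' = 3" "sn' = sn" using assms(2,3) by (auto split: if_splits)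
  have "l # v = map UA [] @ Sep2 # v" by (simp add: Sep2)
  then show ?thesis using assms(1) unfolding n tails_simps by blast
next
  case (TI b)
  then have n: "n = 3" "n' = 3" "sn' = sn" using assms(2,3) by (auto split: if_splits)
  obtain w r where "v = map TI w @ End # r" "r \<in> tails 0 sn" using assms(1) unfolding n tails_simps by blast
  then have "l # v = map TI (b # w) @ End # r" "r \<in> tails 0 sn" by (simp_all add: TI)
  then show ?thesis unfolding n tails_simps by blast
next
  case End
  then have n: "n = 3" "n' = 0" "sn' = sn" using assms(2,3) by (auto split: if_splits)
  have "l # v = map TI [] @ End # v" by (simp add: End)
  then show ?thesis using assms(1) unfolding n tails_simps by blast
next
  case Fin
  then have n: "n = 0" "n' = 4" "sn' = sn" "sn" using assms(2,3) by (auto split: if_splits)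
  obtain w where "v = map TB w" using assms(1) unfolding n(2) tails_simps by blast
  then have "l # v = raw [] w" by (simp add: Fin raw_def)
  moreover have "marks [] = (if sn then 0 else 1)" using n(4) by simp
  ultimately show ?thesis unfolding n(1) tails_simps by blast
qed

lemma format_sound: "fst (foldl fstep (n, sn) v) = 4 \<Longrightarrow> n \<le> 5 \<Longrightarrow> v \<in> tails n sn"
proof (induction v arbitrary: n sn)
  case Nil
  then have n: "n = 4" by simp
  show ?case unfolding n tails_simps by (rule range_eqI[of _ _ "[]"]) simp
next
  case (Cons l v)
  obtain n' sn' where f: "fstep (n, sn) l = (n', sn')" by fastforce
  have "n' \<noteq> 5" using Cons.prems(1) f fstep_dead[of sn' v] by auto
  moreover have "n' \<le> 5" using f Cons.prems(2) by (cases l) (auto split: if_splits)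
  moreover have "v \<in> tails n' sn'" using Cons.IH[of n' sn'] Cons.prems f calculation by simp
  ultimately show ?case using tails_step f Cons.prems(2) by blast
qed

lemma fstep_map:
  "foldl fstep (1, sn) (map TB v) = (1, sn)" "foldl fstep (4, sn) (map TB v) = (4, sn)"
  "foldl fstep (2, sn) (map UA x) = (2, sn)" "foldl fstep (3, sn) (map TI s) = (3, sn)"
proof -
  show "foldl fstep (1, sn) (map TB v) = (1, sn)" "foldl fstep (4, sn) (map TB v) = (4, sn)" by (induction v) simp_all
  show "foldl fstep (2, sn) (map UA x) = (2, sn)" by (induction x) simp_all
  show "foldl fstep (3, sn) (map TI s) = (3, sn)" by (induction s) simp_all
qed

lemma format_complete:
  "marks bs = (if sn then 0 else 1) \<Longrightarrow> fst (foldl fstep (0, sn) (raw bs w)) = 4"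
proof (induction bs arbitrary: sn)
  case Nil
  then show ?case by (simp add: raw_def fstep_map split: if_splits)
next
  case (Cons b bs)
  obtain m v x s where b: "b = (m, v, x, s)" by (cases b)
  have ok: "m = Plain \<or> \<not> sn" "marks bs = (if sn \<or> m \<noteq> Plain then 0 else 1)"
    using Cons.prems by (auto simp: b split: if_splits)
  have "foldl fstep (0, sn) (raw (b # bs) w) = foldl fstep (0, sn \<or> m \<noteq> Plain) (raw bs w)"
    using ok(1) by (simp add: b raw_Cons fstep_map fstep_map[unfolded One_nat_def])
  then show ?case using Cons.IH[OF ok(2)] by simp
qed

lemma format_iff: "fst (foldl fstep (0, False) v) = 4 \<longleftrightarrow> (\<exists>bs w. v = raw bs w \<and> marks bs = 1)"
proof
  assume "fst (foldl fstep (0, False) v) = 4"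
  from format_sound[OF this] have "v \<in> tails 0 False" by simp
  then show "\<exists>bs w. v = raw bs w \<and> marks bs = 1" unfolding tails_simps by auto
qed (use format_complete[of _ False] in auto)

section \<open>The single conditions on normal forms as languages\<close>

context wreath
begin

lemma transducer_etr:
  assumes "\<And>q l. l \<in> C \<Longrightarrow> set (olist (e q l)) \<subseteq> D"
  shows "transducer UNIV None C D (etr e)"
  using assms by (auto simp: transducer_def etr_def Let_def)

lemma P_format: "P_language C {v \<in> lists C. \<exists>bs w. v = raw bs w \<and> marks bs = 1}"
proof -
  have "pdfun C (\<lambda>v. (\<lambda>q. fst q = 4) (foldl fstep (0, False) v))"
  proof (rule pdfun_finite_automaton[where Q = "{..5} \<times> UNIV"])
    fix q :: "nat \<times> bool" and l assume "q \<in> {..5} \<times> UNIV"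
    then show "fstep q l \<in> {..5} \<times> UNIV" by (cases q; cases l) auto
  qed auto
  from P_language_pdfun[OF finite_C this] show ?thesis by (simp only: format_iff)
qed

text \<open>Each block selected by \<open>P\<close> emits one terminated chunk and all else emits
  nothing, so a test of all chunks is a test of all selected blocks. Nothing is claimed about words
  of another format, which is tested separately.\<close>

lemma P_blocks:
  fixes D :: "'d set"
  assumes K: "P_language D K"
    and e: "\<And>q l. l \<in> C \<Longrightarrow> set (olist (e q l)) \<subseteq> insert None (Some ` D)"
    and bl: "\<And>m v x s. em (e (Some m)) (rblock m v x s) = (if P (m, v, x, s) then map Some (y (m, v, x, s)) @ [None] else [])"
    and fin: "\<And>w. em (e None) (Fin # map TB w) = []"
  shows "\<exists>K'. P_language C K' \<and> (\<forall>bs w. raw bs w \<in> lists C \<longrightarrow>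
    (raw bs w \<in> K' \<longleftrightarrow> (\<forall>b\<in>set bs. P b \<longrightarrow> y b \<in> K)))"
proof (intro exI conjI allI impI)
  let ?K = "{w \<in> lists (insert None (Some ` D)). \<forall>u\<in>set (chunks w []). u \<in> K}"
  show "P_language C {v \<in> lists C. tr (etr e) None v \<in> ?K}"
    by (rule P_language_vimage[OF P_language_chunks[OF K] transducer_etr[OF e] finite_C])
  fix bs w assume r: "raw bs w \<in> lists C"
  have f: "(\<lambda>(m, v, x, s). em (e (Some m)) (rblock m v x s)) = (\<lambda>b. if P b then map Some (y b) @ [None] else [])"
    by (auto simp: bl)
  have "tr (etr e) None (raw bs w) = concat (map (\<lambda>b. if P b then map Some (y b) @ [None] else []) bs)"
    unfolding tr_raw f fin by simp
  then have "set (chunks (tr (etr e) None (raw bs w)) []) = y ` {b \<in> set bs. P b}"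
    by (simp only: chunks_blocks)
  moreover have "tr (etr e) None (raw bs w) \<in> lists (insert None (Some ` D))"
    by (rule tr_lists[OF transducer_etr[OF e] r])
  ultimately show "raw bs w \<in> {v \<in> lists C. tr (etr e) None v \<in> ?K} \<longleftrightarrow> (\<forall>b\<in>set bs. P b \<longrightarrow> y b \<in> K)"
    using r by auto
qed

text \<open>The letters \<open>TB\<close> after \<open>Fin\<close> belong to the cursor. There the
  remembered mark is \<open>None\<close>, which tells them from the letters of a position.\<close>

fun e_pos :: "mark option \<Rightarrow> letter \<Rightarrow> nat option option"
  where "e_pos (Some m) (TB b) = Some (Some b)" | "e_pos _ Sep1 = Some None" | "e_pos _ _ = None"

fun e_val :: "mark option \<Rightarrow> letter \<Rightarrow> nat option option"
  where "e_val _ (UA a) = Some (Some a)" | "e_val _ Sep2 = Some None" | "e_val _ _ = None"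

fun e_val_if :: "bool \<Rightarrow> mark option \<Rightarrow> letter \<Rightarrow> nat option option"
  where
    "e_val_if \<beta> q (UA a) = (if (q = Some Triv) = \<beta> then Some (Some a) else None)"
  | "e_val_if \<beta> q Sep2 = (if (q = Some Triv) = \<beta> then Some None else None)"
  | "e_val_if \<beta> _ _ = None"

fun e_inv :: "mark option \<Rightarrow> letter \<Rightarrow> (nat + nat) option option"
  where "e_inv (Some m) (TB b) = Some (Some (Inl b))" | "e_inv _ (TI b) = Some (Some (Inr b))"
  | "e_inv _ End = Some None" | "e_inv _ _ = None"

text \<open>The letter \<open>0\<close> in front of every position makes the first comparison, with the
  empty word, succeed.\<close>

fun e_ord :: "mark option \<Rightarrow> letter \<Rightarrow> (nat + nat) option option"
  where "e_ord _ (TI b) = Some (Some (Inl b))" | "e_ord _ End = Some (Some (Inl 0))"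
  | "e_ord _ (Mk m) = Some (Some (Inr 0))" | "e_ord (Some m) (TB b) = Some (Some (Inr b))"
  | "e_ord _ Sep1 = Some None" | "e_ord _ _ = None"

fun e_cur :: "mark option \<Rightarrow> letter \<Rightarrow> (nat + nat) option"
  where "e_cur (Some m) (TI b) = (if m = Plain then None else Some (Inl b))" | "e_cur None (TB b) = Some (Inr b)"
  | "e_cur _ _ = None"

lemma raw_lists:
  assumes "raw bs w \<in> lists C"
  shows "w \<in> lists B" "(m, v, x, s) \<in> set bs \<Longrightarrow> v \<in> lists B \<and> x \<in> lists A \<and> s \<in> lists B"
proof -
  have "set (map TB w) \<subseteq> C" using assms by (auto simp: raw_def)
  then show "w \<in> lists B" by auto
  assume "(m, v, x, s) \<in> set bs"
  then have "set (rblock m v x s) \<subseteq> C" using assms by (auto simp: raw_def)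
  then show "v \<in> lists B \<and> x \<in> lists A \<and> s \<in> lists B" by (auto simp: rblock_def)
qed

lemma P_positions: "\<exists>K. P_language C K \<and> (\<forall>bs w. raw bs w \<in> lists C \<longrightarrow>
    (raw bs w \<in> K \<longleftrightarrow> (\<forall>b\<in>set bs. True \<longrightarrow> (\<lambda>(m, v, x, s). v) b \<in> LT)))"
proof (rule P_blocks[where e = e_pos])
  show "P_language B LT" using LT by (simp add: P_structure_def)
  show "set (olist (e_pos q l)) \<subseteq> insert None (Some ` B)" if "l \<in> C" for q l
    using that by (cases "(q, l)" rule: e_pos.cases) auto
qed (simp_all add: em_rblock em_map_Some em_map_None)

lemma P_values: "\<exists>K. P_language C K \<and> (\<forall>bs w. raw bs w \<in> lists C \<longrightarrow>
    (raw bs w \<in> K \<longleftrightarrow> (\<forall>b\<in>set bs. True \<longrightarrow> (\<lambda>(m, v, x, s). x) b \<in> LU)))"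
proof (rule P_blocks[where e = e_val])
  show "P_language A LU" using LU by (simp add: P_structure_def)
  show "set (olist (e_val q l)) \<subseteq> insert None (Some ` A)" if "l \<in> C" for q l
    using that by (cases "(q, l)" rule: e_val.cases) auto
qed (simp_all add: em_rblock em_map_Some em_map_None)

text \<open>The equivalence between trivial value and mark \<open>Triv\<close> is split into two
  tests, each uniform over the blocks that it selects: \<open>True\<close> for the blocks marked
  \<open>Triv\<close>, \<open>False\<close> for the others.\<close>

lemma P_trivial: "\<exists>K. P_language C K \<and> (\<forall>bs w. raw bs w \<in> lists C \<longrightarrow>
    (raw bs w \<in> K \<longleftrightarrow> (\<forall>b\<in>set bs. (\<lambda>(m, v, x, s). (m = Triv) = \<beta>) b \<longrightarrow>
      (\<lambda>(m, v, x, s). x) b \<in> {x \<in> lists A. (x = repU \<one>\<^bsub>U\<^esub>) = \<beta>})))"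
proof (rule P_blocks[where e = "e_val_if \<beta>"])
  show "P_language A {x \<in> lists A. (x = repU \<one>\<^bsub>U\<^esub>) = \<beta>}"
    by (rule P_language_pdfun[OF A pdfun_out[OF pdfun_fixed_word]])
  show "set (olist (e_val_if \<beta> q l)) \<subseteq> insert None (Some ` A)" if "l \<in> C" for q l
    using that by (cases "(\<beta>, q, l)" rule: e_val_if.cases) auto
next
  fix m v x s
  show "em (e_val_if \<beta> (Some m)) (rblock m v x s) = (if (\<lambda>(m, v, x, s). (m = Triv) = \<beta>) (m, v, x, s)
      then map Some ((\<lambda>(m, v, x, s). x) (m, v, x, s)) @ [None] else [])"
    by (cases "(m = Triv) = \<beta>") (simp_all add: em_rblock em_map_Some em_map_None)
qed (simp add: em_map_None)

lemma P_inverses: "\<exists>K. P_language C K \<and> (\<forall>bs w. raw bs w \<in> lists C \<longrightarrow>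
    (raw bs w \<in> K \<longleftrightarrow> (\<forall>(m, v, x, s)\<in>set bs. rev v = s)))"
proof -
  obtain F :: "(nat + nat) list \<Rightarrow> bool \<times> bool" where F: "pdfun (B <+> B) F"
    and cmp: "\<And>s v. s \<in> lists B \<Longrightarrow> v \<in> lists B \<Longrightarrow> F (map Inl s @ map Inr v) = (rev s = v, rev s < v)"
    using pdfun_compare[OF B] by blast
  let ?y = "\<lambda>(m :: mark, v, x :: nat list, s). map Inl v @ map Inr s" and ?K = "{u \<in> lists (B <+> B). fst (F u)}"
  have "\<exists>K. P_language C K \<and> (\<forall>bs w. raw bs w \<in> lists C \<longrightarrow> (raw bs w \<in> K \<longleftrightarrow>
      (\<forall>b\<in>set bs. True \<longrightarrow> ?y b \<in> ?K)))"
  proof (rule P_blocks[where e = e_inv])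
    show "P_language (B <+> B) ?K"
      using B by (intro P_language_pdfun pdfun_out[OF F]) simp
    show "set (olist (e_inv q l)) \<subseteq> insert None (Some ` (B <+> B))" if "l \<in> C" for q l
      using that by (cases "(q, l)" rule: e_inv.cases) auto
  qed (simp_all add: em_rblock em_map_Some[where h = "\<lambda>b. Some (Inl b)"] em_map_Some[where h = "\<lambda>b. Some (Inr b)"] em_map_None)
  then obtain K where K: "P_language C K" "\<And>bs w. raw bs w \<in> lists C \<Longrightarrow> raw bs w \<in> K \<longleftrightarrow> (\<forall>b\<in>set bs. ?y b \<in> ?K)"
    by auto
  have "?y b \<in> ?K \<longleftrightarrow> (\<lambda>(m, v, x, s). rev v = s) b" if "raw bs w \<in> lists C" "b \<in> set bs" for bs w b
  proof -
    obtain m v x s where b: "b = (m, v, x, s)" by (cases b)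
    have "v \<in> lists B" "s \<in> lists B" using raw_lists(2)[OF that(1)] that(2) b by blast+
    then show ?thesis by (auto simp: b cmp in_lists_conv_set)
  qed
  then show ?thesis using K by (intro exI[of _ K]) simp
qed

lemma filter_single:
  assumes "length (filter P bs) = 1"
  shows "\<exists>b\<in>set bs. P b \<and> concat (map (\<lambda>b. if P b then g b else []) bs) = g b \<and> (\<forall>b'\<in>set bs. P b' \<longrightarrow> b' = b)"
proof -
  obtain b where f: "filter P bs = [b]"
    using assms by (cases "filter P bs") auto
  then have "{b' \<in> set bs. P b'} = {b}" by (metis list.set(1,2) set_filter)
  moreover have "concat (map (\<lambda>b. if P b then g b else []) bs) = concat (map g (filter P bs))"
    by (induction bs) auto
  ultimately show ?thesis using f by (intro bexI[of _ b]) auto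
qed

lemma one_mark:
  assumes "marks bs = 1"
  obtains m v x s where "(m, v, x, s) \<in> set bs" "m \<noteq> Plain"
      "concat (map (\<lambda>(m, v, x, s). if m = Plain then [] else map (Inl :: nat \<Rightarrow> nat + nat) s) bs) = map (Inl :: nat \<Rightarrow> nat + nat) s"
      "\<forall>(m', v', x', s')\<in>set bs. m' \<noteq> Plain \<longrightarrow> (m', v', x', s') = (m, v, x, s)"
proof -
  let ?P = "\<lambda>(m, v :: nat list, x :: nat list, s :: nat list). m \<noteq> Plain"
  let ?g = "\<lambda>(m :: mark, v :: nat list, x :: nat list, s). map (Inl :: nat \<Rightarrow> nat + nat) s"
  have e: "(\<lambda>(m, v, x, s). if m = Plain then [] else map (Inl :: nat \<Rightarrow> nat + nat) s) = (\<lambda>b. if ?P b then ?g b else [])"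
    by (auto simp: fun_eq_iff)
  obtain b where b: "b \<in> set bs" "?P b" "concat (map (\<lambda>b. if ?P b then ?g b else []) bs) = ?g b"
    "\<forall>b'\<in>set bs. ?P b' \<longrightarrow> b' = b"
    using filter_single[of ?P bs ?g] assms unfolding marks_def by blast
  obtain m v x s where bb: "b = (m, v, x, s)" by (cases b)
  show ?thesis
  proof (rule that[of m v x s])
    show "concat (map (\<lambda>(m, v, x, s). if m = Plain then [] else map (Inl :: nat \<Rightarrow> nat + nat) s) bs) = map (Inl :: nat \<Rightarrow> nat + nat) s"
      using b(3) unfolding e by (simp add: bb)
    show "\<forall>(m', v', x', s')\<in>set bs. m' \<noteq> Plain \<longrightarrow> (m', v', x', s') = (m, v, x, s)"
    proof
      fix b' assume "b' \<in> set bs"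
      with b(4) have "?P b' \<longrightarrow> b' = b" by blast
      then show "case b' of (m', v', x', s') \<Rightarrow> m' \<noteq> Plain \<longrightarrow> (m', v', x', s') = (m, v, x, s)"
        by (cases b') (simp add: bb)
    qed
  qed (use b(1,2) bb in simp_all)
qed

text \<open>The inverse word of the marked block is pushed, so that for a correct block the first
  letter of its position is on top when the word after \<open>Fin\<close> arrives. Several marked
  blocks would be pushed on top of each other, hence the restriction to one.\<close>

lemma P_cursor: "\<exists>K. P_language C K \<and> (\<forall>bs w. raw bs w \<in> lists C \<longrightarrow> marks bs = 1 \<longrightarrow>
    (raw bs w \<in> K \<longleftrightarrow> (\<forall>(m, v, x, s)\<in>set bs. m \<noteq> Plain \<longrightarrow> rev s = w)))"
proof -
  obtain F :: "(nat + nat) list \<Rightarrow> bool \<times> bool" where F: "pdfun (B <+> B) F"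
    and cmp: "\<And>s v. s \<in> lists B \<Longrightarrow> v \<in> lists B \<Longrightarrow> F (map Inl s @ map Inr v) = (rev s = v, rev s < v)"
    using pdfun_compare[OF B] by blast
  let ?K = "{u \<in> lists (B <+> B). fst (F u)}"
  have PK: "P_language (B <+> B) ?K"
    using B by (intro P_language_pdfun pdfun_out[OF F]) simp
  have "set (olist (e_cur q l)) \<subseteq> B <+> B" if "l \<in> C" for q l
    using that by (cases "(q, l)" rule: e_cur.cases) auto
  then have t: "transducer UNIV None C (B <+> B) (etr e_cur)" by (rule transducer_etr)
  have P: "P_language C {v \<in> lists C. tr (etr e_cur) None v \<in> ?K}"
    by (rule P_language_vimage[OF PK t finite_C])
  have "raw bs w \<in> {v \<in> lists C. tr (etr e_cur) None v \<in> ?K} \<longleftrightarrow> (\<forall>(m, v, x, s)\<in>set bs. m \<noteq> Plain \<longrightarrow> rev s = w)"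
    if r: "raw bs w \<in> lists C" and m: "marks bs = 1" for bs w
  proof -
    have 1: "em (e_cur (Some m)) (rblock m v x s) = (if m = Plain then [] else map Inl s)" for m v x s
      by (simp add: em_rblock em_map_Some[where h = Inl] em_map_None)
    obtain m' v' x' s' where *: "(m', v', x', s') \<in> set bs" "m' \<noteq> Plain"
        "concat (map (\<lambda>(m, v, x, s). if m = Plain then [] else map (Inl :: nat \<Rightarrow> nat + nat) s) bs) = map Inl s'"
        "\<forall>(m1, v1, x1, s1)\<in>set bs. m1 \<noteq> Plain \<longrightarrow> (m1, v1, x1, s1) = (m', v', x', s')"
      by (rule one_mark[OF m]) (rule that)
    have "tr (etr e_cur) None (raw bs w) = map Inl s' @ map Inr w"
      unfolding tr_raw 1 *(3) by (simp add: em_map_Some[where h = Inr])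
    moreover have "s' \<in> lists B" "w \<in> lists B" using raw_lists[OF r] *(1) by blast+
    moreover from this have "map Inl s' @ map Inr w \<in> lists (B <+> B)" by (auto simp: in_lists_conv_set)
    ultimately have "raw bs w \<in> {v \<in> lists C. tr (etr e_cur) None v \<in> ?K} \<longleftrightarrow> rev s' = w"
      using r cmp by simp
    also have "\<dots> \<longleftrightarrow> (\<forall>(m, v, x, s)\<in>set bs. m \<noteq> Plain \<longrightarrow> rev s = w)"
    proof
      assume "rev s' = w"
      have "rev s = w" if "(m, v, x, s) \<in> set bs" "m \<noteq> Plain" for m v x s
        using bspec[OF *(4) that(1)] that(2) \<open>rev s' = w\<close> by simp
      then show "\<forall>(m, v, x, s)\<in>set bs. m \<noteq> Plain \<longrightarrow> rev s = w" by blast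
    next
      assume "\<forall>(m, v, x, s)\<in>set bs. m \<noteq> Plain \<longrightarrow> rev s = w"
      from bspec[OF this *(1)] show "rev s' = w" using *(2) by simp
    qed
    finally show ?thesis .
  qed
  then show ?thesis using P by blast
qed

lemma chunks_map_append: "chunks (map Some y @ w) u = chunks w (u @ y)"
  by (induction y arbitrary: u) simp_all

text \<open>Chunks end at \<open>Sep1\<close> and not at the ends of blocks: each holds the inverse
  word of one block, which pushes that position with its first letter on top, and then the position
  of the next block. What follows the last \<open>Sep1\<close> is an unfinished chunk and is
  dropped. Comparing neighbours suffices, as the order is transitive.\<close>

lemma P_order: "\<exists>K. P_language C K \<and> (\<forall>bs w. raw bs w \<in> lists C \<longrightarrow> (\<forall>(m, v, x, s)\<in>set bs. s = rev v) \<longrightarrow>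
    (raw bs w \<in> K \<longleftrightarrow> sorted_wrt (<) (map (\<lambda>(m, v, x, s). v) bs)))"
proof -
  \<comment> \<open>The additional letter \<open>0\<close> may lie outside \<open>B\<close>.\<close>
  let ?D = "insert 0 B"
  have D: "finite ?D" using B by simp
  obtain F :: "(nat + nat) list \<Rightarrow> bool \<times> bool" where F: "pdfun (?D <+> ?D) F"
    and cmp: "\<And>s v. s \<in> lists ?D \<Longrightarrow> v \<in> lists ?D \<Longrightarrow> F (map Inl s @ map Inr v) = (rev s = v, rev s < v)"
    using pdfun_compare[OF D] by blast
  let ?K = "{u \<in> lists (?D <+> ?D). snd (F u)}" and ?D' = "insert None (Some ` (?D <+> ?D))"
  let ?L = "{w \<in> lists ?D'. \<forall>u\<in>set (chunks w []). u \<in> ?K}"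
  have PK: "P_language (?D <+> ?D) ?K"
    using D by (intro P_language_pdfun pdfun_out[OF F]) simp
  have "set (olist (e_ord q l)) \<subseteq> ?D'" if "l \<in> C" for q l
    using that by (cases "(q, l)" rule: e_ord.cases) auto
  then have t: "transducer UNIV None C ?D' (etr e_ord)" by (rule transducer_etr)
  have P: "P_language C {v \<in> lists C. tr (etr e_ord) None v \<in> ?L}"
    by (rule P_language_vimage[OF P_language_chunks[OF PK] t finite_C])
  let ?b = "\<lambda>(m :: mark, v, x :: nat list, s). map Some (map Inr (0 # v)) @ None # map Some (map Inl (s @ [0]))"
  \<comment> \<open>\<open>s0\<close> is what the preceding block has contributed to the current
    chunk; it is empty in front of the first block.\<close>
  have chain: "(\<forall>c\<in>set (chunks (concat (map ?b bs)) (map Inl s0)). c \<in> ?K) \<longleftrightarrow>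
      sorted_wrt (<) (rev s0 # map (\<lambda>(m, v, x, s). 0 # v) bs)"
    if "s0 \<in> lists ?D" "\<forall>(m, v, x, s)\<in>set bs. s = rev v \<and> v \<in> lists B" for s0 bs
    using that
  proof (induction bs arbitrary: s0)
    case (Cons b bs)
    obtain m v x s where b: "b = (m, v, x, s)" by (cases b)
    have v: "s = rev v" "v \<in> lists B" using Cons.prems(2) b by simp_all
    have e: "rev (s @ [0]) = 0 # v" by (simp add: v(1))
    have p2: "\<forall>(m, v, x, s)\<in>set bs. s = rev v \<and> v \<in> lists B" using Cons.prems(2) by simp
    have D0: "0 # v \<in> lists ?D" "s @ [0] \<in> lists ?D" using v by (auto simp: in_lists_conv_set)
    have "chunks (concat (map ?b (b # bs))) (map Inl s0) =
        (map Inl s0 @ map Inr (0 # v)) # chunks (concat (map ?b bs)) (map Inl (s @ [0]))"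
    proof -
      have "concat (map ?b (b # bs)) =
          map Some (map Inr (0 # v)) @ None # (map Some (map Inl (s @ [0])) @ concat (map ?b bs))"
        by (simp add: b)
      then show ?thesis by (simp only: chunks_map_append chunks.simps(2) append_Nil)
    qed
    moreover have "map Inl s0 @ map Inr (0 # v) \<in> ?K \<longleftrightarrow> rev s0 < 0 # v"
      using cmp[OF Cons.prems(1) D0(1)] Cons.prems(1) D0(1) by (auto simp: in_lists_conv_set)
    moreover have "(\<forall>c\<in>set (chunks (concat (map ?b bs)) (map Inl (s @ [0]))). c \<in> ?K) \<longleftrightarrow>
        sorted_wrt (<) ((0 # v) # map (\<lambda>(m, v, x, s). 0 # v) bs)"
      by (rule Cons.IH[OF D0(2) p2, unfolded e])
    ultimately show ?case
      by (simp only: list.set ball_simps b list.map prod.case sorted_wrt2[OF transp_on_less])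
  qed simp
  have "raw bs w \<in> {v \<in> lists C. tr (etr e_ord) None v \<in> ?L} \<longleftrightarrow> sorted_wrt (<) (map (\<lambda>(m, v, x, s). v) bs)"
    if r: "raw bs w \<in> lists C" and s: "\<forall>(m, v, x, s)\<in>set bs. s = rev v" for bs w
  proof -
    have 1: "em (e_ord (Some m)) (rblock m v x s) = map Some (map Inr (0 # v)) @ None # map Some (map Inl (s @ [0]))"
      for m v x s
      by (simp add: em_rblock em_map_Some[where h = "\<lambda>b. Some (Inl b)"] em_map_Some[where h = "\<lambda>b. Some (Inr b)"] em_map_None)
    have tr: "tr (etr e_ord) None (raw bs w) = concat (map ?b bs)"
      unfolding tr_raw 1 by (simp add: em_map_None)
    have "\<forall>(m, v, x, s)\<in>set bs. s = rev v \<and> v \<in> lists B" using s raw_lists(2)[OF r] by fastforce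
    from chain[OF _ this, of "[]"]
    have "raw bs w \<in> {v \<in> lists C. tr (etr e_ord) None v \<in> ?L} \<longleftrightarrow>
        sorted_wrt (<) ([] # map (\<lambda>(m, v, x, s). 0 # v) bs)"
      using r tr_lists[OF t r] by (simp add: tr)
    also have "\<dots> \<longleftrightarrow> sorted_wrt (<) (map (\<lambda>(m, v, x, s). v) bs)"
      by (simp add: sorted_wrt_map case_prod_unfold)
    finally show ?thesis .
  qed
  then show ?thesis using P by blast
qed

text \<open>The tests build on each other: the format supplies \<open>bs\<close>, \<open>w\<close>
  and the single mark that the test of the cursor presupposes, and the test of the inverse words
  supplies \<open>s = rev v\<close>, which the test of the order presupposes.\<close>

lemma P_L: "P_language C L"
proof -
  from P_positions obtain K1 where 1: "P_language C K1"
    "\<And>bs w. raw bs w \<in> lists C \<Longrightarrow> raw bs w \<in> K1 \<longleftrightarrow> (\<forall>b\<in>set bs. True \<longrightarrow> (\<lambda>(m, v, x, s). v) b \<in> LT)" by blast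
  from P_values obtain K2 where 2: "P_language C K2"
    "\<And>bs w. raw bs w \<in> lists C \<Longrightarrow> raw bs w \<in> K2 \<longleftrightarrow> (\<forall>b\<in>set bs. True \<longrightarrow> (\<lambda>(m, v, x, s). x) b \<in> LU)" by blast
  from P_trivial[of True] obtain K3 where 3: "P_language C K3"
    "\<And>bs w. raw bs w \<in> lists C \<Longrightarrow> raw bs w \<in> K3 \<longleftrightarrow> (\<forall>b\<in>set bs. (\<lambda>(m, v, x, s). (m = Triv) = True) b \<longrightarrow>
      (\<lambda>(m, v, x, s). x) b \<in> {x \<in> lists A. (x = repU \<one>\<^bsub>U\<^esub>) = True})" by blast
  from P_trivial[of False] obtain K4 where 4: "P_language C K4"
    "\<And>bs w. raw bs w \<in> lists C \<Longrightarrow> raw bs w \<in> K4 \<longleftrightarrow> (\<forall>b\<in>set bs. (\<lambda>(m, v, x, s). (m = Triv) = False) b \<longrightarrow>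
      (\<lambda>(m, v, x, s). x) b \<in> {x \<in> lists A. (x = repU \<one>\<^bsub>U\<^esub>) = False})" by blast
  from P_inverses obtain K5 where 5: "P_language C K5"
    "\<And>bs w. raw bs w \<in> lists C \<Longrightarrow> raw bs w \<in> K5 \<longleftrightarrow> (\<forall>(m, v, x, s)\<in>set bs. rev v = s)" by blast
  from P_order obtain K6 where 6: "P_language C K6"
    "\<And>bs w. raw bs w \<in> lists C \<Longrightarrow> \<forall>(m, v, x, s)\<in>set bs. s = rev v \<Longrightarrow>
      raw bs w \<in> K6 \<longleftrightarrow> sorted_wrt (<) (map (\<lambda>(m, v, x, s). v) bs)" by blast
  from P_cursor obtain K7 where 7: "P_language C K7"
    "\<And>bs w. raw bs w \<in> lists C \<Longrightarrow> marks bs = 1 \<Longrightarrow>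
      raw bs w \<in> K7 \<longleftrightarrow> (\<forall>(m, v, x, s)\<in>set bs. m \<noteq> Plain \<longrightarrow> rev s = w)" by blast
  let ?K0 = "{v \<in> lists C. \<exists>bs w. v = raw bs w \<and> marks bs = 1}"
  let ?K = "?K0 \<inter> (K1 \<inter> (K2 \<inter> (K3 \<inter> (K4 \<inter> (K5 \<inter> (K6 \<inter> K7))))))"
  have P: "P_language C ?K"
    by (intro P_language_Int P_format 1(1) 2(1) 3(1) 4(1) 5(1) 6(1) 7(1))
  have iff: "raw bs w \<in> K1 \<inter> (K2 \<inter> (K3 \<inter> (K4 \<inter> (K5 \<inter> (K6 \<inter> K7))))) \<longleftrightarrow> good bs w"
    if r: "raw bs w \<in> lists C" and m: "marks bs = 1" for bs w
  proof -
    let ?v = "\<lambda>(m, v, x, s). v"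
    obtain m0 v0 x0 s0 where b0: "(m0, v0, x0, s0) \<in> set bs" "m0 \<noteq> Plain"
        and uniq: "\<forall>(m1, v1, x1, s1)\<in>set bs. m1 \<noteq> Plain \<longrightarrow> (m1, v1, x1, s1) = (m0, v0, x0, s0)"
      by (rule one_mark[OF m]) (rule that)
    have xA: "x \<in> lists A" if "(m, v, x, s) \<in> set bs" for m v x s using raw_lists(2)[OF r that] by blast
    show ?thesis
    proof
      assume K: "raw bs w \<in> K1 \<inter> (K2 \<inter> (K3 \<inter> (K4 \<inter> (K5 \<inter> (K6 \<inter> K7)))))"
      have s: "\<forall>(m, v, x, s)\<in>set bs. s = rev v" using K 5(2)[OF r] by fastforce
      have sorted: "sorted_wrt (<) (map ?v bs)" using K 6(2)[OF r s] by simp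
      then have dist: "distinct (map ?v bs)" by (simp add: strict_sorted_iff)
      have cur: "\<forall>(m, v, x, s)\<in>set bs. m \<noteq> Plain \<longrightarrow> rev s = w" using K 7(2)[OF r m] by simp
      have v0: "v0 = w" using bspec[OF cur b0(1)] bspec[OF s b0(1)] b0(2) by simp
      have "s = rev v \<and> v \<in> LT \<and> x \<in> LU \<and> (x = repU \<one>\<^bsub>U\<^esub> \<longleftrightarrow> m = Triv) \<and> (m \<noteq> Plain \<longleftrightarrow> v = w)"
        if b: "(m, v, x, s) \<in> set bs" for m v x s
      proof -
        have "v \<in> LT" "x \<in> LU" using K 1(2)[OF r] 2(2)[OF r] b by fastforce+
        moreover have "x = repU \<one>\<^bsub>U\<^esub> \<longleftrightarrow> m = Triv"
          using K 3(2)[OF r] 4(2)[OF r] b by fastforce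
        moreover have "v = w" if "m \<noteq> Plain" using bspec[OF uniq b] that v0 by simp
        \<comment> \<open>Positions are distinct, so a block at \<open>w\<close> must be the marked
          one.\<close>
        moreover have "m \<noteq> Plain" if "v = w"
        proof -
          have "inj_on ?v (set bs)" using dist by (simp add: distinct_map)
          then have "(m, v, x, s) = (m0, v0, x0, s0)" by (rule inj_onD) (use b b0 that v0 in simp_all)
          then show ?thesis using b0(2) by simp
        qed
        ultimately show ?thesis using bspec[OF s b] by auto
      qed
      moreover have "w \<in> ?v ` set bs" using b0(1) v0 by force
      ultimately show "good bs w" unfolding good_def using sorted by blast
    next
      assume g: "good bs w"
      have b: "s = rev v \<and> v \<in> LT \<and> x \<in> LU \<and> (x = repU \<one>\<^bsub>U\<^esub> \<longleftrightarrow> m = Triv) \<and> (m \<noteq> Plain \<longleftrightarrow> v = w)"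
        if "(m, v, x, s) \<in> set bs" for m v x s
        using g that unfolding good_def by fastforce
      have s: "\<forall>(m, v, x, s)\<in>set bs. s = rev v" using b by fastforce
      have "raw bs w \<in> K1" unfolding 1(2)[OF r] using b by fastforce
      moreover have "raw bs w \<in> K2" unfolding 2(2)[OF r] using b by fastforce
      moreover have "raw bs w \<in> K3" unfolding 3(2)[OF r] using b xA by fastforce
      moreover have "raw bs w \<in> K4" unfolding 4(2)[OF r] using b xA by fastforce
      moreover have "raw bs w \<in> K5" unfolding 5(2)[OF r] using b by fastforce
      moreover have "raw bs w \<in> K6" unfolding 6(2)[OF r s] using g by (simp add: good_def)
      moreover have "raw bs w \<in> K7" unfolding 7(2)[OF r m] using b by fastforce
      ultimately show "raw bs w \<in> K1 \<inter> (K2 \<inter> (K3 \<inter> (K4 \<inter> (K5 \<inter> (K6 \<inter> K7)))))" by blast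
    qed
  qed
  \<comment> \<open>Exactly one block sits at \<open>w\<close>, because positions are distinct, and
    the marked blocks are those at \<open>w\<close>.\<close>
  have marks: "marks bs = 1" if g: "good bs w" for bs w
  proof -
    let ?v = "\<lambda>(m, v, x, s). v"
    have sorted: "sorted_wrt (<) (map ?v bs)" and w: "w \<in> ?v ` set bs"
      and ball: "\<forall>(m, v, x, s)\<in>set bs. s = rev v \<and> v \<in> LT \<and> x \<in> LU \<and> (x = repU \<one>\<^bsub>U\<^esub> \<longleftrightarrow> m = Triv) \<and> (m \<noteq> Plain \<longleftrightarrow> v = w)"
      by (fact g[unfolded good_def, THEN conjunct1] g[unfolded good_def, THEN conjunct2, THEN conjunct2]
        g[unfolded good_def, THEN conjunct2, THEN conjunct1])+
    have "filter (\<lambda>(m, v, x, s). m \<noteq> Plain) bs = filter (\<lambda>c. ?v c = w) bs"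
    proof (rule filter_cong[OF refl])
      fix c assume "c \<in> set bs"
      from bspec[OF ball this] show "(\<lambda>(m, v, x, s). m \<noteq> Plain) c = (?v c = w)" by (cases c) simp
    qed
    then have "marks bs = length (filter (\<lambda>v. v = w) (map ?v bs))"
      by (simp add: marks_def filter_map comp_def)
    also have "\<dots> = card {w}"
    proof -
      have "distinct (map ?v bs)" using sorted by (simp add: strict_sorted_iff)
      then have "length (filter (\<lambda>v. v = w) (map ?v bs)) = card (set (filter (\<lambda>v. v = w) (map ?v bs)))"
        by (intro distinct_card[symmetric] distinct_filter)
      moreover have "set (filter (\<lambda>v. v = w) ws) = {w}" if "w \<in> set ws" for ws using that by auto
      then have "set (filter (\<lambda>v. v = w) (map ?v bs)) = {w}" using w by (simp only: list.set_map)
      ultimately show ?thesis by simp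
    qed
    finally show ?thesis by simp
  qed
  have "v \<in> ?K \<longleftrightarrow> v \<in> L" for v
  proof
    assume v: "v \<in> ?K"
    then obtain bs w where *: "v = raw bs w" "marks bs = 1" by blast
    then have "raw bs w \<in> lists C" "raw bs w \<in> K1 \<inter> (K2 \<inter> (K3 \<inter> (K4 \<inter> (K5 \<inter> (K6 \<inter> K7)))))"
      using v by simp_all
    then have "good bs w" using iff[OF _ *(2)] by blast
    then show "v \<in> L" unfolding L_def *(1) by blast
  next
    assume v: "v \<in> L"
    then obtain bs w where *: "v = raw bs w" "good bs w" unfolding L_def by blast
    have r: "raw bs w \<in> lists C" using v *(1) L_lists by blast
    note m = marks[OF *(2)]
    have "raw bs w \<in> K1 \<inter> (K2 \<inter> (K3 \<inter> (K4 \<inter> (K5 \<inter> (K6 \<inter> K7)))))" using iff[OF r m] *(2) by blast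
    then show "v \<in> ?K" unfolding *(1) using r m by blast
  qed
  then have "?K = L" by blast
  then show ?thesis using P by simp
qed

end

subsection \<open>The multiplication relations\<close>

text \<open>\<open>P_group\<close> asks for letters in \<open>nat\<close>. Decoding with
  \<open>from_nat\<close> is a transducer, so the language and the relations are transported as
  preimages. Surjectivity of the evaluation is inherited from the bijection on normal forms.\<close>

lemma P_group_countable_alphabet:
  fixes C :: "'c :: countable set"
  assumes G: "group G" and C: "finite C" and \<phi>: "\<phi> \<in> C \<rightarrow> carrier G" and L: "P_structure G C \<phi> L"
  shows "P_group G"
proof -
  define h :: "'c \<Rightarrow> nat" where "h = to_nat"
  define \<psi> where "\<psi> = \<phi> \<circ> (from_nat :: nat \<Rightarrow> 'c)"
  let ?\<delta> = "\<lambda>(_ :: unit) n. ((), Some (from_nat n :: 'c))"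
  have h [simp]: "from_nat (h c) = c" for c by (simp add: h_def)
  have tr: "tr ?\<delta> () v = map from_nat v" for v by (induction v) simp_all
  have mm [simp]: "map from_nat (map h v) = v" for v by (simp add: comp_def)
  have hm: "map h (map from_nat v) = v" if "v \<in> lists (h ` C)" for v
    using that by (induction v rule: list.induct) auto
  have lists: "map from_nat v \<in> lists C" if "v \<in> lists (h ` C)" for v
    using that by (induction v rule: list.induct) auto
  have lists': "map h v \<in> lists (h ` C)" if "v \<in> lists C" for v
    using that by (induction v rule: list.induct) auto
  have val: "word_value G \<psi> v = word_value G \<phi> (map from_nat v)" for v
    by (induction v) (simp_all add: word_value_Cons \<psi>_def)
  have t: "transducer UNIV () (h ` C) C ?\<delta>" by (auto simp: transducer_def)
  have LC: "L \<subseteq> lists C" and bij: "bij_betw (word_value G \<phi>) L (carrier G)" and PL: "P_language C L"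
    using L by (simp_all add: P_structure_def)
  have L': "map h ` L = {v \<in> lists (h ` C). tr ?\<delta> () v \<in> L}"
  proof
    show "map h ` L \<subseteq> {v \<in> lists (h ` C). tr ?\<delta> () v \<in> L}"
    proof
      fix v assume "v \<in> map h ` L"
      then obtain x where x: "x \<in> L" "v = map h x" by blast
      then show "v \<in> {v \<in> lists (h ` C). tr ?\<delta> () v \<in> L}"
        using lists'[of x] LC by (simp only: tr mm mem_Collect_eq) blast
    qed
    show "{v \<in> lists (h ` C). tr ?\<delta> () v \<in> L} \<subseteq> map h ` L"
    proof
      fix v assume "v \<in> {v \<in> lists (h ` C). tr ?\<delta> () v \<in> L}"
      then have v: "v \<in> lists (h ` C)" "map from_nat v \<in> L" unfolding tr by blast+
      show "v \<in> map h ` L" by (rule image_eqI[where x = "map from_nat v"]) (rule hm[OF v(1), symmetric], rule v(2))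
    qed
  qed
  have P: "P_language (h ` C) (map h ` L)"
    unfolding L' using C by (intro P_language_vimage[OF PL t]) simp
  have "word_value G \<psi> \<circ> map h = word_value G \<phi>"
    by (rule ext) (simp only: comp_apply val mm)
  then have "bij_betw (word_value G \<psi> \<circ> map h) L (carrier G)" using bij by simp
  moreover have "bij_betw (map h) L (map h ` L)"
    by (intro inj_on_imp_bij_betw inj_on_inverseI[of _ "map from_nat"]) (rule mm)
  ultimately have bij': "bij_betw (word_value G \<psi>) (map h ` L) (carrier G)"
    using bij_betw_comp_iff by blast
  have R: "ATP_language (h ` C) {(w, w'). w \<in> map h ` L \<and> w' \<in> map h ` L \<and>
      word_value G \<psi> w' = word_value G \<psi> (w @ [a])}" if a: "a \<in> h ` C" for a
  proof -
    obtain c where c: "c \<in> C" "a = h c" using a by blast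
    let ?R = "{(w, w'). w \<in> L \<and> w' \<in> L \<and> word_value G \<phi> w' = word_value G \<phi> (w @ [c])}"
    have "ATP_language C ?R" using L c unfolding P_structure_def by blast
    then have "ATP_language (h ` C) {(u, v). u \<in> lists (h ` C) \<and> v \<in> lists (h ` C) \<and> (tr ?\<delta> () u, tr ?\<delta> () v) \<in> ?R}"
      using C by (intro ATP_language_vimage[OF _ t]) simp_all
    also have "{(u, v). u \<in> lists (h ` C) \<and> v \<in> lists (h ` C) \<and> (tr ?\<delta> () u, tr ?\<delta> () v) \<in> ?R} =
        {(w, w'). w \<in> map h ` L \<and> w' \<in> map h ` L \<and> word_value G \<psi> w' = word_value G \<psi> (w @ [a])}"
      unfolding L' by (simp only: tr val c(2) map_append list.map h mem_Collect_eq prod.case) blast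
    finally show ?thesis .
  qed
  have \<psi>: "\<psi> \<in> h ` C \<rightarrow> carrier G" using \<phi> by (auto simp: \<psi>_def)
  have L'l: "map h ` L \<subseteq> lists (h ` C)" unfolding L' by blast
  have "word_value G \<psi> ` lists (h ` C) = carrier G"
  proof
    show "word_value G \<psi> ` lists (h ` C) \<subseteq> carrier G" using word_value_closed[OF G \<psi>] by blast
    show "carrier G \<subseteq> word_value G \<psi> ` lists (h ` C)"
      using bij' L'l unfolding bij_betw_def by blast
  qed
  moreover have "P_structure G (h ` C) \<psi> (map h ` L)"
    unfolding P_structure_def using L'l bij' P R by blast
  ultimately show ?thesis unfolding P_group_def using G C \<psi> by blast
qed

lemma concat_map_single:
  "distinct ws \<Longrightarrow> a \<in> set ws \<Longrightarrow> concat (map (\<lambda>v. if v = a then x else []) ws) = x"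
proof (induction ws)
  case (Cons w ws)
  have e: "concat (map (\<lambda>v. if v = a then x else []) ws) = []" if "a \<notin> set ws"
    using that by (induction ws) auto
  show ?case
  proof (cases "w = a")
    case True
    then show ?thesis using Cons.prems e by simp
  next
    case False
    then show ?thesis using Cons by simp
  qed
qed simp

section \<open>Separating what a generator changes from what it keeps\<close>

context wreath
begin

text \<open>For a generator of \<open>U\<close>, \<open>e_away\<close> extracts what is kept and
  \<open>e_here\<close> what changes; for a generator of \<open>T\<close> these are
  \<open>e_fun\<close> and \<open>e_end\<close>. \<open>e_away\<close> identifies
  \<open>Here\<close> and \<open>Triv\<close>, since the value at the cursor may become or cease to
  be trivial. \<open>e_fun\<close> deletes the block marked \<open>Triv\<close>, which is present
  only on account of the cursor.\<close>

fun e_away :: "mark option \<Rightarrow> letter \<Rightarrow> letter option"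
  where
    "e_away q (UA a) = (if q = Some Plain then Some (UA a) else None)"
  | "e_away q (Mk m) = Some (Mk (if m = Plain then Plain else Here))"
  | "e_away q l = Some l"

fun e_here :: "mark option \<Rightarrow> letter \<Rightarrow> nat option"
  where
    "e_here (Some m) (UA a) = (if m = Plain then None else Some a)"
  | "e_here _ _ = None"

fun e_fun :: "mark option \<Rightarrow> letter \<Rightarrow> letter option"
  where
    "e_fun (Some m) l = (if m = Triv then None else case l of Mk _ \<Rightarrow> Some (Mk Plain) | _ \<Rightarrow> Some l)"
  | "e_fun None _ = None"

fun e_end :: "mark option \<Rightarrow> letter \<Rightarrow> nat option"
  where "e_end None (TB b) = Some b" | "e_end _ _ = None"

lemma transducers:
  "transducer UNIV None C C (etr e_away)" "transducer UNIV None C A (etr e_here)"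
  "transducer UNIV None C C (etr e_fun)" "transducer UNIV None C B (etr e_end)"
proof -
  have "set (olist (e_away q l)) \<subseteq> C" if "l \<in> C" for q l using that by (cases l) simp_all
  then show "transducer UNIV None C C (etr e_away)" by (rule transducer_etr)
  have "set (olist (e_here q l)) \<subseteq> A" if "l \<in> C" for q l
    using that by (cases "(q, l)" rule: e_here.cases) simp_all
  then show "transducer UNIV None C A (etr e_here)" by (rule transducer_etr)
  have "set (olist (e_fun q l)) \<subseteq> C" if "l \<in> C" for q l
    using that by (cases q; cases l) simp_all
  then show "transducer UNIV None C C (etr e_fun)" by (rule transducer_etr)
  have "set (olist (e_end q l)) \<subseteq> B" if "l \<in> C" for q l
    using that by (cases "(q, l)" rule: e_end.cases) simp_all
  then show "transducer UNIV None C B (etr e_end)" by (rule transducer_etr)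
qed

lemma tr_nf:
  "tr (etr e) None (nf f t) =
    concat (map (\<lambda>v. em (e (Some (mk f t v))) (block (mk f t v) v (repU (f (valT v))))) (positions f t)) @
      em (e None) (Fin # map TB (repT t))"
  by (simp add: nf_def tr_raw comp_def)

lemma mk_Plain: "mk f t v = Plain \<longleftrightarrow> valT v \<noteq> t"
  by (simp add: mk_def)

lemma tr_away: "tr (etr e_away) None (nf f t) =
    concat (map (\<lambda>v. block (if valT v = t then Here else Plain) v (if valT v = t then [] else repU (f (valT v)))) (positions f t)) @
      Fin # map TB (repT t)"
proof -
  have 1: "em (e_away (Some m)) (rblock m v x s) = (if m = Plain then rblock Plain v x s else rblock Here v [] s)" for m v x s
    by (simp add: rblock_def em_map_Some[where h = TB] em_map_Some[where h = TI] em_map_Some[where h = UA] em_map_None)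
  have 2: "em (e_away None) (Fin # map TB (repT t)) = Fin # map TB (repT t)"
    by (simp add: em_map_Some[where h = TB])
  have "em (e_away (Some (mk f t v))) (block (mk f t v) v (repU (f (valT v)))) =
      block (if valT v = t then Here else Plain) v (if valT v = t then [] else repU (f (valT v)))" for v
    by (cases "valT v = t") (simp_all add: 1 mk_Plain)
  then show ?thesis unfolding tr_nf 2 by simp
qed

lemma tr_here:
  assumes f: "f \<in> carrier N" and t: "t \<in> carrier T"
  shows "tr (etr e_here) None (nf f t) = repU (f t)"
proof -
  have "em (e_here (Some m)) (rblock m v x s) = (if m = Plain then [] else x)" for m v x s
    by (simp add: rblock_def em_map_Some[where h = "\<lambda>x. x"] em_map_None)
  moreover have "em (e_here None) (Fin # map TB (repT t)) = []"
    by (simp add: em_map_None)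
  ultimately have "tr (etr e_here) None (nf f t) =
      concat (map (\<lambda>v. if valT v \<noteq> t then [] else repU (f (valT v))) (positions f t))"
    unfolding tr_nf by (simp add: mk_Plain)
  also have "map (\<lambda>v. if valT v \<noteq> t then [] else repU (f (valT v))) (positions f t) =
      map (\<lambda>v. if v = repT t then repU (f t) else []) (positions f t)"
  proof (rule map_cong[OF refl])
    fix v assume "v \<in> set (positions f t)"
    then have "v \<in> LT" using valT_positions(2)[OF f t] by blast
    then have "v = repT t \<longleftrightarrow> valT v = t" using repT(3)[of v] repT(2)[OF t] by auto
    then show "(if valT v \<noteq> t then [] else repU (f (valT v))) = (if v = repT t then repU (f t) else [])" by simp
  qed
  also have "concat \<dots> = repU (f t)"
    using f by (intro concat_map_single distinct_positions) (simp add: set_positions)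
  finally show ?thesis .
qed

lemma tr_fun:
  assumes f: "f \<in> carrier N" and t: "t \<in> carrier T"
  shows "tr (etr e_fun) None (nf f t) =
    concat (map (\<lambda>v. block Plain v (repU (f (valT v)))) (sorted_list_of_set (repT ` supp f)))"
proof -
  have 1: "em (e_fun (Some m)) (rblock m v x s) = (if m \<noteq> Triv then rblock Plain v x s else [])" for m v x s
    by (simp add: rblock_def em_map_Some[where h = TB] em_map_Some[where h = TI] em_map_Some[where h = UA] em_map_None)
  have 2: "em (e_fun None) (Fin # map TB (repT t)) = []"
    by (simp add: em_map_None)
  have c: "concat (map (\<lambda>v. if P v then y v else []) ws) = concat (map y (filter P ws))" for P and y :: "nat list \<Rightarrow> letter list" and ws
    by (induction ws) auto
  have "tr (etr e_fun) None (nf f t) =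
      concat (map (\<lambda>v. block Plain v (repU (f (valT v)))) (filter (\<lambda>v. mk f t v \<noteq> Triv) (positions f t)))"
    unfolding tr_nf 1 2 c by simp
  \<comment> \<open>Only a cursor outside the support is marked \<open>Triv\<close>, so the
    positions that remain are those of the support.\<close>
  also have "filter (\<lambda>v. mk f t v \<noteq> Triv) (positions f t) = sorted_list_of_set (repT ` supp f)"
  proof (rule sorted_distinct_set_unique)
    have "sorted (positions f t)" by (simp only: positions_def sorted_list_of_set.sorted_sorted_key_list_of_set)
    then show "sorted (filter (\<lambda>v. mk f t v \<noteq> Triv) (positions f t))" by (rule sorted_wrt_filter)
    show "distinct (filter (\<lambda>v. mk f t v \<noteq> Triv) (positions f t))" by (simp add: distinct_positions)
    have "v \<in> repT ` supp f \<longleftrightarrow> mk f t v \<noteq> Triv" if v: "v \<in> repT ` insert t (supp f)" for v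
    proof -
      obtain y where y: "v = repT y" "y \<in> insert t (supp f)" using v by blast
      have yT: "y \<in> carrier T" using y(2) t supp_subset by blast
      then have vy: "valT v = y" by (simp add: y(1) repT(2))
      have "v \<in> repT ` supp f \<longleftrightarrow> y \<in> supp f"
      proof
        assume "v \<in> repT ` supp f"
        then obtain z where "v = repT z" "z \<in> supp f" by blast
        then have "valT v = z" using supp_subset repT(2) by blast
        then show "y \<in> supp f" using vy \<open>z \<in> supp f\<close> by simp
      qed (use y(1) in blast)
      also have "\<dots> \<longleftrightarrow> mk f t v \<noteq> Triv"
        using y(2) yT unfolding mk_def vy supp_def by auto
      finally show ?thesis .
    qed
    then show "set (filter (\<lambda>v. mk f t v \<noteq> Triv) (positions f t)) = set (sorted_list_of_set (repT ` supp f))"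
      using f by (auto simp: set_positions finite_supp)
  qed simp_all
  finally show ?thesis .
qed

lemma tr_end: "tr (etr e_end) None (nf f t) = repT t"
proof -
  have "em (e_end (Some m)) (rblock m v x s) = []" for m v x s
    by (simp add: rblock_def em_map_None)
  then show ?thesis unfolding tr_nf by (simp add: em_map_Some[where h = "\<lambda>x. x"])
qed

text \<open>The output of a transducer is again a word over \<^term>\<open>C\<close>, so its value in \<^term>\<open>G\<close> recovers
  the data that it depends on, and no unique readability has to be proved.\<close>

lemma tr_away_iff:
  assumes f: "f \<in> carrier N" "f' \<in> carrier N" and t: "t \<in> carrier T" "t' \<in> carrier T"
  shows "tr (etr e_away) None (nf f t) = tr (etr e_away) None (nf f' t') \<longleftrightarrow>
    t' = t \<and> (\<forall>y\<in>carrier T. y \<noteq> t \<longrightarrow> f' y = f y)"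
proof -
  \<comment> \<open>This is the function spelled after \<open>e_away\<close> has emptied the value
    at the cursor.\<close>
  define away where "away f t = (\<lambda>y\<in>carrier T. if y = t then \<one>\<^bsub>U\<^esub> else f y)" for f :: "'t \<Rightarrow> 'u" and t
  have val: "val (tr (etr e_away) None (nf f t)) = (away f t, t)"
    if f: "f \<in> carrier N" and t: "t \<in> carrier T" for f t
  proof -
    note p = valT_positions[OF f t]
    let ?x = "\<lambda>v. if valT v = t then [] else repU (f (valT v))"
    have fin: "finite {y \<in> carrier T. away f t y \<noteq> \<one>\<^bsub>U\<^esub>}"
      by (rule finite_subset[OF _ finite_supp[OF f]]) (auto simp: supp_def away_def)
    have "away f t y \<in> carrier U" if "y \<in> carrier T" for y
      using that f_closed[OF f that] by (simp add: away_def)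
    then have aN: "away f t \<in> carrier N" using fin by (auto simp: carrier_N PiE_iff away_def)
    have x: "?x v \<in> lists A \<and> away f t (valT v) = valU (?x v)" if v: "v \<in> set (positions f t)" for v
    proof -
      have vT: "valT v \<in> carrier T" using v p(2) valT_in by blast
      note fv = f_closed[OF f vT]
      show ?thesis using repU(1,2)[OF fv] LU_lists vT by (auto simp: away_def)
    qed
    have l: "concat (map (\<lambda>v. block (if valT v = t then Here else Plain) v (?x v)) (positions f t)) \<in> lists C"
      using p(2) LT_lists x by (intro blocks_lists) blast+
    have "supp (away f t) \<subseteq> valT ` set (positions f t)"
      unfolding p(1) by (auto simp: supp_def away_def)
    then have v: "val (concat (map (\<lambda>v. block (if valT v = t then Here else Plain) v (?x v)) (positions f t))) =
        (away f t, \<one>\<^bsub>T\<^esub>)"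
      using x p(2) by (intro val_positions[OF aN]) (simp_all only: distinct_positions)
    have "repT t \<in> lists B" using repT(1)[OF t] LT_lists by blast
    then show ?thesis unfolding tr_away using val_cursor[OF l v aN] repT(2)[OF t] by simp
  qed
  show ?thesis
  proof
    assume "tr (etr e_away) None (nf f t) = tr (etr e_away) None (nf f' t')"
    then have "(away f t, t) = (away f' t', t')" using val[OF f(1) t(1)] val[OF f(2) t(2)] by metis
    then have e: "away f t = away f' t'" "t' = t" by blast+
    have "f' y = f y" if "y \<in> carrier T" "y \<noteq> t" for y
      using fun_cong[OF e(1), of y] that e(2) by (simp add: away_def)
    then show "t' = t \<and> (\<forall>y\<in>carrier T. y \<noteq> t \<longrightarrow> f' y = f y)" using e(2) by blast
  next
    assume *: "t' = t \<and> (\<forall>y\<in>carrier T. y \<noteq> t \<longrightarrow> f' y = f y)"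
    \<comment> \<open>The cursor is listed for both functions, so a change of the value there leaves
      the positions alone.\<close>
    then have "insert t (supp f') = insert t (supp f)" by (auto simp: supp_def)
    then have pos: "positions f' t = positions f t" by (simp only: positions_def)
    have "f' (valT v) = f (valT v)" if "v \<in> set (positions f t)" "valT v \<noteq> t" for v
      using * that valT_in valT_positions(2)[OF f(1) t(1)] by blast
    then show "tr (etr e_away) None (nf f t) = tr (etr e_away) None (nf f' t')"
      using * unfolding tr_away by (auto simp: pos intro!: arg_cong[of _ _ concat] map_cong)
  qed
qed

lemma tr_fun_iff:
  assumes f: "f \<in> carrier N" "f' \<in> carrier N" and t: "t \<in> carrier T" "t' \<in> carrier T"
  shows "tr (etr e_fun) None (nf f t) = tr (etr e_fun) None (nf f' t') \<longleftrightarrow> f' = f"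
proof -
  have val: "val (tr (etr e_fun) None (nf f t)) = (f, \<one>\<^bsub>T\<^esub>)" if f: "f \<in> carrier N" and t: "t \<in> carrier T" for f t
    unfolding tr_fun[OF f t]
  proof (rule val_positions[OF f])
    have set: "set (sorted_list_of_set (repT ` supp f)) = repT ` supp f" by (simp add: finite_supp[OF f])
    show LT: "set (sorted_list_of_set (repT ` supp f)) \<subseteq> LT"
      unfolding set using supp_subset repT(1) by blast
    show "supp f \<subseteq> valT ` set (sorted_list_of_set (repT ` supp f))"
    proof
      fix y assume y: "y \<in> supp f"
      then have "y \<in> carrier T" using supp_subset by blast
      then have "y = valT (repT y)" by (rule repT(2)[symmetric])
      then show "y \<in> valT ` set (sorted_list_of_set (repT ` supp f))"
        unfolding set by (rule image_eqI) (rule imageI[OF y])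
    qed
    fix v assume "v \<in> set (sorted_list_of_set (repT ` supp f))"
    then have "v \<in> LT" using LT by blast
    then have "f (valT v) \<in> carrier U" by (rule f_closed[OF f valT_in])
    then show "repU (f (valT v)) \<in> lists A \<and> f (valT v) = valU (repU (f (valT v)))"
      using repU(1,2)[of "f (valT v)"] LU_lists by auto
  qed simp
  show ?thesis
  proof
    assume "tr (etr e_fun) None (nf f t) = tr (etr e_fun) None (nf f' t')"
    then have "(f, \<one>\<^bsub>T\<^esub>) = (f', \<one>\<^bsub>T\<^esub>)" using val[OF f(1) t(1)] val[OF f(2) t(2)] by metis
    then show "f' = f" by blast
  next
    assume "f' = f"
    then show "tr (etr e_fun) None (nf f t) = tr (etr e_fun) None (nf f' t')"
      unfolding tr_fun[OF f(1) t(1)] tr_fun[OF f(2) t(2)] by simp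
  qed
qed

lemma ATP_preimage:
  fixes e :: "mark option \<Rightarrow> letter \<Rightarrow> 'd option"
  assumes "ATP_language D R" "transducer UNIV None C D (etr e)"
  shows "ATP_language C {(v, v'). v \<in> L \<and> v' \<in> L \<and> (tr (etr e) None v, tr (etr e) None v') \<in> R}"
proof -
  have "ATP_language C (L \<times> L \<inter> {(u, v). u \<in> lists C \<and> v \<in> lists C \<and> (tr (etr e) None u, tr (etr e) None v) \<in> R})"
    by (intro ATP_language_Int ATP_language_Times P_L ATP_language_vimage[OF assms finite_C])
  also have "L \<times> L \<inter> {(u, v). u \<in> lists C \<and> v \<in> lists C \<and> (tr (etr e) None u, tr (etr e) None v) \<in> R} =
      {(v, v'). v \<in> L \<and> v' \<in> L \<and> (tr (etr e) None v, tr (etr e) None v') \<in> R}"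
    using L_lists by blast
  finally show ?thesis .
qed

lemma ATP_same:
  fixes e :: "mark option \<Rightarrow> letter \<Rightarrow> letter option"
  assumes "transducer UNIV None C C (etr e)"
  shows "ATP_language C {(v, v'). v \<in> L \<and> v' \<in> L \<and> tr (etr e) None v = tr (etr e) None v'}"
proof -
  have "{(v, v'). v \<in> L \<and> v' \<in> L \<and> (tr (etr e) None v, tr (etr e) None v') \<in> {(u, v). u \<in> lists C \<and> u = v}} =
      {(v, v'). v \<in> L \<and> v' \<in> L \<and> tr (etr e) None v = tr (etr e) None v'}"
  proof -
    have l: "tr (etr e) None v \<in> lists C" if "v \<in> L" for v
      using L_lists that by (intro tr_lists[OF assms]) blast
    have "(tr (etr e) None v, tr (etr e) None v') \<in> {(u, v). u \<in> lists C \<and> u = v} \<longleftrightarrow>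
        tr (etr e) None v = tr (etr e) None v'" if "v \<in> L" for v v'
      using l[OF that] by simp
    then show ?thesis by (intro Collect_cong) (simp add: case_prod_unfold cong: conj_cong)
  qed
  then show ?thesis using ATP_preimage[OF ATP_language_Id[OF finite_C] assms] by (simp only:)
qed

definition rel :: "letter \<Rightarrow> (letter list \<times> letter list) set"
  where "rel c = {(v, v'). v \<in> L \<and> v' \<in> L \<and> val v' = val (v @ [c])}"

lemma L_pairs:
  assumes "R \<subseteq> L \<times> L" "R' \<subseteq> L \<times> L"
    and "\<And>f t f' t'. f \<in> carrier N \<Longrightarrow> t \<in> carrier T \<Longrightarrow> f' \<in> carrier N \<Longrightarrow> t' \<in> carrier T \<Longrightarrow>
      (nf f t, nf f' t') \<in> R \<longleftrightarrow> (nf f t, nf f' t') \<in> R'"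
  shows "R = R'"
proof -
  have "\<exists>f\<in>carrier N. \<exists>t\<in>carrier T. v = nf f t" if "v \<in> L" for v
    using that unfolding L_def using good_imp_nf by blast
  then have "p \<in> R \<longleftrightarrow> p \<in> R'" if "p \<in> L \<times> L" for p
    using that assms(3) by (cases p) blast
  then show ?thesis using assms(1,2) by blast
qed

lemma nf_L: "f \<in> carrier N \<Longrightarrow> t \<in> carrier T \<Longrightarrow> nf f t \<in> L"
  using good_nf unfolding L_def nf_def by blast

lemma val_snoc:
  assumes "f \<in> carrier N" "t \<in> carrier T" "c \<in> C"
  shows "val (nf f t @ [c]) = (f, t) \<otimes>\<^bsub>G\<^esub> \<Phi> c"
proof -
  interpret G: group G by (rule G)
  have "\<Phi> c \<in> carrier G" using assms(3) \<Phi>_closed by blast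
  then show ?thesis using assms val_nf[OF assms(1,2)] by (simp add: val_append word_value_Cons)
qed

lemma rel_UA:
  assumes a: "a \<in> A"
  shows "ATP_language C (rel (UA a))"
proof -
  let ?R = "{(x, x'). x \<in> LU \<and> x' \<in> LU \<and> valU x' = valU (x @ [a])}"
  have R: "ATP_language A ?R" using LU a by (simp add: P_structure_def)
  let ?R1 = "{(v, v'). v \<in> L \<and> v' \<in> L \<and> tr (etr e_away) None v = tr (etr e_away) None v'}"
  let ?R2 = "{(v, v'). v \<in> L \<and> v' \<in> L \<and> (tr (etr e_here) None v, tr (etr e_here) None v') \<in> ?R}"
  have "ATP_language C (?R1 \<inter> ?R2)"
    by (intro ATP_language_Int ATP_same ATP_preimage[OF R] transducers)
  also have "?R1 \<inter> ?R2 = rel (UA a)"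
  proof (rule L_pairs)
    fix f t f' t' assume f: "f \<in> carrier N" "f' \<in> carrier N" and t: "t \<in> carrier T" "t' \<in> carrier T"
    have ft: "f t \<in> carrier U" "f' t' \<in> carrier U" using f t f_closed by blast+
    have xa: "repU (f t) \<in> lists A" using repU(1)[OF ft(1)] LU_lists by blast
    have \<phi>a: "\<phi> a \<in> carrier U" using \<phi> a by blast
    have "valU (repU (f t) @ [a]) = f t \<otimes>\<^bsub>U\<^esub> \<phi> a"
      using word_value_append[OF U \<phi> xa, of "[a]"] a repU(2)[OF ft(1)] \<phi>a by (simp add: word_value_Cons)
    then have 2: "(repU (f t), repU (f' t')) \<in> ?R \<longleftrightarrow> f' t' = f t \<otimes>\<^bsub>U\<^esub> \<phi> a"
      using repU(1,2)[OF ft(1)] repU(1,2)[OF ft(2)] by simp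
    \<comment> \<open>Translation by \<open>t\<close> moves the point mass of the generator from the
      identity to the cursor, so \<open>f\<close> is multiplied at \<open>t\<close> only.\<close>
    have "val (nf f t @ [UA a]) = ((\<lambda>y\<in>carrier T. f y \<otimes>\<^bsub>U\<^esub> delta t (\<phi> a) y), t)"
      using f t a by (simp add: val_snoc mult_G translate_delta)
    then have "(nf f t, nf f' t') \<in> rel (UA a) \<longleftrightarrow> f' = (\<lambda>y\<in>carrier T. f y \<otimes>\<^bsub>U\<^esub> delta t (\<phi> a) y) \<and> t' = t"
      using f t by (simp add: rel_def nf_L val_nf(1))
    also have "\<dots> \<longleftrightarrow> t' = t \<and> (\<forall>y\<in>carrier T. y \<noteq> t \<longrightarrow> f' y = f y) \<and> f' t' = f t \<otimes>\<^bsub>U\<^esub> \<phi> a"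
    proof
      assume *: "f' = (\<lambda>y\<in>carrier T. f y \<otimes>\<^bsub>U\<^esub> delta t (\<phi> a) y) \<and> t' = t"
      have "f' y = f y" if "y \<in> carrier T" "y \<noteq> t" for y
        using * that f_closed[OF f(1) that(1)] by (simp add: delta_def)
      then show "t' = t \<and> (\<forall>y\<in>carrier T. y \<noteq> t \<longrightarrow> f' y = f y) \<and> f' t' = f t \<otimes>\<^bsub>U\<^esub> \<phi> a"
        using * t by (simp add: delta_def)
    next
      assume *: "t' = t \<and> (\<forall>y\<in>carrier T. y \<noteq> t \<longrightarrow> f' y = f y) \<and> f' t' = f t \<otimes>\<^bsub>U\<^esub> \<phi> a"
      then have f't: "f' t = f t \<otimes>\<^bsub>U\<^esub> \<phi> a" by metis
      have "f' = (\<lambda>y\<in>carrier T. f y \<otimes>\<^bsub>U\<^esub> delta t (\<phi> a) y)"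
      proof (rule extensionalityI[of _ "carrier T"])
        show "f' \<in> extensional (carrier T)" using f(2) by (simp add: carrier_N PiE_def)
        fix y assume y: "y \<in> carrier T"
        show "f' y = (\<lambda>y\<in>carrier T. f y \<otimes>\<^bsub>U\<^esub> delta t (\<phi> a) y) y"
          using * y f_closed[OF f(1) y] f't by (cases "y = t") (simp_all add: delta_def)
      qed simp
      then show "f' = (\<lambda>y\<in>carrier T. f y \<otimes>\<^bsub>U\<^esub> delta t (\<phi> a) y) \<and> t' = t" using * by blast
    qed
    also have "\<dots> \<longleftrightarrow> (nf f t, nf f' t') \<in> ?R1 \<inter> ?R2"
      using tr_away_iff[OF f t] 2 f t by (simp add: tr_here nf_L)
    finally show "(nf f t, nf f' t') \<in> ?R1 \<inter> ?R2 \<longleftrightarrow> (nf f t, nf f' t') \<in> rel (UA a)" by blast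
  qed (auto simp: rel_def)
  finally show ?thesis .
qed

lemma rel_TB_iff:
  assumes f: "f \<in> carrier N" "f' \<in> carrier N" and t: "t \<in> carrier T" "t' \<in> carrier T" and b: "b \<in> B"
  shows "(nf f t, nf f' t') \<in> rel (TB b) \<longleftrightarrow> f' = f \<and> t' = t \<otimes>\<^bsub>T\<^esub> \<psi> b"
    and "(nf f t, nf f' t') \<in> rel (TI b) \<longleftrightarrow> f' = f \<and> t = t' \<otimes>\<^bsub>T\<^esub> \<psi> b"
proof -
  have \<psi>b: "\<psi> b \<in> carrier T" using \<psi> b by blast
  have "val (nf f t @ [TB b]) = (f, t \<otimes>\<^bsub>T\<^esub> \<psi> b)" "val (nf f t @ [TI b]) = (f, t \<otimes>\<^bsub>T\<^esub> inv\<^bsub>T\<^esub> \<psi> b)"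
    using f t b \<psi>b by (simp_all add: val_snoc mult_one_right del: one_sum_group)
  moreover have "t' = t \<otimes>\<^bsub>T\<^esub> inv\<^bsub>T\<^esub> \<psi> b \<longleftrightarrow> t = t' \<otimes>\<^bsub>T\<^esub> \<psi> b"
    using T.inv_solve_right[of t' t "\<psi> b"] t \<psi>b by simp
  ultimately show "(nf f t, nf f' t') \<in> rel (TB b) \<longleftrightarrow> f' = f \<and> t' = t \<otimes>\<^bsub>T\<^esub> \<psi> b"
    and "(nf f t, nf f' t') \<in> rel (TI b) \<longleftrightarrow> f' = f \<and> t = t' \<otimes>\<^bsub>T\<^esub> \<psi> b"
    using f t by (simp_all add: rel_def nf_L val_nf(1))
qed

lemma rel_TB:
  assumes b: "b \<in> B"
  shows "ATP_language C (rel (TB b))"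
proof -
  let ?R = "{(w, w'). w \<in> LT \<and> w' \<in> LT \<and> valT w' = valT (w @ [b])}"
  have R: "ATP_language B ?R" using LT b by (simp add: P_structure_def)
  let ?R1 = "{(v, v'). v \<in> L \<and> v' \<in> L \<and> tr (etr e_fun) None v = tr (etr e_fun) None v'}"
  let ?R2 = "{(v, v'). v \<in> L \<and> v' \<in> L \<and> (tr (etr e_end) None v, tr (etr e_end) None v') \<in> ?R}"
  have "ATP_language C (?R1 \<inter> ?R2)"
    by (intro ATP_language_Int ATP_same ATP_preimage[OF R] transducers)
  also have "?R1 \<inter> ?R2 = rel (TB b)"
  proof (rule L_pairs)
    fix f t f' t' assume f: "f \<in> carrier N" "f' \<in> carrier N" and t: "t \<in> carrier T" "t' \<in> carrier T"
    have w: "repT t \<in> lists B" using repT(1)[OF t(1)] LT_lists by blast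
    have \<psi>b: "\<psi> b \<in> carrier T" using \<psi> b by blast
    have "valT (repT t @ [b]) = t \<otimes>\<^bsub>T\<^esub> \<psi> b"
      using word_value_append[OF T \<psi> w, of "[b]"] b repT(2)[OF t(1)] \<psi>b by (simp add: word_value_Cons)
    then have "(repT t, repT t') \<in> ?R \<longleftrightarrow> t' = t \<otimes>\<^bsub>T\<^esub> \<psi> b"
      using repT(1,2)[OF t(1)] repT(1,2)[OF t(2)] by simp
    then show "(nf f t, nf f' t') \<in> ?R1 \<inter> ?R2 \<longleftrightarrow> (nf f t, nf f' t') \<in> rel (TB b)"
      using tr_fun_iff[OF f t] rel_TB_iff(1)[OF f t b] f t by (simp add: tr_end nf_L)
  qed (auto simp: rel_def)
  finally show ?thesis .
qed

text \<open>Right multiplication by the inverse of a generator relates the same pairs in the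
  opposite order.\<close>

lemma rel_TI:
  assumes b: "b \<in> B"
  shows "ATP_language C (rel (TI b))"
proof -
  have "(rel (TB b))\<inverse> = rel (TI b)"
  proof (rule L_pairs)
    fix f t f' t' assume f: "f \<in> carrier N" "f' \<in> carrier N" and t: "t \<in> carrier T" "t' \<in> carrier T"
    show "(nf f t, nf f' t') \<in> (rel (TB b))\<inverse> \<longleftrightarrow> (nf f t, nf f' t') \<in> rel (TI b)"
      unfolding converse_iff rel_TB_iff(1)[OF f(2,1) t(2,1) b] rel_TB_iff(2)[OF f t b] by blast
  qed (auto simp: rel_def)
  then show ?thesis using ATP_language_converse[OF rel_TB[OF b]] by simp
qed

text \<open>Letters of trivial value do not move an element, and different normal forms have
  different values, so the relation is the diagonal of \<open>L\<close>.\<close>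

lemma rel_one:
  assumes "c \<in> C" "\<Phi> c = \<one>\<^bsub>G\<^esub>"
  shows "ATP_language C (rel c)"
proof -
  interpret G: group G by (rule G)
  have "L \<times> L \<inter> {(u, v). u \<in> lists C \<and> u = v} = rel c"
  proof (rule L_pairs)
    fix f t f' t' assume *: "f \<in> carrier N" "t \<in> carrier T" "f' \<in> carrier N" "t' \<in> carrier T"
    then have "(f, t) \<in> carrier G" by (simp add: carrier_G)
    then have "val (nf f t @ [c]) = (f, t)" using * assms by (simp add: val_snoc)
    then have "(nf f t, nf f' t') \<in> rel c \<longleftrightarrow> f' = f \<and> t' = t"
      using * by (simp add: rel_def nf_L val_nf(1))
    moreover have "nf f t = nf f' t' \<longleftrightarrow> f' = f \<and> t' = t"
      using val_nf(1)[OF *(1,2)] val_nf(1)[OF *(3,4)] by (metis prod.inject)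
    ultimately show "(nf f t, nf f' t') \<in> L \<times> L \<inter> {(u, v). u \<in> lists C \<and> u = v} \<longleftrightarrow> (nf f t, nf f' t') \<in> rel c"
      using * val_nf(2) by (simp add: nf_L)
  qed (auto simp: rel_def)
  then show ?thesis
    using ATP_language_Int[OF ATP_language_Times[OF P_L] ATP_language_Id[OF finite_C]] by simp
qed

lemma P_group_G: "P_group G"
proof (rule P_group_countable_alphabet[OF G finite_C \<Phi>_closed])
  have "ATP_language C (rel c)" if "c \<in> C" for c
    using that rel_UA rel_TB rel_TI rel_one[OF that] by (cases c) simp_all
  then show "P_structure G C \<Phi> L"
    unfolding P_structure_def using L_lists bij_L P_L by (simp add: rel_def)
qed

end

theorem theorem5p4:
  fixes U :: "('u, 'x) monoid_scheme" and T :: "('t, 'y) monoid_scheme"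
  assumes "P_group U" and "P_group T"
  shows "P_group (wreath_product U T)"
proof -
  obtain A :: "nat set" and \<phi> LU where "finite A" "\<phi> \<in> A \<rightarrow> carrier U" "P_structure U A \<phi> LU" "group U"
    using assms(1) unfolding P_group_def by blast
  moreover obtain B :: "nat set" and \<psi> LT where "finite B" "\<psi> \<in> B \<rightarrow> carrier T" "P_structure T B \<psi> LT" "group T"
    using assms(2) unfolding P_group_def by blast
  ultimately have "wreath U T A B \<phi> \<psi> LU LT" by (intro wreath.intro)
  then show ?thesis by (rule wreath.P_group_G)
qed

end
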